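(* Let $M=\mathbb{P}^2\setminus C$ be the complement of a plane curve arrangement $C$, let $E\subset H^1(M,\mathbb{C})$ be a maximal isotropic subspace with $\dim E\ge 2$, and let $f_E:M\to S_E$ be the mapping associated to $E$. If the arrangement $C$ is given, then the mapping $f_E$ is determined by the vector subspace $E\subset H^1(M,\mathbb{C})$.
   Context: $C\subset\mathbb{P}^2$ is a reduced complex plane curve, regarded as the arrangement of its irreducible components. A linear subspace $E\subset H^1(M,\mathbb{C})$ is isotropic if the cup product $H^1(M,\mathbb{C})\times H^1(M,\mathbb{C})\to H^2(M,\mathbb{C})$ vanishes on $E\times E$, and maximal isotropic if it is maximal for inclusion among isotropic subspaces. For $X=M$ or $X=S_E$, $\mathbb{T}(X)=\mathrm{Hom}(H_1(X,\mathbb{Z}),\mathbb{C}^* )$ parametrizes the rank one complex local systems on $X$, and $\mathcal{V}_1(M)=\{\rho\in\mathbb{T}(M):\dim H^1(M,\mathcal{L}_\rho)\ge1\}$, with $\mathcal{L}_\rho$ the local system attached to $\rho$. The exponential map $H^1(M,\mathbb{C})\to\mathbb{T}(M)$ induces an isomorphism of analytic germs between the resonance variety $\mathcal{R}_1(M)=\{z\in H^1(M,\mathbb{C}):\{w\in H^1(M,\mathbb{C}):w\cup z=0\}/\mathbb{C}z\ne0\}$ at $0$ and $\mathcal{V}_1(M)$ at $1$. For $\dim E\ge2$, $E$ is an irreducible component of $\mathcal{R}_1(M)$, and $W_E$ denotes the irreducible component of $\mathcal{V}_1(M)$ corresponding to it, so that $1\in W_E$ and $T_1W_E=E$. By results of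 Arapura, $W_E$ corresponds to a surjective morphism $f_E:M\to S_E$ with connected generic fiber such that $W_E=f_E^*(\mathbb{T}(S_E))$, where $S_E=\mathbb{P}^1\setminus B$ with $B$ a finite set, $|B|=\dim E+1$; this is the mapping associated to $E$. *)

theory Defs
  imports
    "HOL-Analysis.Analysis"
    "HOL-Homology.Homology"
    "HOL-Algebra.Module"
    "HOL-Algebra.AbelCoset"
    "HOL-Algebra.Multiplicative_Group"
begin

section \<open>Complex projective space\<close>

text \<open>A point of \<open>'n cproj\<close> is a complex line through the origin of \<open>\<complex>\<^sup>n\<close>, so \<open>3 cproj\<close> is the
  projective plane and \<open>2 cproj\<close> the projective line.\<close>

typedef (overloaded) ('n::finite) cproj =
  "{vec.span {v} | v :: complex ^ 'n. v \<noteq> 0}"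
proof -
  have "axis undefined 1 \<noteq> (0 :: complex ^ 'n)"
    by (simp add: axis_eq_0_iff)
  then show ?thesis by blast
qed

definition proj_point :: "complex ^ 'n \<Rightarrow> ('n::finite) cproj" where
  "proj_point v = Abs_cproj (vec.span {v})"

text \<open>The classical topology is the quotient topology of the punctured affine space.\<close>

instantiation cproj :: (finite) topological_space
begin

definition open_cproj :: "'a cproj set \<Rightarrow> bool" where
  "open_cproj U \<longleftrightarrow> open {v. v \<noteq> 0 \<and> proj_point v \<in> U}"

instance
proof
  show "open (UNIV :: 'a cproj set)"
  proof -
    have "{v :: complex ^ 'a. v \<noteq> 0} = - {0}" by auto
    then show ?thesis by (simp add: open_cproj_def open_Compl)
  qed
next
  fix S T :: "'a cproj set"
  assume "open S" "open T"
  moreover have "{v. v \<noteq> 0 \<and> proj_point v \<in> S \<inter> T}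
      = {v. v \<noteq> 0 \<and> proj_point v \<in> S} \<inter> {v. v \<noteq> 0 \<and> proj_point v \<in> T}"
    by auto
  ultimately show "open (S \<inter> T)"
    by (simp add: open_cproj_def open_Int)
next
  fix K :: "'a cproj set set"
  assume *: "\<forall>S\<in>K. open S"
  have "{v. v \<noteq> 0 \<and> proj_point v \<in> \<Union>K} = (\<Union>S\<in>K. {v. v \<noteq> 0 \<and> proj_point v \<in> S})"
    by auto
  with * show "open (\<Union>K)"
    by (simp add: open_cproj_def open_UN)
qed

end

definition homogeneous_poly :: "nat \<Rightarrow> (complex ^ ('n::finite) \<Rightarrow> complex) \<Rightarrow> bool" where
  "homogeneous_poly d g \<longleftrightarrow>
    (\<exists>A c. finite A \<and> (\<forall>m\<in>A. (\<Sum>i\<in>UNIV. m i) = d) \<and>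
       g = (\<lambda>x. \<Sum>m\<in>A. c m * (\<Prod>i\<in>UNIV. (x $ i) ^ (m i :: nat))))"

text \<open>A reduced curve is determined by its point set, and every zero set of a nonzero form of
  positive degree is the point set of the reduced curve defined by the radical of that form.\<close>

definition plane_curve :: "3 cproj set \<Rightarrow> bool" where
  "plane_curve C \<longleftrightarrow>
    (\<exists>d g. d \<ge> 1 \<and> homogeneous_poly d g \<and> g \<noteq> (\<lambda>_. 0) \<and>
       C = {proj_point v | v. v \<noteq> 0 \<and> g v = 0})"

text \<open>Morphisms of quasi-projective varieties: near each point of \<open>X\<close>, on a principal Zariski open
  set \<open>{h \<noteq> 0}\<close>, the map is given by forms \<open>F\<close> of a common degree without common zero. Only the
  values of \<open>f\<close> on \<open>X\<close> matter.\<close>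

definition regular_map ::
    "('m::finite) cproj set \<Rightarrow> ('n::finite) cproj set \<Rightarrow> ('m cproj \<Rightarrow> 'n cproj) \<Rightarrow> bool" where
  "regular_map X Y f \<longleftrightarrow> f ` X \<subseteq> Y \<and>
    (\<forall>u. u \<noteq> 0 \<and> proj_point u \<in> X \<longrightarrow>
      (\<exists>d e h. \<exists>F :: complex ^ 'm \<Rightarrow> complex ^ 'n.
         (\<forall>j. homogeneous_poly d (\<lambda>v. F v $ j)) \<and> homogeneous_poly e h \<and> h u \<noteq> 0 \<and>
         (\<forall>v. v \<noteq> 0 \<and> proj_point v \<in> X \<and> h v \<noteq> 0 \<longrightarrow>
            F v \<noteq> 0 \<and> f (proj_point v) = proj_point (F v))))"

definition biregular_map ::
    "('m::finite) cproj set \<Rightarrow> ('n::finite) cproj set \<Rightarrow> ('m cproj \<Rightarrow> 'n cproj) \<Rightarrow> bool" where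
  "biregular_map X Y f \<longleftrightarrow> regular_map X Y f \<and>
    (\<exists>g. regular_map Y X g \<and> (\<forall>x\<in>X. g (f x) = x) \<and> (\<forall>y\<in>Y. f (g y) = y))"

text \<open>For maps to a curve \<open>Y\<close>: the nonempty Zariski open subsets are the cofinite ones.\<close>

definition connected_generic_fiber ::
    "('m::finite) cproj set \<Rightarrow> ('n::finite) cproj set \<Rightarrow> ('m cproj \<Rightarrow> 'n cproj) \<Rightarrow> bool" where
  "connected_generic_fiber X Y f \<longleftrightarrow>
    (\<exists>A. finite A \<and> (\<forall>y \<in> Y - A. connected {x \<in> X. f x = y}))"


section \<open>Quotient spaces and dimension\<close>

definition complex_ring :: "complex ring" where
  "complex_ring = \<lparr>carrier = UNIV, mult = (*), one = 1, zero = 0, add = (+)\<rparr>"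

text \<open>The multiplicative part of a \<open>module\<close> record is meaningless for modules and left unspecified
  below.\<close>

definition quotient_module :: "('k, 'v) module \<Rightarrow> 'v set \<Rightarrow> ('k, 'v set) module" where
  "quotient_module V N =
    \<lparr>carrier = a_rcosets\<^bsub>V\<^esub> N, mult = undefined, one = undefined,
     zero = N, add = set_add V,
     smult = (\<lambda>c A. \<Union>a\<in>A. N +>\<^bsub>V\<^esub> (c \<odot>\<^bsub>V\<^esub> a))\<rparr>"

definition lin_independent ::
    "('k, 'a) ring_scheme \<Rightarrow> ('k, 'v) module \<Rightarrow> nat \<Rightarrow> (nat \<Rightarrow> 'v) \<Rightarrow> bool" where
  "lin_independent K V n e \<longleftrightarrow>
    (\<forall>c \<in> {..<n} \<rightarrow> carrier K.
       (\<Oplus>\<^bsub>V\<^esub>i\<in>{..<n}. c i \<odot>\<^bsub>V\<^esub> e i) = \<zero>\<^bsub>V\<^esub> \<longrightarrow> (\<forall>i<n. c i = \<zero>\<^bsub>K\<^esub>))"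

text \<open>Dimension of a linear subspace \<open>E\<close> of \<open>V\<close>, possibly \<open>\<infinity>\<close>.\<close>

definition lin_dim :: "('k, 'a) ring_scheme \<Rightarrow> ('k, 'v) module \<Rightarrow> 'v set \<Rightarrow> enat" where
  "lin_dim K V E = Sup {enat n | n. \<exists>e \<in> {..<n} \<rightarrow> E. lin_independent K V n e}"


section \<open>Singular cohomology with coefficients in a rank one local system\<close>

type_synonym 'a cochain = "((nat \<Rightarrow> real) \<Rightarrow> 'a) \<Rightarrow> complex"

text \<open>A rank one local system with chosen bases of its stalks: \<open>L \<gamma>\<close> is the parallel transport along
  the path \<open>\<gamma>\<close>, from the stalk at \<open>\<gamma>(e\<^sub>0)\<close> to the stalk at \<open>\<gamma>(e\<^sub>1)\<close>. The condition on 2-simplices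
  says that transport depends only on the homotopy class and is compatible with composition.\<close>

definition local_system :: "'a topology \<Rightarrow> 'a cochain \<Rightarrow> bool" where
  "local_system X L \<longleftrightarrow>
    (\<forall>\<gamma>. singular_simplex 1 X \<gamma> \<longrightarrow> L \<gamma> \<noteq> 0) \<and>
    (\<forall>\<tau>. singular_simplex 2 X \<tau> \<longrightarrow>
       L (singular_face 2 1 \<tau>) = L (singular_face 2 2 \<tau>) * L (singular_face 2 0 \<tau>))"

definition cochain_module :: "nat \<Rightarrow> 'a topology \<Rightarrow> (complex, 'a cochain) module" where
  "cochain_module p X =
    \<lparr>carrier = {\<phi>. \<forall>\<sigma>. \<not> singular_simplex p X \<sigma> \<longrightarrow> \<phi> \<sigma> = 0},
     mult = undefined, one = undefined,
     zero = (\<lambda>\<sigma>. 0), add = (\<lambda>\<phi> \<psi> \<sigma>. \<phi> \<sigma> + \<psi> \<sigma>), smult = (\<lambda>c \<phi> \<sigma>. c * \<phi> \<sigma>)\<rparr>"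

text \<open>The front \<open>p\<close>-face and the back \<open>q\<close>-face of a \<open>(p+q)\<close>-simplex.\<close>

definition front_face :: "nat \<Rightarrow> ((nat \<Rightarrow> real) \<Rightarrow> 'a) \<Rightarrow> (nat \<Rightarrow> real) \<Rightarrow> 'a" where
  "front_face p \<sigma> = restrict \<sigma> (standard_simplex p)"

definition back_face :: "nat \<Rightarrow> nat \<Rightarrow> ((nat \<Rightarrow> real) \<Rightarrow> 'a) \<Rightarrow> (nat \<Rightarrow> real) \<Rightarrow> 'a" where
  "back_face p q \<sigma> =
    restrict (\<lambda>x. \<sigma> (\<lambda>i. if i < p then 0 else x (i - p))) (standard_simplex q)"

text \<open>The value of a cochain on \<open>\<sigma>\<close> lies in the stalk at the vertex \<open>\<sigma>(e\<^sub>0)\<close>. The 0-th face starts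
  at \<open>\<sigma>(e\<^sub>1)\<close>, so its value is transported back along the first edge.\<close>

definition coboundary ::
    "nat \<Rightarrow> 'a topology \<Rightarrow> 'a cochain \<Rightarrow> 'a cochain \<Rightarrow> 'a cochain" where
  "coboundary p X L \<phi> = (\<lambda>\<sigma>.
     if singular_simplex (Suc p) X \<sigma>
     then inverse (L (front_face 1 \<sigma>)) * \<phi> (singular_face (Suc p) 0 \<sigma>)
          + (\<Sum>k=1..Suc p. (-1) ^ k * \<phi> (singular_face (Suc p) k \<sigma>))
     else 0)"

definition cocycles :: "nat \<Rightarrow> 'a topology \<Rightarrow> 'a cochain \<Rightarrow> 'a cochain set" where
  "cocycles p X L =
    {\<phi> \<in> carrier (cochain_module p X). coboundary p X L \<phi> = (\<lambda>\<sigma>. 0)}"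

definition coboundaries :: "nat \<Rightarrow> 'a topology \<Rightarrow> 'a cochain \<Rightarrow> 'a cochain set" where
  "coboundaries p X L =
    (case p of 0 \<Rightarrow> {\<lambda>\<sigma>. 0}
     | Suc q \<Rightarrow> coboundary q X L ` carrier (cochain_module q X))"

definition twisted_cohomology ::
    "nat \<Rightarrow> 'a topology \<Rightarrow> 'a cochain \<Rightarrow> (complex, 'a cochain set) module" where
  "twisted_cohomology p X L =
    quotient_module ((cochain_module p X)\<lparr>carrier := cocycles p X L\<rparr>) (coboundaries p X L)"

abbreviation cohomology :: "nat \<Rightarrow> 'a topology \<Rightarrow> (complex, 'a cochain set) module" where
  "cohomology p X \<equiv> twisted_cohomology p X (\<lambda>\<gamma>. 1)"

definition cup_cochain :: "nat \<Rightarrow> nat \<Rightarrow> 'a topology \<Rightarrow> 'a cochain \<Rightarrow> 'a cochain \<Rightarrow> 'a cochain" where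
  "cup_cochain p q X \<phi> \<psi> = (\<lambda>\<sigma>.
     if singular_simplex (p + q) X \<sigma> then \<phi> (front_face p \<sigma>) * \<psi> (back_face p q \<sigma>) else 0)"

definition cup ::
    "nat \<Rightarrow> nat \<Rightarrow> 'a topology \<Rightarrow> 'a cochain set \<Rightarrow> 'a cochain set \<Rightarrow> 'a cochain set" where
  "cup p q X a b =
    (\<Union>\<phi>\<in>a. \<Union>\<psi>\<in>b. coboundaries (p + q) X (\<lambda>\<gamma>. 1)
        +>\<^bsub>cochain_module (p + q) X\<^esub> cup_cochain p q X \<phi> \<psi>)"

definition isotropic :: "'a topology \<Rightarrow> 'a cochain set set \<Rightarrow> bool" where
  "isotropic X E \<longleftrightarrow> submodule E complex_ring (cohomology 1 X) \<and>
    (\<forall>a\<in>E. \<forall>b\<in>E. cup 1 1 X a b = \<zero>\<^bsub>cohomology 2 X\<^esub>)"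

definition maximal_isotropic :: "'a topology \<Rightarrow> 'a cochain set set \<Rightarrow> bool" where
  "maximal_isotropic X E \<longleftrightarrow> isotropic X E \<and> (\<forall>E'. isotropic X E' \<and> E \<subseteq> E' \<longrightarrow> E' = E)"

definition resonance_variety :: "'a topology \<Rightarrow> 'a cochain set set" where
  "resonance_variety X =
    {z \<in> carrier (cohomology 1 X).
       let Cz = {t \<odot>\<^bsub>cohomology 1 X\<^esub> z | t. t \<in> carrier complex_ring};
           K = {w \<in> carrier (cohomology 1 X). cup 1 1 X w z = \<zero>\<^bsub>cohomology 2 X\<^esub>};
           Q = quotient_module ((cohomology 1 X)\<lparr>carrier := K\<rparr>) Cz
       in carrier Q \<noteq> {\<zero>\<^bsub>Q\<^esub>}}"


section \<open>Characters and characteristic varieties\<close>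

definition char_torus :: "'a topology \<Rightarrow> ('a chain set \<Rightarrow> complex) set" where
  "char_torus X =
    hom (homology_group 1 X) (mult_of complex_ring) \<inter> extensional (carrier (homology_group 1 X))"

definition trivial_char :: "'a topology \<Rightarrow> 'a chain set \<Rightarrow> complex" where
  "trivial_char X = (\<lambda>h \<in> carrier (homology_group 1 X). 1)"

definition pullback_char ::
    "'a topology \<Rightarrow> 'b topology \<Rightarrow> ('a \<Rightarrow> 'b) \<Rightarrow> ('b chain set \<Rightarrow> complex) \<Rightarrow> 'a chain set \<Rightarrow> complex" where
  "pullback_char X Y f \<rho> =
    (\<lambda>h \<in> carrier (homology_group 1 X). \<rho> (hom_induced 1 X {} Y {} f h))"

definition attached_local_system ::
    "'a topology \<Rightarrow> ('a chain set \<Rightarrow> complex) \<Rightarrow> 'a cochain \<Rightarrow> bool" where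
  "attached_local_system X \<rho> L \<longleftrightarrow> local_system X L \<and>
    (\<forall>c. singular_relcycle 1 X {} c \<longrightarrow>
       \<rho> (homologous_rel_set 1 X {} c)
         = (\<Prod>\<gamma>\<in>Poly_Mapping.keys c. L \<gamma> powi Poly_Mapping.lookup c \<gamma>))"

text \<open>The local system attached to a character exists and is unique up to isomorphism.\<close>

definition char_variety :: "'a topology \<Rightarrow> ('a chain set \<Rightarrow> complex) set" where
  "char_variety X =
    {\<rho> \<in> char_torus X. \<exists>L. attached_local_system X \<rho> L \<and>
       lin_dim complex_ring (twisted_cohomology 1 X L) (carrier (twisted_cohomology 1 X L)) \<ge> 1}"

text \<open>The Zariski topology of the character torus: its coordinate ring is the group algebra of the
  first homology group, spanned by the evaluations \<open>\<rho> \<mapsto> \<rho> h\<close>.\<close>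

definition regular_function :: "'a topology \<Rightarrow> (('a chain set \<Rightarrow> complex) \<Rightarrow> complex) \<Rightarrow> bool" where
  "regular_function X g \<longleftrightarrow>
    (\<exists>A c. finite A \<and> A \<subseteq> carrier (homology_group 1 X) \<and> g = (\<lambda>\<rho>. \<Sum>h\<in>A. c h * \<rho> h))"

definition zariski_closed :: "'a topology \<Rightarrow> ('a chain set \<Rightarrow> complex) set \<Rightarrow> bool" where
  "zariski_closed X Z \<longleftrightarrow>
    (\<exists>G. (\<forall>g\<in>G. regular_function X g) \<and> Z = {\<rho> \<in> char_torus X. \<forall>g\<in>G. g \<rho> = 0})"

definition zariski_irreducible :: "'a topology \<Rightarrow> ('a chain set \<Rightarrow> complex) set \<Rightarrow> bool" where
  "zariski_irreducible X Z \<longleftrightarrow> Z \<noteq> {} \<and> Z \<subseteq> char_torus X \<and>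
    (\<forall>A B. zariski_closed X A \<and> zariski_closed X B \<and> Z \<subseteq> A \<union> B \<longrightarrow> Z \<subseteq> A \<or> Z \<subseteq> B)"

definition irreducible_component ::
    "'a topology \<Rightarrow> ('a chain set \<Rightarrow> complex) set \<Rightarrow> ('a chain set \<Rightarrow> complex) set \<Rightarrow> bool" where
  "irreducible_component X V W \<longleftrightarrow> W \<subseteq> V \<and> zariski_irreducible X W \<and>
    (\<forall>W'. W \<subseteq> W' \<and> W' \<subseteq> V \<and> zariski_irreducible X W' \<longrightarrow> W' = W)"


section \<open>The exponential map and the mapping associated to an isotropic subspace\<close>

definition cochain_eval :: "'a cochain \<Rightarrow> 'a chain \<Rightarrow> complex" where
  "cochain_eval \<phi> c = (\<Sum>\<sigma>\<in>Poly_Mapping.keys c. of_int (Poly_Mapping.lookup c \<sigma>) * \<phi> \<sigma>)"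

definition kronecker :: "'a cochain set \<Rightarrow> 'a chain set \<Rightarrow> complex" where
  "kronecker z h = (THE t. \<forall>\<phi>\<in>z. \<forall>c\<in>h. cochain_eval \<phi> c = t)"

definition exp_char :: "'a topology \<Rightarrow> 'a cochain set \<Rightarrow> 'a chain set \<Rightarrow> complex" where
  "exp_char X z = (\<lambda>h \<in> carrier (homology_group 1 X). exp (kronecker z h))"

text \<open>The classical topologies. Since the first homology group is finitely generated for the spaces
  considered here, these are the usual topologies of a finite-dimensional vector space and of a
  complex algebraic torus (times a finite group).\<close>

definition char_topology :: "'a topology \<Rightarrow> ('a chain set \<Rightarrow> complex) topology" where
  "char_topology X =
    subtopology (product_topology (\<lambda>h. euclidean) (carrier (homology_group 1 X))) (char_torus X)"

definition cohomology_topology :: "'a topology \<Rightarrow> 'a cochain set topology" where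
  "cohomology_topology X =
    pullback_topology (carrier (cohomology 1 X))
      (\<lambda>z. \<lambda>h \<in> carrier (homology_group 1 X). kronecker z h)
      (product_topology (\<lambda>h. euclidean) (carrier (homology_group 1 X)))"

definition corresponding_component ::
    "'a topology \<Rightarrow> 'a cochain set set \<Rightarrow> ('a chain set \<Rightarrow> complex) set \<Rightarrow> bool" where
  "corresponding_component X E W \<longleftrightarrow>
    irreducible_component X (char_variety X) W \<and>
    (\<exists>U U'. openin (cohomology_topology X) U \<and> \<zero>\<^bsub>cohomology 1 X\<^esub> \<in> U \<and>
       openin (char_topology X) U' \<and> trivial_char X \<in> U' \<and>
       homeomorphic_map (subtopology (cohomology_topology X) U) (subtopology (char_topology X) U')
         (exp_char X) \<and>
       exp_char X ` (resonance_variety X \<inter> U) = char_variety X \<inter> U' \<and>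
       exp_char X ` (E \<inter> U) = W \<inter> U')"

definition associated_map ::
    "3 cproj set \<Rightarrow> 3 cproj cochain set set \<Rightarrow> 2 cproj set \<Rightarrow> (3 cproj \<Rightarrow> 2 cproj) \<Rightarrow> bool" where
  "associated_map C E B f \<longleftrightarrow>
    (let M = top_of_set (- C); S = top_of_set (- B) in
      finite B \<and> enat (card B) = lin_dim complex_ring (cohomology 1 M) E + 1 \<and>
      regular_map (- C) (- B) f \<and> f ` (- C) = - B \<and> connected_generic_fiber (- C) (- B) f \<and>
      corresponding_component M E (pullback_char M S f ` char_torus S))"

end

theory Submission
  imports Defs
    "HOL-Complex_Analysis.Winding_Numbers"
    "HOL-Computational_Algebra.Fundamental_Theorem_Algebra"
    "HOL-Computational_Algebra.Polynomial_Factorial"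
    "HOL-Computational_Algebra.Field_as_Ring"
begin

text \<open>Let \<open>u\<close> be a coordinate on the target of \<open>f'\<close> with zero and pole in \<open>B'\<close>. Both pulled back tori
  agree near the trivial character, so for small real \<open>s\<close> the character that sends a loop
  \<open>\<gamma>\<close> to \<open>exp (s wind(u \<circ> f' \<circ> \<gamma>))\<close> factors through \<open>f\<close>. Evaluating it on small circles in
  a projective line \<open>L\<close> shows that the divisor of \<open>u \<circ> f'\<close> on \<open>L\<close> is a combination of the divisors
  \<open>f\<^sup>*(b)\<close>, \<open>b \<in> B\<close>, with coefficients that depend only on \<open>b\<close>; hence a power of \<open>u \<circ> f'\<close> is a
  function of \<open>f\<close> on \<open>L\<close>. Any two points of a fiber of \<open>f\<close> lie on a line, so \<open>u \<circ> f'\<close> takes only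
  countably many values on that fiber and is constant if the fiber is connected. By symmetry \<open>f\<close> and \<open>f'\<close>
  have the same general fibers. On a line, this forces the two pairs of coprime polynomials
  representing \<open>f\<close> and \<open>f'\<close> to span the same space, so they differ by a Moebius transformation, which
  does not depend on the line.\<close>

hide_const (open) up_ring.coeff up_ring.monom Coset.order module.smult

subsection \<open>Projective points, forms and regular maps\<close>

text \<open>A component of the characteristic variety is tied to \<open>E\<close> only near the
  trivial character, so the two tori can be compared only there. This is why a small real parameter
  \<open>s\<close> appears: on a small circle the character has the value \<open>exp (s * n)\<close>
  with an integer \<open>n\<close>, and since the exponent is real, the absolute value returns
  \<open>n\<close> without the ambiguity of a complex logarithm. The price is that the coefficient
  attached to \<open>b\<close>, which is \<open>ln (norm (\<rho> (\<delta> b))) / s\<close>, is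
  merely a real number. It is rational as soon as \<open>b\<close> is attained on a line, because a
  point of the line lies over at most one \<open>b\<close>; rationality is what makes a power of the
  coordinate a function of \<open>f\<close>. The coefficients do not depend on the line because a
  circle around a point of order \<open>k\<close> over \<open>b\<close> is sent to \<open>k\<close>
  times a class of the target that is fixed beforehand. Lines replace divisors on the plane by root
  orders of polynomials in one variable. The point at infinity of every line is chosen outside
  \<open>C\<close>, so that no zero or pole is lost there and degrees can be compared.\<close>

lemma proj_point_eq_span:
  assumes "v \<noteq> 0" "w \<noteq> 0"
  shows "proj_point v = proj_point w \<longleftrightarrow> vec.span {v} = vec.span {w}"
  unfolding proj_point_def using assms by (subst Abs_cproj_inject) auto

lemma proj_point_eq_iff:
  assumes "v \<noteq> 0" "w \<noteq> 0"
  shows "proj_point v = proj_point w \<longleftrightarrow> (\<exists>c. w = c *s v)"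
proof -
  have "vec.span {v} = vec.span {w} \<longleftrightarrow> (\<exists>c. w = c *s v)"
  proof
    assume "vec.span {v} = vec.span {w}"
    then have "w \<in> vec.span {v}" by (simp add: vec.span_base)
    then show "\<exists>c. w = c *s v" by (auto simp: vec.span_singleton)
  next
    assume "\<exists>c. w = c *s v"
    then obtain c where c: "w = c *s v" by blast
    with assms have "c \<noteq> 0" by auto
    then have v: "v = (1/c) *s w" using c by (simp add: vector_scalar_commute)
    show "vec.span {v} = vec.span {w}"
    proof (rule vec.span_eq[THEN iffD2], intro conjI)
      show "{v} \<subseteq> vec.span {w}" by (subst v) (simp add: vec.span_base vec.span_scale)
      show "{w} \<subseteq> vec.span {v}" by (subst c) (simp add: vec.span_base vec.span_scale)
    qed
  qed
  then show ?thesis using proj_point_eq_span[OF assms] by simp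
qed

lemma proj_point_scale: "c \<noteq> 0 \<Longrightarrow> v \<noteq> 0 \<Longrightarrow> proj_point (c *s v) = proj_point v"
  by (metis proj_point_eq_iff vector_mul_eq_0)

lemma proj_point_cases: obtains v where "v \<noteq> 0" "y = proj_point v"
proof -
  have "Rep_cproj y \<in> {vec.span {v} | v. v \<noteq> 0}" by (rule Rep_cproj)
  then obtain v where "v \<noteq> 0" "Rep_cproj y = vec.span {v}" by blast
  then have "y = proj_point v" by (metis Rep_cproj_inverse proj_point_def)
  then show ?thesis using \<open>v \<noteq> 0\<close> that by blast
qed

definition affine_cone :: "('n::finite) cproj set \<Rightarrow> (complex ^ 'n) set" where
  "affine_cone U = {v. v \<noteq> 0 \<and> proj_point v \<in> U}"

lemma open_cproj_iff_affine_cone: "open U \<longleftrightarrow> open (affine_cone U)"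
  by (simp add: open_cproj_def affine_cone_def)

lemma open_nonzero: "open {v :: complex ^ 'n. v \<noteq> 0}"
proof -
  have "{v :: complex ^ 'n. v \<noteq> 0} = - {0}" by auto
  then show ?thesis by (simp add: open_Compl)
qed

lemma continuous_on_proj_point: "continuous_on {v. v \<noteq> 0} proj_point"
proof (subst continuous_on_open_vimage[OF open_nonzero], intro allI impI)
  fix B :: "'a cproj set" assume "open B"
  moreover have "proj_point -` B \<inter> {v. v \<noteq> 0} = affine_cone B" by (auto simp: affine_cone_def)
  ultimately show "open (proj_point -` B \<inter> {v. v \<noteq> 0})" by (simp add: open_cproj_iff_affine_cone)
qed

text \<open>Openness in \<open>cproj\<close> is defined through the punctured cone, so continuity
  can be tested upstairs, where maps are given by polynomials.\<close>

lemma continuous_on_from_affine_cone: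
  assumes "open X" "continuous_on (affine_cone X) (\<lambda>v. f (proj_point v))"
  shows "continuous_on X f"
proof (subst continuous_on_open_vimage[OF assms(1)], intro allI impI)
  fix B :: "'b set" assume B: "open B"
  have oc: "open (affine_cone X)" using assms(1) by (simp add: open_cproj_iff_affine_cone)
  have "open ((\<lambda>v. f (proj_point v)) -` B \<inter> affine_cone X)"
    using assms(2) B oc by (simp add: continuous_on_open_vimage)
  moreover have "(\<lambda>v. f (proj_point v)) -` B \<inter> affine_cone X = affine_cone (f -` B \<inter> X)"
    by (auto simp: affine_cone_def)
  ultimately show "open (f -` B \<inter> X)" by (simp add: open_cproj_iff_affine_cone)
qed

section \<open>Forms, their restriction to lines, and regular maps\<close>

lemma homogeneous_poly_scale:
  assumes "homogeneous_poly d g" shows "g (c *s v) = c ^ d * g v"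
proof -
  obtain A k where A: "finite A" "\<forall>m\<in>A. (\<Sum>i\<in>UNIV. m i) = d"
    "g = (\<lambda>x. \<Sum>m\<in>A. k m * (\<Prod>i\<in>UNIV. (x $ i) ^ (m i :: nat)))"
    using assms unfolding homogeneous_poly_def by blast
  have "k m * (\<Prod>i\<in>UNIV. ((c *s v) $ i) ^ (m i)) = c ^ d * (k m * (\<Prod>i\<in>UNIV. (v $ i) ^ m i))"
    if "m \<in> A" for m
  proof -
    have "(\<Prod>i\<in>UNIV. ((c *s v) $ i) ^ (m i)) = (\<Prod>i\<in>UNIV. c ^ m i) * (\<Prod>i\<in>UNIV. (v $ i) ^ m i)"
      by (simp add: power_mult_distrib prod.distrib)
    also have "(\<Prod>i\<in>UNIV. c ^ m i) = c ^ d"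
      using A(2) that by (simp flip: power_sum)
    finally show ?thesis by simp
  qed
  then show ?thesis unfolding A(3) sum_distrib_left by (rule sum.cong[OF refl])
qed

lemma continuous_on_homogeneous_poly:
  assumes "homogeneous_poly d g" shows "continuous_on S g"
proof -
  obtain A k where A: "finite A"
    "g = (\<lambda>x. \<Sum>m\<in>A. k m * (\<Prod>i\<in>UNIV. (x $ i) ^ (m i :: nat)))"
    using assms unfolding homogeneous_poly_def by blast
  show ?thesis unfolding A(2) by (intro continuous_intros)
qed

text \<open>The numbers \<open>n i\<close> are only upper bounds for the degrees. The coefficient at
  the sum of the bounds is still multiplicative, since every other term of the convolution lies
  beyond one of the two bounds. Thus a coefficient of formal top degree can be read off even where
  the degree drops.\<close>

lemma degree_prod_le_sum:
  fixes f :: "'i \<Rightarrow> 'a::comm_semiring_1 poly"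
  assumes "finite I" "\<And>i. i \<in> I \<Longrightarrow> degree (f i) \<le> n i"
  shows "degree (prod f I) \<le> sum n I" "coeff (prod f I) (sum n I) = (\<Prod>i\<in>I. coeff (f i) (n i))"
proof -
  have "degree (prod f I) \<le> sum n I \<and> coeff (prod f I) (sum n I) = (\<Prod>i\<in>I. coeff (f i) (n i))"
    using assms
  proof (induction I rule: finite_induct)
    case empty show ?case by simp
  next
    case (insert x F)
    have *: "coeff (p * q) (m + k) = coeff p m * coeff q k"
      if "degree p \<le> m" "degree q \<le> k" for p q :: "'a poly" and m k
    proof -
      have "coeff (p * q) (m + k) = (\<Sum>i\<le>m + k. coeff p i * coeff q (m + k - i))"
        by (simp add: coeff_mult)
      also have "\<dots> = (\<Sum>i\<in>{m}. coeff p i * coeff q (m + k - i))"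
      proof (rule sum.mono_neutral_right)
        show "\<forall>i\<in>{..m + k} - {m}. coeff p i * coeff q (m + k - i) = 0"
        proof
          fix i assume i: "i \<in> {..m + k} - {m}"
          then consider "i > m" | "i < m" by fastforce
          then show "coeff p i * coeff q (m + k - i) = 0"
          proof cases
            case 1 then show ?thesis using that by (simp add: coeff_eq_0)
          next
            case 2 then have "m + k - i > degree q" using that by linarith
            then show ?thesis by (simp add: coeff_eq_0)
          qed
        qed
      qed auto
      finally show ?thesis by simp
    qed
    from insert have 1: "degree (f x) \<le> n x" "degree (prod f F) \<le> sum n F"
      "coeff (prod f F) (sum n F) = (\<Prod>i\<in>F. coeff (f i) (n i))" by auto
    have "degree (f x * prod f F) \<le> n x + sum n F"
      using degree_mult_le[of "f x" "prod f F"] 1 by linarith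
    with insert(1,2) *[OF 1(1,2)] 1(3) show ?case by simp
  qed
  then show "degree (prod f I) \<le> sum n I" "coeff (prod f I) (sum n I) = (\<Prod>i\<in>I. coeff (f i) (n i))"
    by auto
qed

text \<open>\<open>z\<close> is the point at infinity of the line \<open>a + t *s z\<close>, and the
  coefficient of degree \<open>d\<close> is the value there. If the form does not vanish at
  \<open>z\<close>, then \<open>q\<close> is nonzero of degree exactly \<open>d\<close>.\<close>

lemma homogeneous_poly_on_line:
  assumes "homogeneous_poly d g"
  obtains q where "\<And>t. poly q t = g (a + t *s z)" "degree q \<le> d" "coeff q d = g z"
proof -
  obtain A k where A: "finite A" "\<forall>m\<in>A. (\<Sum>i\<in>UNIV. m i) = d"
    "g = (\<lambda>x. \<Sum>m\<in>A. k m * (\<Prod>i\<in>UNIV. (x $ i) ^ (m i :: nat)))"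
    using assms unfolding homogeneous_poly_def by blast
  define T where "T m = (\<Prod>i\<in>UNIV. [:a $ i, z $ i:] ^ (m i :: nat))" for m
  \<comment> \<open>For \<open>y = 0\<close> the power is a constant polynomial, and its coefficient
    of degree \<open>n\<close> is \<open>0 ^ n\<close>, which is 1 for \<open>n = 0\<close>.\<close>
  have pw: "degree ([:x, y:] ^ n) \<le> n \<and> coeff ([:x, y:] ^ n) n = y ^ n" for x y :: complex and n
  proof (cases "y = 0")
    case True
    have "[:x:] ^ n = [:x ^ n:]" by (induction n) (auto simp: one_pCons)
    then show ?thesis using True by (cases n) auto
  next
    case False
    then have "degree ([:x, y:] ^ n) = n" by (simp add: degree_power_eq)
    then show ?thesis using lead_coeff_power[of "[:x, y:]" n] False by simp
  qed
  have T: "degree (T m) \<le> d" "coeff (T m) d = (\<Prod>i\<in>UNIV. (z $ i) ^ m i)" if "m \<in> A" for m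
    using degree_prod_le_sum[of UNIV "\<lambda>i. [:a $ i, z $ i:] ^ (m i)" m] pw A(2) that
    unfolding T_def by auto
  define q where "q = (\<Sum>m\<in>A. smult (k m) (T m))"
  show ?thesis
  proof (rule that[of q])
    show "poly q t = g (a + t *s z)" for t
      by (simp add: q_def A(3) T_def poly_sum poly_prod)
    show "degree q \<le> d" unfolding q_def
      by (rule degree_sum_le) (use A T in \<open>auto intro: order_trans[OF degree_smult_le]\<close>)
    show "coeff q d = g z" unfolding q_def A(3) by (simp add: coeff_sum T)
  qed
qed

text \<open>Homogeneity makes the vanishing of \<open>g\<close> independent of the representative,
  which turns the set comprehension into a pointwise test.\<close>

lemma open_Compl_plane_curve:
  assumes "homogeneous_poly d g" "C = {proj_point v | v. v \<noteq> 0 \<and> g v = 0}"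
  shows "open (- C)" "\<And>v. v \<noteq> 0 \<Longrightarrow> proj_point v \<in> C \<longleftrightarrow> g v = 0"
proof -
  show *: "proj_point v \<in> C \<longleftrightarrow> g v = 0" if v: "v \<noteq> 0" for v
  proof
    assume "proj_point v \<in> C"
    then obtain w where w: "proj_point w = proj_point v" "w \<noteq> 0" "g w = 0" unfolding assms(2) by auto
    from w(1) obtain c where "v = c *s w" using proj_point_eq_iff[OF w(2) v] by blast
    then show "g v = 0" using homogeneous_poly_scale[OF assms(1)] w(3) by simp
  qed (use v assms(2) in auto)
  have "affine_cone (- C) = {v. v \<noteq> 0} \<inter> {v. g v \<noteq> 0}" by (auto simp: affine_cone_def *)
  also have "open \<dots>"
    by (intro open_Int open_nonzero open_Collect_neq continuous_on_homogeneous_poly[OF assms(1)] continuous_intros)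
  finally show "open (- C)" by (simp add: open_cproj_iff_affine_cone)
qed

lemma plane_curveE:
  assumes "plane_curve C"
  obtains d g where "homogeneous_poly d g" "\<And>v. v \<noteq> 0 \<Longrightarrow> proj_point v \<in> C \<longleftrightarrow> g v = 0" "open (- C)"
proof -
  from assms obtain d g where g: "homogeneous_poly d g" "C = {proj_point v | v. v \<noteq> 0 \<and> g v = 0}"
    unfolding plane_curve_def by blast
  show ?thesis using that[OF g(1) open_Compl_plane_curve(2,1)[OF g]] by blast
qed

lemma regular_map_local:
  assumes "regular_map X Y f" "u \<noteq> 0" "proj_point u \<in> X"
  obtains d e h F where "\<And>j. homogeneous_poly d (\<lambda>v. F v $ j)" "homogeneous_poly e h" "h u \<noteq> 0"
    "\<And>v. v \<noteq> 0 \<Longrightarrow> proj_point v \<in> X \<Longrightarrow> h v \<noteq> 0 \<Longrightarrow> F v \<noteq> 0 \<and> f (proj_point v) = proj_point (F v)"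
  using assms unfolding regular_map_def by metis

text \<open>Locally the map lifts to \<open>F\<close> on the cone, which is continuous and avoids 0
  where \<open>h\<close> does not vanish.\<close>

lemma continuous_on_regular_map:
  assumes "regular_map X Y f" "open X"
  shows "continuous_on X f"
proof (rule continuous_on_from_affine_cone[OF assms(2)])
  have oc: "open (affine_cone X)" using assms(2) by (simp add: open_cproj_iff_affine_cone)
  show "continuous_on (affine_cone X) (\<lambda>v. f (proj_point v))"
    unfolding continuous_on_eq_continuous_at[OF oc]
  proof
    fix u assume u: "u \<in> affine_cone X"
    then have u': "u \<noteq> 0" "proj_point u \<in> X" by (auto simp: affine_cone_def)
    obtain d e h F where F: "\<And>j. homogeneous_poly d (\<lambda>v. F v $ j)" "homogeneous_poly e h" "h u \<noteq> 0"
    "\<And>v. v \<noteq> 0 \<Longrightarrow> proj_point v \<in> X \<Longrightarrow> h v \<noteq> 0 \<Longrightarrow> F v \<noteq> 0 \<and> f (proj_point v) = proj_point (F v)"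
      by (rule regular_map_local[OF assms(1) u']) (rule that)
    define V where "V = affine_cone X \<inter> {v. h v \<noteq> 0}"
    have oV: "open V" unfolding V_def
      by (intro open_Int oc open_Collect_neq continuous_on_homogeneous_poly[OF F(2)] continuous_intros)
    have uV: "u \<in> V" using u F(3) by (simp add: V_def)
    have cF: "continuous_on V F"
    proof -
      have "continuous_on V (\<lambda>v. \<chi> j. F v $ j)"
        by (intro continuous_intros continuous_on_homogeneous_poly[OF F(1)])
      then show ?thesis by simp
    qed
    have "continuous_on V (\<lambda>v. proj_point (F v))"
      by (rule continuous_on_compose2[OF continuous_on_proj_point cF])
         (use F(4) in \<open>auto simp: V_def affine_cone_def\<close>)
    then have "continuous_on V (\<lambda>v. f (proj_point v))"
      by (rule continuous_on_eq) (use F(4) in \<open>auto simp: V_def affine_cone_def\<close>)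
    then show "isCont (\<lambda>v. f (proj_point v)) u"
      using oV uV by (simp add: continuous_on_eq_continuous_at)
  qed
qed

section \<open>Linear forms and coordinates on the projective line\<close>

definition rep_vec :: "2 cproj \<Rightarrow> complex ^ 2" where
  "rep_vec b = (SOME v. v \<noteq> 0 \<and> b = proj_point v)"

lemma rep_vec: "rep_vec b \<noteq> 0" "proj_point (rep_vec b) = b"
proof -
  have "\<exists>v. v \<noteq> 0 \<and> b = proj_point v" using proj_point_cases by metis
  from someI_ex[OF this] show "rep_vec b \<noteq> 0" "proj_point (rep_vec b) = b"
    unfolding rep_vec_def by auto
qed

text \<open>The determinant of \<open>w\<close> and a representative of \<open>b\<close>, hence the
  linear form whose only zero is \<open>b\<close>. Another representative would change it by a
  nonzero constant factor.\<close>

definition lin_form :: "2 cproj \<Rightarrow> complex ^ 2 \<Rightarrow> complex" where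
  "lin_form b w = rep_vec b $ 2 * w $ 1 - rep_vec b $ 1 * w $ 2"

lemma proj_point_eq_det:
  fixes v w :: "complex ^ 2"
  assumes "v \<noteq> 0" "w \<noteq> 0"
  shows "proj_point v = proj_point w \<longleftrightarrow> v $ 2 * w $ 1 = v $ 1 * w $ 2"
  unfolding proj_point_eq_iff[OF assms]
proof
  assume "\<exists>c. w = c *s v" then show "v $ 2 * w $ 1 = v $ 1 * w $ 2" by auto
next
  assume *: "v $ 2 * w $ 1 = v $ 1 * w $ 2"
  from assms(1) consider "v $ 1 \<noteq> 0" | "v $ 2 \<noteq> 0" by (auto simp: vec_eq_iff forall_2)
  then show "\<exists>c. w = c *s v"
  proof cases
    case 1
    then have "w = (w $ 1 / v $ 1) *s v" using * by (simp add: vec_eq_iff forall_2 field_simps)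
    then show ?thesis by blast
  next
    case 2
    then have "w = (w $ 2 / v $ 2) *s v" using * by (simp add: vec_eq_iff forall_2 field_simps)
    then show ?thesis by blast
  qed
qed

lemma lin_form_eq_0_iff: "w \<noteq> 0 \<Longrightarrow> lin_form b w = 0 \<longleftrightarrow> proj_point w = b"
  using proj_point_eq_det[of "rep_vec b" w] rep_vec[of b] by (auto simp: lin_form_def)

lemma lin_form_scale: "lin_form b (c *s w) = c * lin_form b w"
  by (simp add: lin_form_def algebra_simps)

lemma continuous_on_lin_form: "continuous_on S (lin_form b)"
  unfolding lin_form_def by (intro continuous_intros)

lemma open_Compl_finite_cproj2:
  fixes B :: "2 cproj set"
  assumes "finite B" shows "open (- B)"
proof -
  have "affine_cone (- B) = {v. v \<noteq> 0} \<inter> (\<Inter>b\<in>B. {v. lin_form b v \<noteq> 0})"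
    by (auto simp: affine_cone_def lin_form_eq_0_iff)
  also have "open \<dots>"
    by (intro open_Int open_nonzero open_INT assms ballI open_Collect_neq continuous_on_lin_form continuous_intros)
  finally show ?thesis by (simp add: open_cproj_iff_affine_cone)
qed

text \<open>For \<open>j \<noteq> k\<close> this is the coordinate with zero \<open>j\<close> and
  pole \<open>k\<close>. At \<open>k\<close> itself division by zero yields 0, so it is used only
  away from \<open>k\<close>.\<close>

definition lin_form_ratio :: "2 cproj \<Rightarrow> 2 cproj \<Rightarrow> 2 cproj \<Rightarrow> complex" where
  "lin_form_ratio j k y = lin_form j (rep_vec y) / lin_form k (rep_vec y)"

lemma lin_form_ratio_proj_point: "v \<noteq> 0 \<Longrightarrow> lin_form_ratio j k (proj_point v) = lin_form j v / lin_form k v"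
proof -
  assume v: "v \<noteq> 0"
  obtain c where c: "v = c *s rep_vec (proj_point v)"
    using proj_point_eq_iff[OF rep_vec(1) v] rep_vec(2) by metis
  then have "c \<noteq> 0" using v by auto
  then show ?thesis unfolding lin_form_ratio_def by (subst (3 4) c) (simp add: lin_form_scale)
qed

lemma continuous_on_lin_form_ratio:
  assumes "finite B" "k \<in> B" shows "continuous_on (- B) (lin_form_ratio j k)"
proof (rule continuous_on_from_affine_cone[OF open_Compl_finite_cproj2[OF assms(1)]])
  have "continuous_on (affine_cone (- B)) (\<lambda>v. lin_form j v / lin_form k v)"
    by (intro continuous_intros continuous_on_lin_form) (use assms in \<open>auto simp: affine_cone_def lin_form_eq_0_iff\<close>)
  then show "continuous_on (affine_cone (- B)) (\<lambda>v. lin_form_ratio j k (proj_point v))"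
    by (rule continuous_on_eq) (auto simp: affine_cone_def lin_form_ratio_proj_point)
qed

lemma lin_form_ratio_nonzero: "j \<in> B \<Longrightarrow> k \<in> B \<Longrightarrow> y \<notin> B \<Longrightarrow> lin_form_ratio j k y \<noteq> 0"
  unfolding lin_form_ratio_def using lin_form_eq_0_iff[of "rep_vec y"] rep_vec[of y] by auto

lemma lin_form_ratio_inj:
  assumes "j \<noteq> k" "x \<noteq> k" "y \<noteq> k" "lin_form_ratio j k x = lin_form_ratio j k y" shows "x = y"
proof -
  define v w a b where d: "v = rep_vec x" "w = rep_vec y" "a = rep_vec j" "b = rep_vec k"
  have nz: "lin_form k v \<noteq> 0" "lin_form k w \<noteq> 0" using assms d rep_vec lin_form_eq_0_iff by metis+
  have jk: "b $ 2 * a $ 1 - b $ 1 * a $ 2 \<noteq> 0"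
    using assms(1) rep_vec lin_form_eq_0_iff[of "rep_vec j" k] unfolding d lin_form_def by metis
  have "lin_form j v * lin_form k w = lin_form j w * lin_form k v"
    using assms(4) nz unfolding lin_form_ratio_def d[symmetric] by (simp add: field_simps)
  \<comment> \<open>The Pluecker relation between four vectors of a two-dimensional space.\<close>
  moreover have "(b $ 2 * a $ 1 - b $ 1 * a $ 2) * (v $ 2 * w $ 1 - v $ 1 * w $ 2)
      = lin_form j w * lin_form k v - lin_form j v * lin_form k w"
    unfolding lin_form_def d[symmetric] by (simp add: algebra_simps)
  ultimately have "(b $ 2 * a $ 1 - b $ 1 * a $ 2) * (v $ 2 * w $ 1 - v $ 1 * w $ 2) = 0" by simp
  with jk have "v $ 2 * w $ 1 = v $ 1 * w $ 2" by simp
  then have "proj_point v = proj_point w" using proj_point_eq_det rep_vec d by metis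
  then show ?thesis using rep_vec d by metis
qed

subsection \<open>The winding class of a cycle in the punctured plane\<close>

lemma cochain_eval_superset:
  assumes "finite S" "Poly_Mapping.keys c \<subseteq> S"
  shows "cochain_eval \<phi> c = (\<Sum>\<sigma>\<in>S. of_int (Poly_Mapping.lookup c \<sigma>) * \<phi> \<sigma>)"
  unfolding cochain_eval_def
  by (rule sum.mono_neutral_left[OF assms]) (auto simp: in_keys_iff)

lemma cochain_eval_0 [simp]: "cochain_eval \<phi> 0 = 0"
  by (simp add: cochain_eval_def)

lemma cochain_eval_add: "cochain_eval \<phi> (c + d) = cochain_eval \<phi> c + cochain_eval \<phi> d"
proof -
  define S where "S = Poly_Mapping.keys c \<union> Poly_Mapping.keys d"
  have S: "finite S" "Poly_Mapping.keys c \<subseteq> S" "Poly_Mapping.keys d \<subseteq> S" "Poly_Mapping.keys (c + d) \<subseteq> S"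
    using keys_add[of c d] by (auto simp: S_def)
  show ?thesis
    unfolding S(2-4)[THEN cochain_eval_superset[OF S(1)]]
    by (simp add: lookup_add algebra_simps sum.distrib)
qed

lemma cochain_eval_diff: "cochain_eval \<phi> (c - d) = cochain_eval \<phi> c - cochain_eval \<phi> d"
  using cochain_eval_add[of \<phi> "c - d" d] by simp

lemma cochain_eval_frag_of [simp]: "cochain_eval \<phi> (frag_of \<sigma>) = \<phi> \<sigma>"
  by (simp add: cochain_eval_def)

lemma cochain_eval_sum: "cochain_eval \<phi> (sum f I) = (\<Sum>i\<in>I. cochain_eval \<phi> (f i))"
  by (induction I rule: infinite_finite_induct) (auto simp: cochain_eval_add)

lemma cochain_eval_cong:
  assumes "singular_chain p X c" "\<And>\<sigma>. singular_simplex p X \<sigma> \<Longrightarrow> \<phi> \<sigma> = \<psi> \<sigma>"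
  shows "cochain_eval \<phi> c = cochain_eval \<psi> c"
  using assms unfolding cochain_eval_def singular_chain_def by (intro sum.cong) auto

lemma cochain_eval_sign: "cochain_eval \<phi> (frag_cmul ((-1) ^ k) c) = (-1) ^ k * cochain_eval \<phi> c"
proof (cases "even k")
  case False
  then show ?thesis using cochain_eval_diff[of \<phi> 0 c] by simp
qed simp

text \<open>Boundary and untwisted coboundary are adjoint under evaluation; by additivity only
  single simplices have to be checked.\<close>

lemma cochain_eval_chain_boundary:
  "cochain_eval \<phi> (chain_boundary (Suc p) c)
    = cochain_eval (\<lambda>\<sigma>. \<Sum>k\<le>Suc p. (-1) ^ k * \<phi> (singular_face (Suc p) k \<sigma>)) c"
proof -
  have "Poly_Mapping.keys c \<subseteq> UNIV" by simp
  then show ?thesis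
  proof (induction c rule: frag_induction)
    case (one \<sigma>)
    show ?case
      unfolding chain_boundary_of
      by (simp only: cochain_eval_sum cochain_eval_sign cochain_eval_frag_of nat.distinct if_False)
  qed (auto simp: chain_boundary_diff cochain_eval_diff)
qed

definition simplex_edge :: "real \<Rightarrow> nat \<Rightarrow> real" where
  "simplex_edge t = (\<lambda>i. if i = 0 then 1 - t else if i = 1 then t else 0)"

lemma simplex_edge_in: "t \<in> {0..1} \<Longrightarrow> simplex_edge t \<in> standard_simplex 1"
  by (auto simp: standard_simplex_def simplex_edge_def)

lemma continuous_on_singular_simplex:
  assumes "singular_simplex p (top_of_set S) \<sigma>" "\<And>i. continuous_on T (\<lambda>t. q t i)"
    "\<And>t. t \<in> T \<Longrightarrow> q t \<in> standard_simplex p"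
  shows "continuous_on T (\<lambda>t. \<sigma> (q t))" "\<And>t. t \<in> T \<Longrightarrow> \<sigma> (q t) \<in> S"
proof -
  have "continuous_map (top_of_set T) (subtopology (powertop_real UNIV) (standard_simplex p)) q"
    using assms(2,3) by (auto simp: continuous_map_in_subtopology continuous_map_componentwise)
  then have "continuous_map (top_of_set T) (top_of_set S) (\<sigma> \<circ> q)"
    using assms(1) unfolding singular_simplex_def by (metis continuous_map_compose)
  then show "continuous_on T (\<lambda>t. \<sigma> (q t))" "\<And>t. t \<in> T \<Longrightarrow> \<sigma> (q t) \<in> S"
    by (auto simp: continuous_map_in_subtopology o_def)
qed

text \<open>The path need not be closed. The value is the change of a logarithm along it divided by
  \<open>2 * pi * \<i>\<close>, in general a complex number; being additive along paths, it yields a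
  cocycle.\<close>

definition winding_cochain :: "complex cochain" where
  "winding_cochain \<sigma> = winding_number (\<lambda>t. \<sigma> (simplex_edge t)) 0"

lemma winding_number_exp:
  assumes "continuous_on {0..1} g" "\<And>t. t \<in> {0..1} \<Longrightarrow> p t = exp (g t)"
  shows "winding_number p 0 = (g 1 - g 0) / (2 * of_real pi * \<i>)"
proof -
  have "winding_number p 0 = winding_number (exp \<circ> g) 0"
    by (rule winding_number_cong) (use assms(2) in auto)
  also have "\<dots> = (g 1 - g 0) / (2 * of_real pi * \<i>)"
    using winding_number_compose_exp[of g] assms(1) by (simp add: path_def pathfinish_def pathstart_def)
  finally show ?thesis .
qed

text \<open>\<open>\<tau>\<close> has a continuous logarithm on the contractible triangle. Each face
  contributes the difference of that logarithm at its two ends, and with the boundary signs these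
  differences cancel.\<close>

lemma winding_cochain_boundary:
  assumes "singular_simplex 2 (top_of_set (- {0})) \<tau>"
  shows "(\<Sum>k\<le>2. (-1) ^ k * winding_cochain (singular_face 2 k \<tau>)) = 0"
proof -
  \<comment> \<open>Dropping the barycentric coordinate of index 0 replaces the standard simplex by
    a convex set in the plane; \<open>q\<close> restores that coordinate.\<close>
  define T where "T = {x :: real \<times> real. 0 \<le> fst x \<and> 0 \<le> snd x \<and> fst x + snd x \<le> 1}"
  define q where "q x i = (if i = 0 then 1 - fst x - snd x else if i = 1 then fst x
      else if i = 2 then snd x else 0)" for x :: "real \<times> real" and i :: nat
  have qT: "q x \<in> standard_simplex 2" if "x \<in> T" for x
    using that unfolding standard_simplex_def T_def q_def
    by (auto simp: numeral_2_eq_2)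
  have cq: "continuous_on T (\<lambda>x. q x i)" for i
    unfolding q_def by (cases "i = 0"; cases "i = 1"; cases "i = 2") (auto intro!: continuous_intros)
  have "convex T"
    unfolding convex_def T_def
  proof safe
    fix a b c d u v :: real
    assume *: "0 \<le> u" "0 \<le> v" "u + v = 1" "0 \<le> fst (a,b)" "0 \<le> snd (a,b)" "fst (a,b) + snd (a,b) \<le> 1"
       "0 \<le> fst (c,d)" "0 \<le> snd (c,d)" "fst (c,d) + snd (c,d) \<le> 1"
    have "u * (a + b) \<le> u" "v * (c + d) \<le> v" using * by (simp_all add: mult_left_le)
    then show "fst (u *\<^sub>R (a, b) + v *\<^sub>R (c, d)) + snd (u *\<^sub>R (a, b) + v *\<^sub>R (c, d)) \<le> 1"
      using *(3) by (simp add: algebra_simps)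
  qed auto
  then have "contractible T" by (rule convex_imp_contractible)
  moreover have "continuous_on T (\<lambda>x. \<tau> (q x))" "\<And>x. x \<in> T \<Longrightarrow> \<tau> (q x) \<noteq> 0"
    using continuous_on_singular_simplex[OF assms cq qT] by auto
  ultimately obtain G where G: "continuous_on T G" "\<And>x. x \<in> T \<Longrightarrow> \<tau> (q x) = exp (G x)"
    using continuous_logarithm_on_contractible by metis
  have face: "winding_cochain (singular_face 2 k \<tau>) = (G (l 1) - G (l 0)) / (2 * of_real pi * \<i>)"
    if "continuous_on {0..1} l" "\<And>t. t \<in> {0..1} \<Longrightarrow> l t \<in> T"
      "\<And>t. t \<in> {0..1} \<Longrightarrow> simplical_face k (simplex_edge t) = q (l t)" for k l
  proof -
    have "winding_number (\<lambda>t. singular_face 2 k \<tau> (simplex_edge t)) 0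
        = (G (l 1) - G (l 0)) / (2 * of_real pi * \<i>)"
    proof (rule winding_number_exp)
      show "continuous_on {0..1} (\<lambda>t. G (l t))"
        by (rule continuous_on_compose2[OF G(1) that(1)]) (use that(2) in auto)
      show "singular_face 2 k \<tau> (simplex_edge t) = exp (G (l t))" if "t \<in> {0..1}" for t
        using that simplex_edge_in[OF that] \<open>\<And>t. t \<in> {0..1} \<Longrightarrow> simplical_face k (simplex_edge t) = q (l t)\<close>[OF that]
          G(2)[OF \<open>\<And>t. t \<in> {0..1} \<Longrightarrow> l t \<in> T\<close>[OF that]]
        by (simp add: singular_face_def)
    qed
    then show ?thesis by (simp add: winding_cochain_def)
  qed
  have 0: "winding_cochain (singular_face 2 0 \<tau>) = (G (0, 1) - G (1, 0)) / (2 * of_real pi * \<i>)"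
    by (subst face[of "\<lambda>t. (1 - t, t)"])
       (auto intro!: continuous_intros simp: T_def simplical_face_def simplex_edge_def q_def fun_eq_iff)
  have 1: "winding_cochain (singular_face 2 1 \<tau>) = (G (0, 1) - G (0, 0)) / (2 * of_real pi * \<i>)"
    by (subst face[of "\<lambda>t. (0, t)"])
       (auto intro!: continuous_intros simp: T_def simplical_face_def simplex_edge_def q_def fun_eq_iff)
  have 2: "winding_cochain (singular_face 2 2 \<tau>) = (G (1, 0) - G (0, 0)) / (2 * of_real pi * \<i>)"
    by (subst face[of "\<lambda>t. (t, 0)"])
       (auto intro!: continuous_intros simp: T_def simplical_face_def simplex_edge_def q_def fun_eq_iff)
  have "(\<Sum>k\<le>2. (-1) ^ k * winding_cochain (singular_face 2 k \<tau>))
      = winding_cochain (singular_face 2 0 \<tau>) - winding_cochain (singular_face 2 1 \<tau>)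
        + winding_cochain (singular_face 2 2 \<tau>)"
    by (simp add: numeral_2_eq_2)
  also have "\<dots> = 0" unfolding 0 1 2 by (simp flip: diff_divide_distrib add_divide_distrib)
  finally show ?thesis .
qed

abbreviation punctured_plane :: "complex topology" where
  "punctured_plane \<equiv> top_of_set (- {0})"

text \<open>The pairing with the class of \<open>dz / (2 * pi * \<i> * z)\<close>.
  \<open>kronecker\<close> receives a singleton because one representative suffices to evaluate;
  independence of the cycle chosen in \<open>h\<close> is shown next.\<close>

definition winding_class :: "complex chain set \<Rightarrow> complex" where
  "winding_class h = kronecker {winding_cochain} h"

lemma winding_class_eqI:
  assumes "c \<in> h" "\<And>c. c \<in> h \<Longrightarrow> cochain_eval winding_cochain c = t"
  shows "winding_class h = t"
  unfolding winding_class_def kronecker_def using assms by (intro the_equality) auto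

text \<open>Homologous chains differ by a boundary, and the cocycle vanishes on boundaries.\<close>

lemma winding_class_homologous_rel_set:
  assumes "c' \<in> homologous_rel_set 1 punctured_plane {} c"
  shows "cochain_eval winding_cochain c' = cochain_eval winding_cochain c"
proof -
  from assms obtain d where d: "singular_chain 2 punctured_plane d"
      "(chain_boundary 2 d, c - c') \<in> mod_subset 1 (subtopology punctured_plane {})"
    unfolding homologous_rel_def singular_relboundary_def Suc_1 mem_Collect_eq by blast
  from d(2) have bd: "chain_boundary 2 d = c - c'" by (simp only: mod_subset_empty)
  have "cochain_eval winding_cochain (chain_boundary 2 d)
      = cochain_eval (\<lambda>\<sigma>. \<Sum>k\<le>2. (-1) ^ k * winding_cochain (singular_face 2 k \<sigma>)) d"
    using cochain_eval_chain_boundary[of winding_cochain 1 d] by (simp add: numeral_2_eq_2)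
  also have "\<dots> = cochain_eval (\<lambda>\<sigma>. 0) d"
    by (rule cochain_eval_cong[OF d(1)]) (rule winding_cochain_boundary)
  also have "\<dots> = 0" by (simp add: cochain_eval_def)
  finally show ?thesis unfolding bd by (simp add: cochain_eval_diff)
qed

lemma winding_class_eq:
  "winding_class (homologous_rel_set 1 punctured_plane {} c) = cochain_eval winding_cochain c"
  by (rule winding_class_eqI[of c]) (use winding_class_homologous_rel_set in auto)

lemma winding_class_mult:
  assumes "x \<in> carrier (homology_group 1 punctured_plane)" "y \<in> carrier (homology_group 1 punctured_plane)"
  shows "winding_class (x \<otimes>\<^bsub>homology_group 1 punctured_plane\<^esub> y) = winding_class x + winding_class y"
proof -
  obtain c d where c: "x = homologous_rel_set 1 punctured_plane {} c" "y = homologous_rel_set 1 punctured_plane {} d"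
    using assms carrier_relative_homology_group[of 1 punctured_plane "{}"] by auto
  have m: "x \<otimes>\<^bsub>homology_group 1 punctured_plane\<^esub> y = (\<Union>r\<in>x. \<Union>s\<in>y. {r + s})"
    using mult_relative_homology_group[of 1 punctured_plane "{}"] by simp
  show ?thesis unfolding m
    by (rule winding_class_eqI[of "c + d"])
       (use winding_class_homologous_rel_set homologous_rel_refl in
        \<open>force simp: c winding_class_eq cochain_eval_add simp del: One_nat_def\<close>)+
qed

lemma winding_class_one: "winding_class (\<one>\<^bsub>homology_group 1 punctured_plane\<^esub>) = 0"
proof -
  interpret group "homology_group 1 punctured_plane" by simp
  show ?thesis
    using winding_class_mult[of "\<one>\<^bsub>homology_group 1 punctured_plane\<^esub>" "\<one>\<^bsub>homology_group 1 punctured_plane\<^esub>"]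
    by (metis l_one one_closed add_cancel_left_left)
qed

lemma winding_class_int_pow:
  assumes x: "x \<in> carrier (homology_group 1 punctured_plane)"
  shows "winding_class (x [^]\<^bsub>homology_group 1 punctured_plane\<^esub> (d::int)) = of_int d * winding_class x"
proof -
  interpret H: group "homology_group 1 punctured_plane" by simp
  have nat: "winding_class (x [^]\<^bsub>homology_group 1 punctured_plane\<^esub> (n::nat)) = of_nat n * winding_class x" for n
  proof (induction n)
    case 0 show ?case using winding_class_one by simp
  next
    case (Suc n)
    then show ?case using winding_class_mult[OF H.nat_pow_closed[OF x] x] by (simp add: algebra_simps)
  qed
  show ?thesis
  proof (cases d rule: int_cases2)
    case (nonneg n) then show ?thesis using nat by (simp add: int_pow_int)
  next
    case (nonpos n)
    then have dn: "d = - int n" by simp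
    let ?y = "x [^]\<^bsub>homology_group 1 punctured_plane\<^esub> n"
    have "winding_class (inv\<^bsub>homology_group 1 punctured_plane\<^esub> ?y) + winding_class ?y = 0"
      using winding_class_mult[of "inv\<^bsub>homology_group 1 punctured_plane\<^esub> ?y" ?y] x winding_class_one
      by (simp add: H.l_inv)
    then show ?thesis unfolding dn using nat[of n] x
      by (simp add: H.int_pow_neg_int eq_neg_iff_add_eq_0 del: of_nat_Suc)
  qed
qed

section \<open>The circle, its fundamental class and its power maps\<close>

definition circle_point :: "real \<Rightarrow> nat \<Rightarrow> real" where
  "circle_point t = (\<lambda>i. if i = 0 then cos (2 * pi * t) else if i = 1 then sin (2 * pi * t) else 0)"

text \<open>\<open>nsphere 1\<close> consists of real sequences; this identifies it with the unit
  circle of the complex plane.\<close>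

definition circle_coord :: "(nat \<Rightarrow> real) \<Rightarrow> complex" where
  "circle_coord x = Complex (x 0) (x 1)"

definition circle_simplex :: "(nat \<Rightarrow> real) \<Rightarrow> nat \<Rightarrow> real" where
  "circle_simplex = restrict (\<lambda>x. circle_point (x 1)) (standard_simplex 1)"

definition circle_class :: "(nat \<Rightarrow> real) chain set" where
  "circle_class = homologous_rel_set 1 (nsphere 1) {} (frag_of circle_simplex)"

lemma circle_coord_circle_point: "circle_coord (circle_point t) = exp (2 * of_real pi * \<i> * of_real t)"
  by (simp add: circle_coord_def circle_point_def complex_eq_iff Re_exp Im_exp)

lemma topspace_nsphere1: "topspace (nsphere 1) = {x. (x 0)\<^sup>2 + (x 1)\<^sup>2 = 1 \<and> (\<forall>i>1. x i = 0)}"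
  by (simp add: nsphere)

lemma norm_circle_coord: "x \<in> topspace (nsphere 1) \<Longrightarrow> norm (circle_coord x) = 1"
  unfolding topspace_nsphere1 by (simp add: circle_coord_def cmod_def)

lemma continuous_map_into_nsphere1:
  assumes "\<And>i. continuous_map X euclideanreal (\<lambda>x. f x i)"
    "\<And>x. x \<in> topspace X \<Longrightarrow> f x \<in> topspace (nsphere 1)"
  shows "continuous_map X (nsphere 1) f"
  using assms unfolding topspace_nsphere1
  by (auto simp: nsphere continuous_map_in_subtopology continuous_map_componentwise)

lemma continuous_map_circle_coord: "continuous_map (nsphere 1) euclidean circle_coord"
proof -
  have "continuous_map euclideanreal euclidean complex_of_real"
    "continuous_map euclideanreal euclidean (\<lambda>t. \<i> * complex_of_real t)"
    by (auto intro!: continuous_intros)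
  from this[THEN continuous_map_compose[OF continuous_map_nsphere_projection]]
  have "continuous_map (nsphere 1) euclidean (\<lambda>x. complex_of_real (x 0))"
    "continuous_map (nsphere 1) euclidean (\<lambda>x. \<i> * complex_of_real (x 1))"
    by (simp_all add: o_def)
  from continuous_map_add[OF this]
  have "continuous_map (nsphere 1) euclidean (\<lambda>x. of_real (x 0) + \<i> * of_real (x 1) :: complex)" .
  moreover have "(\<lambda>x. of_real (x 0) + \<i> * of_real (x 1) :: complex) = circle_coord"
    by (auto simp: circle_coord_def complex_eq_iff)
  ultimately show ?thesis by simp
qed

lemma singular_simplex_circle: "singular_simplex 1 (nsphere 1) circle_simplex"
  unfolding singular_simplex_def
proof
  have pr: "continuous_map (subtopology (powertop_real UNIV) (standard_simplex 1)) euclideanreal (\<lambda>x. x 1)"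
    by (intro continuous_map_from_subtopology continuous_map_product_projection) auto
  have "continuous_map (subtopology (powertop_real UNIV) (standard_simplex 1)) (nsphere 1) (\<lambda>x. circle_point (x 1))"
  proof (rule continuous_map_into_nsphere1)
    fix i
    have "continuous_map euclideanreal euclideanreal (\<lambda>t. circle_point t i)"
      unfolding circle_point_def by (cases "i = 0"; cases "i = 1") (auto intro!: continuous_intros)
    from continuous_map_compose[OF pr this]
    show "continuous_map (subtopology (powertop_real UNIV) (standard_simplex 1)) euclideanreal (\<lambda>x. circle_point (x 1) i)"
      by (simp add: o_def)
  qed (unfold topspace_nsphere1, simp add: circle_point_def)
  then show "continuous_map (subtopology (powertop_real UNIV) (standard_simplex 1)) (nsphere 1) circle_simplex"
    by (rule continuous_map_eq) (auto simp: circle_simplex_def)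
qed (simp add: circle_simplex_def)

text \<open>The simplex starts and ends at the same point, so its two faces cancel.\<close>

lemma singular_relcycle_circle: "singular_relcycle 1 (nsphere 1) {} (frag_of circle_simplex)"
proof -
  have "singular_face 1 0 circle_simplex = singular_face 1 1 circle_simplex"
    unfolding singular_face_def
  proof (rule restrict_ext)
    fix x assume "x \<in> standard_simplex (1 - Suc 0)"
    then have x: "x = (\<lambda>j. if j = 0 then 1 else 0)" by (simp add: standard_simplex_0)
    have "simplical_face 0 x \<in> standard_simplex 1" "simplical_face 1 x \<in> standard_simplex 1"
      using simplical_face_in_standard_simplex[of 1 _ x] by (auto simp: x standard_simplex_0)
    then show "(circle_simplex \<circ> simplical_face 0) x = (circle_simplex \<circ> simplical_face 1) x"
      by (simp add: circle_simplex_def x simplical_face_def circle_point_def fun_eq_iff)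
  qed
  then have "chain_boundary 1 (frag_of circle_simplex) = 0"
    by (simp add: chain_boundary_of)
  then show ?thesis
    unfolding singular_cycle using singular_simplex_circle by (simp add: singular_chain_of)
qed

lemma circle_class_carrier: "circle_class \<in> carrier (homology_group 1 (nsphere 1))"
  using carrier_relative_homology_group[of 1 "nsphere 1" "{}"] singular_relcycle_circle
  unfolding circle_class_def by auto

text \<open>\<open>g\<close> is a logarithm along the circle cut open at one point. It need not
  close up, and its jump is what the winding class measures.\<close>

lemma winding_class_loop:
  assumes "continuous_map (nsphere 1) punctured_plane f"
    "continuous_on {0..1} g" "\<And>t. t \<in> {0..1} \<Longrightarrow> f (circle_point t) = exp (g t)"
  shows "winding_class (hom_induced 1 (nsphere 1) {} punctured_plane {} f circle_class)
    = (g 1 - g 0) / (2 * of_real pi * \<i>)"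
proof -
  have "hom_induced 1 (nsphere 1) {} punctured_plane {} f circle_class
      = homologous_rel_set 1 punctured_plane {} (chain_map 1 f (frag_of circle_simplex))"
    unfolding circle_class_def
    using hom_induced_chain_map[OF assms(1) _ singular_relcycle_circle, of "{}"] by simp
  then have "winding_class (hom_induced 1 (nsphere 1) {} punctured_plane {} f circle_class)
      = winding_cochain (simplex_map 1 f circle_simplex)"
    by (simp add: winding_class_eq del: One_nat_def)
  also have "\<dots> = (g 1 - g 0) / (2 * of_real pi * \<i>)"
    unfolding winding_cochain_def
  proof (rule winding_number_exp[OF assms(2)])
    fix t :: real assume t: "t \<in> {0..1}"
    show "simplex_map 1 f circle_simplex (simplex_edge t) = exp (g t)"
      using assms(3)[OF t] simplex_edge_in[OF t]
      by (simp add: simplex_map_def circle_simplex_def) (simp add: simplex_edge_def)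
  qed
  finally show ?thesis .
qed

definition circle_power :: "nat \<Rightarrow> (nat \<Rightarrow> real) \<Rightarrow> nat \<Rightarrow> real" where
  "circle_power k x = (\<lambda>i. if i = 0 then Re (circle_coord x ^ k) else if i = 1 then Im (circle_coord x ^ k) else 0)"

lemma circle_coord_power: "circle_coord (circle_power k x) = circle_coord x ^ k"
  by (simp add: circle_power_def circle_coord_def[of "\<lambda>i. _ i"])

lemma continuous_map_circle_coord_power: "continuous_map (nsphere 1) euclidean (\<lambda>x. circle_coord x ^ k)"
proof -
  have "continuous_map euclidean euclidean (\<lambda>z::complex. z ^ k)" by (auto intro!: continuous_intros)
  from continuous_map_compose[OF continuous_map_circle_coord this] show ?thesis by (simp add: o_def)
qed

lemma continuous_map_circle_power: "continuous_map (nsphere 1) (nsphere 1) (circle_power k)"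
proof (rule continuous_map_into_nsphere1)
  fix i
  have "continuous_map euclidean euclideanreal (\<lambda>z. if i = (0::nat) then Re z else if i = 1 then Im z else 0)"
    by (cases "i = 0"; cases "i = 1") (auto intro!: continuous_intros)
  from continuous_map_compose[OF continuous_map_circle_coord_power this]
  show "continuous_map (nsphere 1) euclideanreal (\<lambda>x. circle_power k x i)"
    by (simp add: o_def circle_power_def)
next
  fix x assume "x \<in> topspace (nsphere 1)"
  then have "norm (circle_coord x ^ k) = 1" by (simp add: norm_power norm_circle_coord)
  then show "circle_power k x \<in> topspace (nsphere 1)"
    unfolding topspace_nsphere1 by (simp add: circle_power_def cmod_def)
qed

lemma continuous_map_circle_coord_power_punctured:
  "continuous_map (nsphere 1) punctured_plane (\<lambda>x. circle_coord x ^ k)"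
  unfolding continuous_map_in_subtopology
  using continuous_map_circle_coord_power[of k] norm_circle_coord by fastforce

text \<open>The class is multiplied by some integer, the Brouwer degree, which is read off from the winding class.\<close>

lemma hom_induced_circle_power:
  "hom_induced 1 (nsphere 1) {} (nsphere 1) {} (circle_power k) circle_class
    = circle_class [^]\<^bsub>homology_group 1 (nsphere 1)\<^esub> (int k)"
proof -
  define d where "d = Brouwer_degree2 1 (circle_power k)"
  let ?H = "homology_group 1 (nsphere 1)" and ?P = "homology_group 1 punctured_plane"
  let ?cz = "hom_induced 1 (nsphere 1) {} punctured_plane {} circle_coord"
  \<comment> \<open>The Brouwer degree refers to reduced homology, which agrees with homology in
    dimension 1.\<close>
  have red: "reduced_homology_group 1 (nsphere 1) = ?H" by (simp add: un_reduced_homology_group)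
  have d: "hom_induced 1 (nsphere 1) {} (nsphere 1) {} (circle_power k) circle_class
      = circle_class [^]\<^bsub>?H\<^esub> d"
    using Brouwer_degree2[of circle_class 1 "circle_power k"] circle_class_carrier red by (simp add: d_def)
  interpret cz: group_hom ?H ?P ?cz
    by (simp add: group_hom_def group_hom_axioms_def hom_induced_hom)
  have cc: "continuous_map (nsphere 1) punctured_plane circle_coord"
    using continuous_map_circle_coord_power_punctured[of 1] by simp
  have pw: "winding_class (hom_induced 1 (nsphere 1) {} punctured_plane {} (\<lambda>x. circle_coord x ^ n) circle_class) = of_nat n" for n
    by (subst winding_class_loop[where g = "\<lambda>t. of_nat n * (2 * of_real pi * \<i> * of_real t)"])
       (use continuous_map_circle_coord_power_punctured in \<open>auto simp: circle_coord_circle_point exp_of_nat_mult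
          intro!: continuous_intros\<close>)
  have "of_nat k = winding_class (hom_induced 1 (nsphere 1) {} punctured_plane {} (\<lambda>x. circle_coord x ^ k) circle_class)"
    by (rule pw[symmetric])
  also have "(\<lambda>x. circle_coord x ^ k) = circle_coord \<circ> circle_power k"
    by (auto simp: circle_coord_power)
  also have "hom_induced 1 (nsphere 1) {} punctured_plane {} (circle_coord \<circ> circle_power k) circle_class
      = ?cz (circle_class [^]\<^bsub>?H\<^esub> d)"
    unfolding hom_induced_compose_empty[OF continuous_map_circle_power cc] by (simp only: o_apply d)
  also have "\<dots> = ?cz circle_class [^]\<^bsub>?P\<^esub> d"
    by (rule cz.hom_int_pow[OF circle_class_carrier])
  also have "winding_class \<dots> = of_int d * winding_class (?cz circle_class)"
    by (rule winding_class_int_pow) (rule cz.hom_closed[OF circle_class_carrier])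
  also have "winding_class (?cz circle_class) = 1" using pw[of 1] by simp
  finally have "(of_int (int k) :: complex) = of_int d" by simp
  then have "int k = d" by (simp only: of_int_eq_iff)
  then show ?thesis using d by simp
qed

subsection \<open>Small loops around punctures of the line\<close>

definition poly_vec :: "complex poly \<Rightarrow> complex poly \<Rightarrow> complex \<Rightarrow> complex ^ 2" where
  "poly_vec P Q t = vector [poly P t, poly Q t]"

text \<open>For coprime \<open>P\<close> and \<open>Q\<close> its roots, counted with their orders,
  are the pullback of the point \<open>b\<close> to the affine part of the line.\<close>

definition lin_form_poly :: "2 cproj \<Rightarrow> complex poly \<Rightarrow> complex poly \<Rightarrow> complex poly" where
  "lin_form_poly b P Q = smult (rep_vec b $ 2) P - smult (rep_vec b $ 1) Q"

lemma poly_vec_nth [simp]: "poly_vec P Q t $ 1 = poly P t" "poly_vec P Q t $ 2 = poly Q t"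
  by (simp_all add: poly_vec_def)

lemma poly_lin_form_poly: "poly (lin_form_poly b P Q) t = lin_form b (poly_vec P Q t)"
  by (simp add: lin_form_poly_def lin_form_def)

lemma continuous_on_poly_vec: "continuous_on S g \<Longrightarrow> continuous_on S (\<lambda>x. poly_vec P Q (g x))"
proof -
  assume g: "continuous_on S g"
  have eq: "poly_vec P Q t = (\<chi> i. if i = 1 then poly P t else poly Q t)" for t
    by (simp add: vec_eq_iff forall_2)
  show ?thesis unfolding eq
  proof (rule continuous_on_vec_lambda)
    show "continuous_on S (\<lambda>x. if i = 1 then poly P (g x) else poly Q (g x))" for i :: 2
      by (cases "i = 1") (auto intro!: continuous_intros g)
  qed
qed

lemma poly_vec_nonzero:
  assumes "coprime P Q" shows "poly_vec P Q t \<noteq> 0"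
proof
  assume "poly_vec P Q t = 0"
  then have "poly P t = 0" "poly Q t = 0" by (metis poly_vec_nth zero_index)+
  then have "[:- t, 1:] dvd P" "[:- t, 1:] dvd Q" by (simp_all add: poly_eq_0_iff_dvd)
  with assms have "is_unit [:- t, 1:]" by (rule coprime_common_divisor)
  then show False by (simp add: is_unit_iff_degree)
qed

lemma poly_lin_form_poly_eq_0_iff:
  "coprime P Q \<Longrightarrow> poly (lin_form_poly b P Q) t = 0 \<longleftrightarrow> proj_point (poly_vec P Q t) = b"
  by (simp add: poly_lin_form_poly lin_form_eq_0_iff poly_vec_nonzero)

text \<open>Split off the full power of \<open>t - p\<close>. The cofactor has no zeros on the disc,
  so it is an exponential there. A point \<open>p\<close> that is not a root is included, with
  exponent 0.\<close>

lemma poly_log_near: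
  fixes q :: "complex poly"
  assumes "q \<noteq> 0" "r > 0" "\<And>t. t \<in> cball p r \<Longrightarrow> t \<noteq> p \<Longrightarrow> poly q t \<noteq> 0"
  obtains g where "continuous_on (cball 0 1) g"
    "\<And>\<zeta>. \<zeta> \<in> cball 0 1 \<Longrightarrow> poly q (p + of_real r * \<zeta>) = \<zeta> ^ order p q * exp (g \<zeta>)"
proof -
  obtain q1 where q1: "q = [:- p, 1:] ^ order p q * q1" "\<not> [:- p, 1:] dvd q1"
    using order_decomp[OF assms(1)] by blast
  define n where "n = order p q"
  have "poly q1 p \<noteq> 0" using q1(2) by (simp add: poly_eq_0_iff_dvd)
  moreover have "poly q1 t \<noteq> 0" if "t \<in> cball p r" "t \<noteq> p" for t
    using assms(3)[OF that] by (subst (asm) q1(1)) auto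
  ultimately have nz: "poly q1 t \<noteq> 0" if "t \<in> cball p r" for t using that by blast
  have incb: "p + of_real r * \<zeta> \<in> cball p r" if "\<zeta> \<in> cball 0 1" for \<zeta> :: complex
    using that assms(2) by (simp add: dist_norm norm_mult mult_left_le)
  \<comment> \<open>The factor \<open>r ^ n\<close> produced by the substitution
    \<open>t = p + r * \<zeta>\<close> is absorbed into the zero-free part.\<close>
  define F where "F \<zeta> = of_real r ^ n * poly q1 (p + of_real r * \<zeta>)" for \<zeta> :: complex
  have "continuous_on (cball 0 1) F" unfolding F_def by (intro continuous_intros)
  moreover have "F \<zeta> \<noteq> 0" if "\<zeta> \<in> cball 0 1" for \<zeta>
    using nz[OF incb[OF that]] assms(2) by (simp add: F_def)
  ultimately obtain g where g: "continuous_on (cball 0 1) g" "\<And>z. z \<in> cball 0 1 \<Longrightarrow> F z = exp (g z)"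
    using continuous_logarithm_on_cball by metis
  show ?thesis
  proof (rule that[OF g(1)])
    fix \<zeta> :: complex assume "\<zeta> \<in> cball 0 1"
    have "poly q (p + of_real r * \<zeta>) = (of_real r * \<zeta>) ^ n * poly q1 (p + of_real r * \<zeta>)"
      by (subst q1(1)) (simp add: n_def)
    also have "\<dots> = \<zeta> ^ n * F \<zeta>" by (simp add: F_def power_mult_distrib)
    finally show "poly q (p + of_real r * \<zeta>) = \<zeta> ^ order p q * exp (g \<zeta>)"
      using g(2)[OF \<open>\<zeta> \<in> cball 0 1\<close>] by (simp add: n_def)
  qed
qed

text \<open>Smallness of radii is expressed by the filter \<open>at_right 0\<close>, so that
  finitely many conditions can be combined without tracking bounds.\<close>

lemma eventually_cball_at_right_0:
  fixes p :: "'a::metric_space"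
  assumes "eventually Q (nhds p)"
  shows "eventually (\<lambda>r. \<forall>t\<in>cball p r. Q t) (at_right 0)"
proof -
  obtain d where d: "d > 0" "\<And>t. dist t p < d \<Longrightarrow> Q t"
    using assms by (auto simp: eventually_nhds_metric)
  have "eventually (\<lambda>r. r < d) (at_right (0::real))"
    using d(1) eventually_at_right_field by blast
  then show ?thesis
    by eventually_elim (auto intro!: d(2) simp: dist_commute)
qed

lemma eventually_no_other_root:
  fixes q :: "complex poly"
  assumes "q \<noteq> 0"
  shows "eventually (\<lambda>r. \<forall>t\<in>cball p r. t \<noteq> p \<longrightarrow> poly q t \<noteq> 0) (at_right 0)"
proof (rule eventually_cball_at_right_0)
  have "finite ({t. poly q t = 0} - {p})" using poly_roots_finite[OF assms] by simp
  then have "open (- ({t. poly q t = 0} - {p}))" by (intro open_Compl finite_imp_closed)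
  then have "\<forall>\<^sub>F t in nhds p. t \<in> - ({t. poly q t = 0} - {p})"
    by (rule eventually_nhds_in_open) simp
  then show "\<forall>\<^sub>F t in nhds p. t \<noteq> p \<longrightarrow> poly q t \<noteq> 0"
    by (rule eventually_mono) auto
qed

abbreviation loop_hom :: "'b topology \<Rightarrow> ((nat \<Rightarrow> real) \<Rightarrow> 'b) \<Rightarrow> 'b chain set" where
  "loop_hom Y f \<equiv> hom_induced 1 (nsphere 1) {} Y {} f circle_class"

lemma loop_hom_cong:
  "(\<And>x. x \<in> topspace (nsphere 1) \<Longrightarrow> f x = g x) \<Longrightarrow> loop_hom Y f = loop_hom Y g"
  using hom_induced_eq by metis

lemma loop_hom_circle_homotopy:
  fixes H :: "real \<times> complex \<Rightarrow> 'b::topological_space"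
  assumes "continuous_on ({0..1} \<times> sphere 0 1) H" "H ` ({0..1} \<times> sphere 0 1) \<subseteq> Y"
  shows "loop_hom (top_of_set Y) (\<lambda>x. H (0, circle_coord x)) = loop_hom (top_of_set Y) (\<lambda>x. H (1, circle_coord x))"
proof -
  let ?h = "\<lambda>p. H (fst p, circle_coord (snd p))"
  let ?X = "prod_topology (top_of_set {0..1::real}) (nsphere 1)"
  have cz: "continuous_map (nsphere 1) (top_of_set (sphere 0 1)) circle_coord"
    unfolding continuous_map_in_subtopology
    using continuous_map_circle_coord norm_circle_coord by fastforce
  have "continuous_map ?X (prod_topology (top_of_set {0..1}) (top_of_set (sphere 0 1)))
      (\<lambda>p. (fst p, circle_coord (snd p)))"
    using continuous_map_compose[OF continuous_map_snd cz, of "top_of_set {0..1::real}"]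
    by (intro continuous_map_pairedI continuous_map_fst) (simp only: o_def)
  then have 1: "continuous_map ?X (top_of_set ({0..1} \<times> sphere 0 1)) (\<lambda>p. (fst p, circle_coord (snd p)))"
    by (simp only: prod_topology_subtopology_eu)
  have 2: "continuous_map (top_of_set ({0..1} \<times> sphere 0 1)) (top_of_set Y) H"
    using assms by auto
  have "continuous_map ?X (top_of_set Y) ?h"
    using continuous_map_compose[OF 1 2] by (simp add: o_def)
  then have "homotopic_with (\<lambda>h. True) (nsphere 1) (top_of_set Y)
      (\<lambda>x. H (0, circle_coord x)) (\<lambda>x. H (1, circle_coord x))"
    unfolding homotopic_with_def by (intro exI[of _ ?h]) simp
  from homology_homotopy_empty[OF this] show ?thesis by metis
qed

section \<open>Images of small circles in the punctured projective line\<close>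

definition small_loop :: "complex poly \<Rightarrow> complex poly \<Rightarrow> complex \<Rightarrow> real \<Rightarrow> (nat \<Rightarrow> real) \<Rightarrow> 2 cproj" where
  "small_loop P Q p r = (\<lambda>x. proj_point (poly_vec P Q (p + of_real r * circle_coord x)))"

text \<open>The loop extends over the closed disc, which is contractible and has trivial first
  homology.\<close>

lemma small_loop_trivial:
  assumes PQ: "coprime P Q" and B: "finite B" and p: "proj_point (poly_vec P Q p) \<notin> B"
  shows "\<forall>\<^sub>F r in at_right 0. loop_hom (top_of_set (- B)) (small_loop P Q p r)
    = \<one>\<^bsub>homology_group 1 (top_of_set (- B))\<^esub>"
proof -
  have cont: "continuous_on UNIV (\<lambda>t. proj_point (poly_vec P Q t))"
    by (rule continuous_on_compose2[OF continuous_on_proj_point]) (auto intro!: continuous_on_poly_vec continuous_intros simp: poly_vec_nonzero[OF PQ])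
  have "open ((\<lambda>t. proj_point (poly_vec P Q t)) -` (- B))"
    using continuous_on_open_vimage[OF open_UNIV, THEN iffD1, OF cont, rule_format, OF open_Compl_finite_cproj2[OF B]] by simp
  then have "\<forall>\<^sub>F t in nhds p. t \<in> (\<lambda>t. proj_point (poly_vec P Q t)) -` (- B)"
    by (rule eventually_nhds_in_open) (use p in simp)
  then have "\<forall>\<^sub>F r in at_right 0. \<forall>t\<in>cball p r. proj_point (poly_vec P Q t) \<notin> B"
    by (intro eventually_cball_at_right_0) simp
  moreover have "\<forall>\<^sub>F r in at_right (0::real). r > 0" by (simp add: eventually_at_right_less)
  ultimately show ?thesis
  proof eventually_elim
    case (elim r)
    let ?S = "top_of_set (- B)" and ?D = "top_of_set (cball (0::complex) 1)"
    let ?G = "\<lambda>\<zeta>. proj_point (poly_vec P Q (p + of_real r * \<zeta>))"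
    have cD: "continuous_map (nsphere 1) ?D circle_coord"
      unfolding continuous_map_in_subtopology
      using continuous_map_circle_coord norm_circle_coord by fastforce
    have "continuous_on (cball 0 1) ?G"
      by (rule continuous_on_compose2[OF cont]) (auto intro!: continuous_intros)
    moreover have "?G \<zeta> \<notin> B" if "\<zeta> \<in> cball 0 1" for \<zeta>
      using elim that by (simp add: dist_norm norm_mult mult_left_le)
    ultimately have cG: "continuous_map ?D ?S ?G" by auto
    have "loop_hom ?S (small_loop P Q p r) = hom_induced 1 ?D {} ?S {} ?G (loop_hom ?D circle_coord)"
      using hom_induced_compose_empty[OF cD cG, of 1] by (simp add: small_loop_def o_def)
    moreover have "trivial_group (homology_group 1 ?D)"
      using trivial_reduced_homology_group_contractible_space[of ?D 1]
      by (simp add: un_reduced_homology_group convex_imp_contractible)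
    then have "loop_hom ?D circle_coord = \<one>\<^bsub>homology_group 1 ?D\<^esub>"
      using hom_induced_carrier by (fastforce simp: trivial_group_def)
    moreover have "hom_induced 1 ?D {} ?S {} ?G \<one>\<^bsub>homology_group 1 ?D\<^esub> = \<one>\<^bsub>homology_group 1 ?S\<^esub>"
      using hom_one[OF hom_induced_hom] by (metis group_relative_homology_group)
    ultimately show ?case by metis
  qed
qed

text \<open>\<open>e\<close> completes \<open>rep_vec b\<close> to a basis in which the second
  component of \<open>w\<close> is the form of \<open>b\<close> itself; the ratio of the components
  is then an affine coordinate centred at \<open>b\<close>.\<close>

lemma cproj2_chart:
  obtains e m1 m2 where "lin_form b e = 1" "\<And>w. w = (m1 * w $ 1 + m2 * w $ 2) *s rep_vec b + lin_form b w *s e"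
proof -
  define v where "v = rep_vec b"
  \<comment> \<open>\<open>N\<close> is the squared norm of \<open>v\<close>. The Hermitian
    orthogonal complement supplies the second basis vector without a case distinction on which entry
    of \<open>v\<close> is nonzero.\<close>
  define N where "N = v $ 1 * cnj (v $ 1) + v $ 2 * cnj (v $ 2)"
  have "N = of_real ((norm (v $ 1))\<^sup>2 + (norm (v $ 2))\<^sup>2)"
    by (simp add: N_def complex_norm_square[symmetric] del: of_real_power of_real_add) simp
  moreover have "v \<noteq> 0" by (simp add: v_def rep_vec)
  then have "v $ 1 \<noteq> 0 \<or> v $ 2 \<noteq> 0" by (auto simp: vec_eq_iff forall_2)
  ultimately have N: "N \<noteq> 0" by (auto simp: add_nonneg_eq_0_iff simp del: of_real_add of_real_power)
  define e :: "complex ^ 2" where "e = vector [cnj (v $ 2) / N, - cnj (v $ 1) / N]"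
  show ?thesis
  proof (rule that[of e "cnj (v $ 1) / N" "cnj (v $ 2) / N"])
    have "lin_form b e = (v $ 1 * cnj (v $ 1) + v $ 2 * cnj (v $ 2)) / N"
      by (simp add: lin_form_def e_def v_def add_divide_distrib)
    also have "\<dots> = 1" using N by (simp add: N_def)
    finally show "lin_form b e = 1" .
  next
    fix w :: "complex ^ 2"
    have "N * w $ 1 = (cnj (v $ 1) * w $ 1 + cnj (v $ 2) * w $ 2) * v $ 1 + (v $ 2 * w $ 1 - v $ 1 * w $ 2) * cnj (v $ 2)"
      "N * w $ 2 = (cnj (v $ 1) * w $ 1 + cnj (v $ 2) * w $ 2) * v $ 2 - (v $ 2 * w $ 1 - v $ 1 * w $ 2) * cnj (v $ 1)"
      by (simp_all add: N_def algebra_simps)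
    then show "w = (cnj (v $ 1) / N * w $ 1 + cnj (v $ 2) / N * w $ 2) *s rep_vec b + lin_form b w *s e"
      using N by (simp add: vec_eq_iff forall_2 e_def lin_form_def flip: v_def) (simp add: field_simps)
  qed
qed

lemma lin_form_add: "lin_form b (v + w) = lin_form b v + lin_form b w"
  by (simp add: lin_form_def algebra_simps)

lemma lin_form_rep_vec: "lin_form b (rep_vec b) = 0" "b' \<noteq> b \<Longrightarrow> lin_form b' (rep_vec b) \<noteq> 0"
  using lin_form_eq_0_iff[OF rep_vec(1)] rep_vec(2) by auto

text \<open>In the chart \<open>c \<mapsto> proj_point (rep_vec b + c e)\<close> at \<open>b\<close>, a loop of radius \<open>r\<close> around a zero of order
  \<open>k\<close> has the form \<open>\<zeta> \<mapsto> \<zeta>\<^sup>k exp (g \<zeta>)\<close>; moving \<open>g\<close> linearly to a constant deforms it to the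
  \<open>k\<close>-th power of a fixed loop without leaving the punctured disc.\<close>

lemma small_loop_around:
  assumes B: "finite B" "b \<in> B"
  obtains \<delta> where "\<delta> \<in> carrier (homology_group 1 (top_of_set (- B)))"
    "\<And>P Q p. coprime P Q \<Longrightarrow> lin_form_poly b P Q \<noteq> 0 \<Longrightarrow> poly (lin_form_poly b P Q) p = 0 \<Longrightarrow>
      \<forall>\<^sub>F r in at_right 0. loop_hom (top_of_set (- B)) (small_loop P Q p r)
        = \<delta> [^]\<^bsub>homology_group 1 (top_of_set (- B))\<^esub> (int (order p (lin_form_poly b P Q)))"
proof -
  let ?S = "top_of_set (- B)"
  obtain e m1 m2 where e: "lin_form b e = 1" and dec: "\<And>w. w = (m1 * w $ 1 + m2 * w $ 2) *s rep_vec b + lin_form b w *s e"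
    using cproj2_chart[of b] by blast
  define v where "v = rep_vec b"
  have nz: "v + c *s e \<noteq> 0" if "c \<noteq> 0" for c
  proof
    assume "v + c *s e = 0"
    then have "lin_form b (v + c *s e) = 0" by (simp add: lin_form_def)
    with that show False by (simp add: lin_form_add lin_form_scale lin_form_rep_vec e v_def)
  qed
  have "\<forall>\<^sub>F c in at 0. \<forall>b'\<in>B. lin_form b' (v + c *s e) \<noteq> 0"
  proof (rule eventually_ball_finite[OF B(1)], rule ballI)
    fix b' assume "b' \<in> B"
    show "\<forall>\<^sub>F c in at 0. lin_form b' (v + c *s e) \<noteq> 0"
    proof (cases "b' = b")
      case True
      have "\<forall>\<^sub>F c in at (0::complex). c \<noteq> 0" by (rule eventually_neq_at_within)
      then show ?thesis by eventually_elim (simp add: True lin_form_add lin_form_scale lin_form_rep_vec e v_def)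
    next
      case False
      have "((\<lambda>c. lin_form b' v + c * lin_form b' e) \<longlongrightarrow> lin_form b' v + 0 * lin_form b' e) (at 0)"
        by (intro tendsto_intros)
      then have "((\<lambda>c. lin_form b' (v + c *s e)) \<longlongrightarrow> lin_form b' v) (at 0)" by (simp add: lin_form_add lin_form_scale)
      then show ?thesis using lin_form_rep_vec(2)[OF False] by (intro tendsto_imp_eventually_ne) (simp_all add: v_def)
    qed
  qed
  \<comment> \<open>A punctured disc of the chart that avoids \<open>B\<close>: the form of
    \<open>b\<close> takes the value \<open>c\<close> there, and the forms of the other points are
    nonzero at the centre.\<close>
  then obtain \<epsilon> where \<epsilon>: "\<epsilon> > 0" "\<And>c. c \<noteq> 0 \<Longrightarrow> norm c < \<epsilon> \<Longrightarrow> \<forall>b'\<in>B. lin_form b' (v + c *s e) \<noteq> 0"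
    unfolding eventually_at by auto
  have inS: "proj_point (v + c *s e) \<in> - B" if "c \<noteq> 0" "norm c < \<epsilon>" for c
    using \<epsilon>(2)[OF that] nz[OF that(1)] lin_form_eq_0_iff by auto
  have cont: "continuous_on T (\<lambda>x. proj_point (v + c x *s e))" if "continuous_on T c" "\<And>x. x \<in> T \<Longrightarrow> c x \<noteq> 0"
    for c and T :: "'t::topological_space set"
  proof (rule continuous_on_compose2[OF continuous_on_proj_point])
    have "continuous_on T (\<lambda>x. \<chi> i. v $ i + c x * e $ i)" by (intro continuous_intros that)
    then show "continuous_on T (\<lambda>x. v + c x *s e)"
      by (rule continuous_on_eq) (simp add: vec_eq_iff)
  qed (use nz that in auto)
  \<comment> \<open>The loop behind \<open>\<delta>\<close> depends on the chart and on
    \<open>\<epsilon>\<close> only, not on \<open>P\<close>, \<open>Q\<close> or \<open>p\<close>.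
    Its radius may be any positive number below \<open>\<epsilon>\<close>.\<close>
  define \<psi> where "\<psi> x = proj_point (v + (of_real (\<epsilon>/2) * circle_coord x) *s e)" for x
  define \<delta> where "\<delta> = loop_hom ?S \<psi>"
  have c\<psi>: "continuous_map (nsphere 1) ?S \<psi>"
  proof -
    have 1: "continuous_map (nsphere 1) (top_of_set (sphere 0 1)) circle_coord"
      unfolding continuous_map_in_subtopology
      using continuous_map_circle_coord norm_circle_coord by fastforce
    have "continuous_on (sphere 0 1) (\<lambda>\<zeta>. proj_point (v + (of_real (\<epsilon>/2) * \<zeta>) *s e))"
      by (rule cont) (use \<epsilon>(1) in \<open>auto intro!: continuous_intros\<close>)
    moreover have "proj_point (v + (of_real (\<epsilon>/2) * \<zeta>) *s e) \<in> - B" if "\<zeta> \<in> sphere 0 1" for \<zeta> :: complex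
      by (rule inS) (use that \<epsilon>(1) in \<open>auto simp: norm_mult\<close>)
    ultimately have 2: "continuous_map (top_of_set (sphere 0 1)) ?S (\<lambda>\<zeta>. proj_point (v + (of_real (\<epsilon>/2) * \<zeta>) *s e))"
      by auto
    show ?thesis using continuous_map_compose[OF 1 2] by (simp add: o_def \<psi>_def[abs_def])
  qed
  show ?thesis
  proof (rule that[of \<delta>])
    show "\<delta> \<in> carrier (homology_group 1 ?S)" by (simp add: \<delta>_def hom_induced_carrier)
  next
    fix P Q p assume PQ: "coprime P Q" and \<beta>0: "lin_form_poly b P Q \<noteq> 0" and p0: "poly (lin_form_poly b P Q) p = 0"
    define \<alpha> where "\<alpha> = smult m1 P + smult m2 Q"
    define \<beta> where "\<beta> = lin_form_poly b P Q"
    define k where "k = order p \<beta>"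
    have decomp: "poly_vec P Q t = poly \<alpha> t *s v + poly \<beta> t *s e" for t
      using dec[of "poly_vec P Q t"] by (simp add: \<alpha>_def \<beta>_def v_def poly_lin_form_poly)
    \<comment> \<open>\<open>P\<close> and \<open>Q\<close> have no common zero, so at a root of
      \<open>\<beta>\<close> the other component survives, and \<open>\<beta> / \<alpha>\<close> is
      the chart coordinate of the loop.\<close>
    have \<alpha>p: "poly \<alpha> p \<noteq> 0" using poly_vec_nonzero[OF PQ, of p] decomp[of p] p0 by (auto simp: \<beta>_def)
    then have \<alpha>0: "\<alpha> \<noteq> 0" by auto
    have "((\<lambda>t. poly \<beta> t / poly \<alpha> t) \<longlongrightarrow> poly \<beta> p / poly \<alpha> p) (nhds p)"
      by (intro tendsto_intros \<alpha>p filterlim_ident)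
    then have "\<forall>\<^sub>F t in nhds p. dist (poly \<beta> t / poly \<alpha> t) 0 < \<epsilon>"
      using p0 \<epsilon>(1) by (auto simp: tendsto_iff \<beta>_def)
    moreover have "\<forall>\<^sub>F t in nhds p. poly \<alpha> t \<noteq> 0"
    proof -
      have "open {t. poly \<alpha> t \<noteq> 0}" by (intro open_Collect_neq continuous_intros)
      from eventually_nhds_in_open[OF this] show ?thesis using \<alpha>p by simp
    qed
    ultimately have "\<forall>\<^sub>F t in nhds p. dist (poly \<beta> t / poly \<alpha> t) 0 < \<epsilon> \<and> poly \<alpha> t \<noteq> 0"
      by (rule eventually_conj)
    from eventually_cball_at_right_0[OF this]
    have "\<forall>\<^sub>F r in at_right 0. \<forall>t\<in>cball p r. dist (poly \<beta> t / poly \<alpha> t) 0 < \<epsilon> \<and> poly \<alpha> t \<noteq> 0" .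
    moreover have "\<forall>\<^sub>F r in at_right 0. \<forall>t\<in>cball p r. t \<noteq> p \<longrightarrow> poly \<beta> t \<noteq> 0"
      using \<beta>0 unfolding \<beta>_def by (rule eventually_no_other_root)
    moreover have "\<forall>\<^sub>F r in at_right (0::real). r > 0" by (simp add: eventually_at_right_less)
    ultimately show "\<forall>\<^sub>F r in at_right 0. loop_hom ?S (small_loop P Q p r)
        = \<delta> [^]\<^bsub>homology_group 1 ?S\<^esub> (int (order p (lin_form_poly b P Q)))"
    proof eventually_elim
      case (elim r)
      obtain ga where ga: "continuous_on (cball 0 1) ga"
        "\<And>\<zeta>. \<zeta> \<in> cball 0 1 \<Longrightarrow> poly \<alpha> (p + of_real r * \<zeta>) = \<zeta> ^ order p \<alpha> * exp (ga \<zeta>)"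
        using poly_log_near[OF \<alpha>0 elim(3), of p] elim(1) by metis
      obtain gb where gb: "continuous_on (cball 0 1) gb"
        "\<And>\<zeta>. \<zeta> \<in> cball 0 1 \<Longrightarrow> poly \<beta> (p + of_real r * \<zeta>) = \<zeta> ^ order p \<beta> * exp (gb \<zeta>)"
        using poly_log_near[of \<beta> r p] \<beta>0 elim(2,3) unfolding \<beta>_def by metis
      define g where "g \<zeta> = gb \<zeta> - ga \<zeta>" for \<zeta>
      have o\<alpha>: "order p \<alpha> = 0" using \<alpha>p by (rule order_0I)
      have quot: "poly \<beta> (p + of_real r * \<zeta>) / poly \<alpha> (p + of_real r * \<zeta>) = \<zeta> ^ k * exp (g \<zeta>)"
        if "\<zeta> \<in> cball 0 1" for \<zeta>
        using ga(2)[OF that] gb(2)[OF that] by (simp add: o\<alpha> k_def g_def exp_diff)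
      have incb: "p + of_real r * \<zeta> \<in> cball p r" if "\<zeta> \<in> cball 0 1" for \<zeta> :: complex
        using that elim(3) by (simp add: dist_norm norm_mult mult_left_le)
      have cg: "continuous_on (sphere 0 1) g" unfolding g_def
        by (intro continuous_intros continuous_on_subset[OF ga(1)] continuous_on_subset[OF gb(1)]) auto
      have small: "Re (g \<zeta>) < ln \<epsilon>" if "\<zeta> \<in> sphere 0 1" for \<zeta>
      proof -
        have z: "\<zeta> \<in> cball 0 1" using that by auto
        have "norm (\<zeta> ^ k * exp (g \<zeta>)) < \<epsilon>"
          using elim(1) incb[OF z] quot[OF z] by (metis dist_0_norm dist_commute)
        then have "exp (Re (g \<zeta>)) < \<epsilon>" using that by (simp add: norm_mult norm_power)
        then have "ln (exp (Re (g \<zeta>))) < ln \<epsilon>" using \<epsilon>(1) by (subst ln_less_cancel_iff) auto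
        then show ?thesis by simp
      qed
      define c where "c q = exp (of_real (1 - fst q) * g (snd q) + of_real (fst q * ln (\<epsilon>/2))) * snd q ^ k"
        for q :: "real \<times> complex"
      define H where "H q = proj_point (v + c q *s e)" for q
      have cc: "continuous_on ({0..1} \<times> sphere 0 1) c"
        unfolding c_def
        by (intro continuous_intros continuous_on_compose2[OF cg]) auto
      have c0: "c q \<noteq> 0" "norm (c q) < \<epsilon>" if qz: "q \<in> {0..1} \<times> sphere 0 1" for q
      proof -
        obtain \<tau> \<zeta> where q: "q = (\<tau>, \<zeta>)" "0 \<le> \<tau>" "\<tau> \<le> 1" "norm \<zeta> = 1"
          using qz by (cases q) auto
        then show "c q \<noteq> 0" by (auto simp: c_def)
        have "norm (c q) = exp ((1 - \<tau>) * Re (g \<zeta>) + \<tau> * ln (\<epsilon>/2))"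
          using q by (simp add: c_def norm_mult norm_power del: of_real_diff of_real_mult)
        \<comment> \<open>The logarithm of the modulus is a convex combination of two numbers below
          \<open>ln \<epsilon>\<close>.\<close>
        also have "(1 - \<tau>) * Re (g \<zeta>) + \<tau> * ln (\<epsilon>/2) < ln \<epsilon>"
          by (rule convex_bound_lt) (use small[of \<zeta>] q \<epsilon>(1) in auto)
        finally show "norm (c q) < \<epsilon>" using \<epsilon>(1) by simp
      qed
      have "loop_hom ?S (\<lambda>x. H (0, circle_coord x)) = loop_hom ?S (\<lambda>x. H (1, circle_coord x))"
      proof (rule loop_hom_circle_homotopy)
        show "continuous_on ({0..1} \<times> sphere 0 1) H" unfolding H_def using cc c0(1) by (rule cont)
        show "H ` ({0..1} \<times> sphere 0 1) \<subseteq> - B" using inS c0 unfolding H_def by blast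
      qed
      moreover have "loop_hom ?S (small_loop P Q p r) = loop_hom ?S (\<lambda>x. H (0, circle_coord x))"
      proof (rule loop_hom_cong)
        fix x assume "x \<in> topspace (nsphere 1)"
        then have z: "circle_coord x \<in> cball 0 1" using norm_circle_coord by simp
        let ?t = "p + of_real r * circle_coord x"
        have a: "poly \<alpha> ?t \<noteq> 0" using elim(1) incb[OF z] by blast
        have "poly_vec P Q ?t = poly \<alpha> ?t *s (v + (poly \<beta> ?t / poly \<alpha> ?t) *s e)"
          unfolding decomp using a by (simp add: vec_eq_iff field_simps)
        also have "poly \<beta> ?t / poly \<alpha> ?t = c (0, circle_coord x)"
          unfolding quot[OF z] by (simp add: c_def)
        finally have eq: "poly_vec P Q ?t = poly \<alpha> ?t *s (v + c (0, circle_coord x) *s e)" .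
        then have "v + c (0, circle_coord x) *s e \<noteq> 0" using poly_vec_nonzero[OF PQ, of ?t] by (metis vector_mul_eq_0)
        then show "small_loop P Q p r x = H (0, circle_coord x)"
          unfolding small_loop_def H_def eq using a by (rule proj_point_scale[rotated])
      qed
      moreover have "loop_hom ?S (\<lambda>x. H (1, circle_coord x)) = loop_hom ?S (\<psi> \<circ> circle_power k)"
      proof (rule loop_hom_cong)
        fix x
        have "c (1, circle_coord x) = exp (complex_of_real (ln (\<epsilon> / 2))) * circle_coord x ^ k"
          by (simp add: c_def)
        also have "exp (complex_of_real (ln (\<epsilon> / 2))) = of_real (\<epsilon> / 2)"
          using \<epsilon>(1) by (subst exp_of_real) simp
        finally show "H (1, circle_coord x) = (\<psi> \<circ> circle_power k) x"
          by (simp only: H_def \<psi>_def o_apply circle_coord_power)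
      qed
      moreover have "loop_hom ?S (\<psi> \<circ> circle_power k)
          = hom_induced 1 (nsphere 1) {} ?S {} \<psi> (circle_class [^]\<^bsub>homology_group 1 (nsphere 1)\<^esub> (int k))"
        unfolding hom_induced_compose_empty[OF continuous_map_circle_power c\<psi>]
        by (simp only: o_apply hom_induced_circle_power)
      moreover have "\<dots> = \<delta> [^]\<^bsub>homology_group 1 ?S\<^esub> (int k)"
      proof -
        interpret group_hom "homology_group 1 (nsphere 1)" "homology_group 1 ?S" "hom_induced 1 (nsphere 1) {} ?S {} \<psi>"
          by (simp add: group_hom_def group_hom_axioms_def hom_induced_hom)
        show ?thesis unfolding \<delta>_def by (rule hom_int_pow[OF circle_class_carrier])
      qed
      ultimately show ?case unfolding k_def \<beta>_def by metis
    qed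
  qed
qed

subsection \<open>Characters near the trivial one\<close>

lemma carrier_complex_units: "carrier (mult_of complex_ring) = - {0}"
  "x \<otimes>\<^bsub>mult_of complex_ring\<^esub> y = x * y"
  by (auto simp: complex_ring_def)

text \<open>The zero class is the set of coboundaries, and these vanish on cycles.\<close>

lemma exp_char_zero: "exp_char X \<zero>\<^bsub>cohomology 1 X\<^esub> = trivial_char X"
proof -
  have "kronecker \<zero>\<^bsub>cohomology 1 X\<^esub> h = 0" if h: "h \<in> carrier (homology_group 1 X)" for h
  proof -
    have Z: "\<zero>\<^bsub>cohomology 1 X\<^esub> = coboundary 0 X (\<lambda>\<gamma>. 1) ` carrier (cochain_module 0 X)"
      by (simp add: twisted_cohomology_def quotient_module_def coboundaries_def)
    obtain c0 where c0: "singular_relcycle 1 X {} c0" "h = homologous_rel_set 1 X {} c0"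
      using h carrier_relative_homology_group[of 1 X "{}"] by auto
    have ev: "cochain_eval \<phi> c = 0" if \<phi>: "\<phi> \<in> \<zero>\<^bsub>cohomology 1 X\<^esub>" and c: "c \<in> h" for \<phi> c
    proof -
      obtain \<psi> where \<psi>: "\<phi> = coboundary 0 X (\<lambda>\<gamma>. 1) \<psi>" using \<phi> Z by auto
      have cyc: "singular_chain 1 X c" "chain_boundary 1 c = 0"
        using homologous_rel_singular_relcycle_1[OF _ c0(1)] c c0(2) singular_cycle by blast+
      have "cochain_eval \<phi> c = cochain_eval (\<lambda>\<sigma>. \<Sum>k\<le>Suc 0. (-1) ^ k * \<psi> (singular_face (Suc 0) k \<sigma>)) c"
        by (rule cochain_eval_cong[OF cyc(1)]) (simp add: \<psi> coboundary_def)
      also have "\<dots> = cochain_eval \<psi> (chain_boundary (Suc 0) c)"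
        by (rule cochain_eval_chain_boundary[symmetric])
      finally show ?thesis using cyc(2) by simp
    qed
    \<comment> \<open>A cochain in the class and a cycle in \<open>h\<close> must be exhibited,
      because \<open>kronecker\<close> picks its value by a definite description.\<close>
    have "(\<lambda>\<sigma>. 0) \<in> carrier (cochain_module 0 X)" by (simp add: cochain_module_def)
    then obtain \<phi> where \<phi>: "\<phi> \<in> \<zero>\<^bsub>cohomology 1 X\<^esub>" using Z by blast
    have c: "c0 \<in> h" using c0(2) by simp
    show ?thesis unfolding kronecker_def
    proof (rule the_equality)
      show "\<forall>\<phi>\<in>\<zero>\<^bsub>cohomology 1 X\<^esub>. \<forall>c\<in>h. cochain_eval \<phi> c = 0" using ev by blast
      show "t = 0" if "\<forall>\<phi>\<in>\<zero>\<^bsub>cohomology 1 X\<^esub>. \<forall>c\<in>h. cochain_eval \<phi> c = t" for t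
        using that \<phi> c ev by metis
    qed
  qed
  then show ?thesis by (auto simp: exp_char_def trivial_char_def)
qed

text \<open>Each component brings its own neighbourhoods, but the exponential is the same map. On
  the image \<open>N\<close> of the common domain, injectivity on \<open>U2\<close> identifies the
  point of \<open>E\<close> that comes from \<open>W'\<close> with a point of \<open>U1\<close>, and
  so its image lies in \<open>W\<close>.\<close>

lemma corresponding_component_germ:
  assumes "corresponding_component X E W" "corresponding_component X E W'"
  obtains N where "openin (char_topology X) N" "trivial_char X \<in> N" "W' \<inter> N \<subseteq> W"
proof -
  let ?T = "cohomology_topology X" and ?T' = "char_topology X" and ?e = "exp_char X"
  let ?z = "\<zero>\<^bsub>cohomology 1 X\<^esub>"
  obtain U1 U1' where 1: "openin ?T U1" "?z \<in> U1" "?e ` (E \<inter> U1) = W \<inter> U1'"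
    using assms(1) unfolding corresponding_component_def by blast
  obtain U2 U2' where 2: "openin ?T U2" "?z \<in> U2" "openin ?T' U2'"
    "homeomorphic_map (subtopology ?T U2) (subtopology ?T' U2') ?e" "?e ` (E \<inter> U2) = W' \<inter> U2'"
    using assms(2) unfolding corresponding_component_def by blast
  have top2: "topspace (subtopology ?T U2) = U2" "topspace (subtopology ?T' U2') = U2'"
    using openin_subset[OF 2(1)] openin_subset[OF 2(3)] by auto
  have inj: "inj_on ?e U2" and im: "?e ` U2 = U2'"
    using homeomorphic_imp_injective_map[OF 2(4)] homeomorphic_imp_surjective_map[OF 2(4)] top2 by auto
  define N where "N = ?e ` (U1 \<inter> U2)"
  have "openin (subtopology ?T U2) (U1 \<inter> U2)"
    using 1(1) by (auto simp: openin_subtopology)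
  then have "openin (subtopology ?T' U2') N"
    using homeomorphic_imp_open_map[OF 2(4)] unfolding open_map_def N_def by blast
  then have "openin ?T' N" using 2(3) openin_open_subtopology by blast
  moreover have "trivial_char X \<in> N" unfolding N_def exp_char_zero[symmetric] by (intro imageI IntI 1(2) 2(2))
  moreover have "W' \<inter> N \<subseteq> W"
  proof
    fix \<rho> assume "\<rho> \<in> W' \<inter> N"
    then obtain v where v: "v \<in> U1" "v \<in> U2" "\<rho> = ?e v" "\<rho> \<in> W'" unfolding N_def by auto
    then have "\<rho> \<in> ?e ` (E \<inter> U2)" using 2(5) im by auto
    then obtain x where x: "x \<in> E" "x \<in> U2" "\<rho> = ?e x" by auto
    then have "x = v" using inj v by (metis inj_onD)
    then show "\<rho> \<in> W" using 1(3) x v by auto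
  qed
  ultimately show ?thesis using that by blast
qed

lemma pullback_char_in_torus:
  assumes "\<rho> \<in> char_torus Y" shows "pullback_char X Y f \<rho> \<in> char_torus X"
proof -
  interpret group "homology_group 1 X" by simp
  have "hom_induced 1 X {} Y {} f \<in> hom (homology_group 1 X) (homology_group 1 Y)" by (rule hom_induced_hom)
  then show ?thesis
    using assms unfolding char_torus_def pullback_char_def hom_def by (auto simp: Pi_iff)
qed

text \<open>The factor \<open>2\<pi>\<i>\<close> is left out of the exponent on purpose: the absolute value of the character then
  determines \<open>s\<close> times the winding class.\<close>

definition winding_char :: "'b topology \<Rightarrow> ('b \<Rightarrow> complex) \<Rightarrow> real \<Rightarrow> 'b chain set \<Rightarrow> complex" where
  "winding_char Y u s = (\<lambda>h \<in> carrier (homology_group 1 Y).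
     exp (of_real s * winding_class (hom_induced 1 Y {} punctured_plane {} u h)))"

lemma winding_char_in_torus: "winding_char Y u s \<in> char_torus Y"
proof -
  interpret group "homology_group 1 Y" by simp
  let ?u = "hom_induced 1 Y {} punctured_plane {} u"
  have "winding_class (?u (x \<otimes>\<^bsub>homology_group 1 Y\<^esub> y)) = winding_class (?u x) + winding_class (?u y)"
    if "x \<in> carrier (homology_group 1 Y)" "y \<in> carrier (homology_group 1 Y)" for x y
    using hom_mult[OF hom_induced_hom that] winding_class_mult hom_induced_carrier by metis
  then show ?thesis
    by (auto simp: char_torus_def hom_def winding_char_def carrier_complex_units distrib_left exp_add
        simp del: carrier_mult_of mult_mult_of)
qed

text \<open>In the topology of pointwise convergence the characters depend continuously on
  \<open>s\<close>, and \<open>s = 0\<close> gives the trivial one.\<close>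

lemma small_winding_chars:
  assumes N: "openin (char_topology X) N" "trivial_char X \<in> N"
  obtains \<epsilon> where "\<epsilon> > 0" "\<And>s. \<bar>s\<bar> < \<epsilon> \<Longrightarrow> pullback_char X Y f (winding_char Y u s) \<in> N"
proof -
  let ?p = "\<lambda>s. pullback_char X Y f (winding_char Y u s)"
  have val: "?p s = (\<lambda>h\<in>carrier (homology_group 1 X).
      exp (of_real s * winding_class (hom_induced 1 Y {} punctured_plane {} u (hom_induced 1 X {} Y {} f h))))" for s
    by (auto simp: pullback_char_def winding_char_def hom_induced_carrier)
  have "continuous_map euclideanreal (char_topology X) ?p"
    unfolding char_topology_def continuous_map_in_subtopology
  proof
    show "continuous_map euclideanreal (product_topology (\<lambda>h. euclidean) (carrier (homology_group 1 X))) ?p"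
      unfolding continuous_map_componentwise
    proof (intro conjI ballI)
      show "?p ` topspace euclideanreal \<subseteq> extensional (carrier (homology_group 1 X))" by (auto simp: val)
      fix h assume "h \<in> carrier (homology_group 1 X)"
      then show "continuous_map euclideanreal euclidean (\<lambda>s. ?p s h)"
        unfolding val by (auto intro!: continuous_intros)
    qed
    show "?p \<in> topspace euclideanreal \<rightarrow> char_torus X"
      using pullback_char_in_torus[OF winding_char_in_torus] by auto
  qed
  then have "open {s. ?p s \<in> N}"
    using openin_continuous_map_preimage[OF _ N(1)] by fastforce
  moreover have "?p 0 = trivial_char X" unfolding val trivial_char_def by simp
  then have "0 \<in> {s. ?p s \<in> N}" using N(2) by simp
  ultimately obtain \<epsilon> where "\<epsilon> > 0" "ball 0 \<epsilon> \<subseteq> {s. ?p s \<in> N}" by (metis open_contains_ball)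
  then show ?thesis by (intro that[of \<epsilon>]) (auto simp: subset_iff)
qed

text \<open>The comparison of germs in one direction: small characters coming from \<open>Y'\<close>
  factor through \<open>f\<close>. Exchanging the two hypotheses gives the other direction.\<close>

lemma common_small_characters:
  assumes "corresponding_component X E (pullback_char X Y f ` char_torus Y)"
    "corresponding_component X E (pullback_char X Y' f' ` char_torus Y')"
  obtains \<epsilon> where "\<epsilon> > 0" "\<And>s. \<bar>s\<bar> < \<epsilon> \<Longrightarrow> \<exists>\<rho>\<in>char_torus Y. \<forall>h\<in>carrier (homology_group 1 X).
     \<rho> (hom_induced 1 X {} Y {} f h)
       = exp (of_real s * winding_class (hom_induced 1 Y' {} punctured_plane {} u (hom_induced 1 X {} Y' {} f' h)))"
proof -
  obtain N where N: "openin (char_topology X) N" "trivial_char X \<in> N"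
    "pullback_char X Y' f' ` char_torus Y' \<inter> N \<subseteq> pullback_char X Y f ` char_torus Y"
    using corresponding_component_germ[OF assms] by blast
  obtain \<epsilon> where \<epsilon>: "\<epsilon> > 0" "\<And>s. \<bar>s\<bar> < \<epsilon> \<Longrightarrow> pullback_char X Y' f' (winding_char Y' u s) \<in> N"
    using small_winding_chars[OF N(1,2)] by blast
  show ?thesis
  proof (rule that[OF \<epsilon>(1)])
    fix s :: real assume "\<bar>s\<bar> < \<epsilon>"
    then have "pullback_char X Y' f' (winding_char Y' u s) \<in> pullback_char X Y f ` char_torus Y"
      using \<epsilon>(2) N(3) winding_char_in_torus by blast
    then obtain \<rho> where \<rho>: "\<rho> \<in> char_torus Y" "pullback_char X Y' f' (winding_char Y' u s) = pullback_char X Y f \<rho>"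
      by auto
    have "\<rho> (hom_induced 1 X {} Y {} f h)
       = exp (of_real s * winding_class (hom_induced 1 Y' {} punctured_plane {} u (hom_induced 1 X {} Y' {} f' h)))"
      if h: "h \<in> carrier (homology_group 1 X)" for h
      using fun_cong[OF \<rho>(2), of h] h
      by (simp add: pullback_char_def winding_char_def hom_induced_carrier)
    with \<rho>(1) show "\<exists>\<rho>\<in>char_torus Y. \<forall>h\<in>carrier (homology_group 1 X).
     \<rho> (hom_induced 1 X {} Y {} f h)
       = exp (of_real s * winding_class (hom_induced 1 Y' {} punctured_plane {} u (hom_induced 1 X {} Y' {} f' h)))"
      by blast
  qed
qed

lemma char_torus_mult:
  assumes "\<rho> \<in> char_torus Y" "x \<in> carrier (homology_group 1 Y)" "y \<in> carrier (homology_group 1 Y)"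
  shows "\<rho> (x \<otimes>\<^bsub>homology_group 1 Y\<^esub> y) = \<rho> x * \<rho> y" "\<rho> x \<noteq> 0"
  using assms by (auto simp: char_torus_def hom_def carrier_complex_units Pi_iff
      simp del: carrier_mult_of mult_mult_of)

lemma char_torus_one:
  assumes "\<rho> \<in> char_torus Y" shows "\<rho> \<one>\<^bsub>homology_group 1 Y\<^esub> = 1"
proof -
  interpret group "homology_group 1 Y" by simp
  show ?thesis
    using char_torus_mult[OF assms one_closed one_closed] by (simp del: one_relative_homology_group)
qed

lemma char_torus_int_pow:
  assumes "\<rho> \<in> char_torus Y" "x \<in> carrier (homology_group 1 Y)"
  shows "\<rho> (x [^]\<^bsub>homology_group 1 Y\<^esub> (int k)) = \<rho> x ^ k"
proof -
  interpret group "homology_group 1 Y" by simp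
  show ?thesis
    unfolding int_pow_int
  proof (induction k)
    case 0 show ?case using char_torus_one[OF assms(1)] by simp
  next
    case (Suc k)
    then show ?case using char_torus_mult(1)[OF assms(1) nat_pow_closed[OF assms(2), of k] assms(2)] by simp
  qed
qed

subsection \<open>Restriction to projective lines\<close>

text \<open>Coprimality lets the pair define a map on the whole affine line, which continues
  \<open>f\<close> across the points of \<open>C\<close>. The point \<open>z\<close> at infinity is
  not covered.\<close>

definition line_rep :: "3 cproj set \<Rightarrow> (3 cproj \<Rightarrow> 2 cproj) \<Rightarrow> complex ^ 3 \<Rightarrow> complex ^ 3
    \<Rightarrow> complex poly \<Rightarrow> complex poly \<Rightarrow> bool" where
  "line_rep C f a z P Q \<longleftrightarrow> coprime P Q \<and>
    (\<forall>t. proj_point (a + t *s z) \<notin> C \<longrightarrow> f (proj_point (a + t *s z)) = proj_point (poly_vec P Q t))"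

lemma line_repD:
  assumes "line_rep C f a z P Q"
  shows "coprime P Q" "proj_point (a + t *s z) \<notin> C \<Longrightarrow> f (proj_point (a + t *s z)) = proj_point (poly_vec P Q t)"
  using assms by (auto simp: line_rep_def)

lemma finite_line_curve:
  assumes "homogeneous_poly d g" "\<And>v. v \<noteq> 0 \<Longrightarrow> proj_point v \<in> C \<longleftrightarrow> g v = 0"
    "z \<noteq> 0" "proj_point z \<notin> C" "\<And>t. a + t *s z \<noteq> 0"
  shows "finite {t. proj_point (a + t *s z) \<in> C}"
proof -
  obtain q where q: "\<And>t. poly q t = g (a + t *s z)" "coeff q d = g z"
    using homogeneous_poly_on_line[OF assms(1), of a z] by metis
  then have "q \<noteq> 0" using assms(2-4) by auto
  from poly_roots_finite[OF this] show ?thesis by (simp add: q(1) assms(2,5))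
qed

text \<open>The degrees agree because \<open>z\<close>, the point at infinity of the line, is mapped outside \<open>B\<close>.\<close>

lemma regular_map_on_line:
  assumes g: "homogeneous_poly d0 g" "\<And>v. v \<noteq> 0 \<Longrightarrow> proj_point v \<in> C \<longleftrightarrow> g v = 0"
    and z: "z \<noteq> 0" "proj_point z \<notin> C" "\<And>t. a + t *s z \<noteq> 0"
    and f: "regular_map (- C) (- B) f"
  obtains P Q D where "line_rep C f a z P Q"
    "\<And>b. b \<in> B \<Longrightarrow> lin_form_poly b P Q \<noteq> 0 \<and> degree (lin_form_poly b P Q) = D"
proof -
  have zC: "proj_point z \<in> - C" using z by simp
  obtain d e h F where F: "\<And>j. homogeneous_poly d (\<lambda>v. F v $ j)" "homogeneous_poly e h" "h z \<noteq> 0"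
    "\<And>v. v \<noteq> 0 \<Longrightarrow> proj_point v \<in> - C \<Longrightarrow> h v \<noteq> 0 \<Longrightarrow> F v \<noteq> 0 \<and> f (proj_point v) = proj_point (F v)"
    by (rule regular_map_local[OF f z(1) zC]) (rule that)
  obtain gp where gp: "\<And>t. poly gp t = g (a + t *s z)" "coeff gp d0 = g z"
    using homogeneous_poly_on_line[OF g(1), of a z] by metis
  obtain hp where hp: "\<And>t. poly hp t = h (a + t *s z)" "coeff hp e = h z"
    using homogeneous_poly_on_line[OF F(2), of a z] by metis
  obtain P0 where P0: "\<And>t. poly P0 t = F (a + t *s z) $ 1" "degree P0 \<le> d" "coeff P0 d = F z $ 1"
    using homogeneous_poly_on_line[OF F(1)[of 1], of a z] by metis
  obtain Q0 where Q0: "\<And>t. poly Q0 t = F (a + t *s z) $ 2" "degree Q0 \<le> d" "coeff Q0 d = F z $ 2"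
    using homogeneous_poly_on_line[OF F(1)[of 2], of a z] by metis
  have nz: "gp \<noteq> 0" "hp \<noteq> 0" using gp hp F(3) g(2)[OF z(1)] z(2) by auto
  have Fz: "F z \<noteq> 0" "f (proj_point z) = proj_point (F z)" using F(4)[OF z(1) zC F(3)] by auto
  have PQ0: "P0 \<noteq> 0 \<or> Q0 \<noteq> 0" using Fz(1) P0(3) Q0(3) by (auto simp: vec_eq_iff forall_2)
  \<comment> \<open>The vector of forms that is valid near \<open>z\<close> may vanish elsewhere on
    the line; dividing by the greatest common divisor removes these zeros.\<close>
  define G where "G = gcd P0 Q0"
  define P Q where "P = P0 div G" and "Q = Q0 div G"
  have G0: "G \<noteq> 0" using PQ0 by (auto simp: G_def)
  have PQG: "P0 = G * P" "Q0 = G * Q" by (simp_all add: P_def Q_def G_def)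
  have cop: "coprime P Q" unfolding P_def Q_def G_def using PQ0 by (intro div_gcd_coprime) auto
  have inC: "proj_point (a + t *s z) \<notin> C \<longleftrightarrow> poly gp t \<noteq> 0" for t using g(2)[OF z(3)] gp(1) by simp
  have rep: "f (proj_point (a + t *s z)) = proj_point (poly_vec P Q t)"
    if t: "proj_point (a + t *s z) \<notin> C" for t
  proof -
    let ?u = "a + t *s z"
    have uC: "proj_point ?u \<in> - C" using t by simp
    obtain d1 e1 h1 F1 where F1: "\<And>j. homogeneous_poly d1 (\<lambda>v. F1 v $ j)" "homogeneous_poly e1 h1" "h1 ?u \<noteq> 0"
      "\<And>v. v \<noteq> 0 \<Longrightarrow> proj_point v \<in> - C \<Longrightarrow> h1 v \<noteq> 0 \<Longrightarrow> F1 v \<noteq> 0 \<and> f (proj_point v) = proj_point (F1 v)"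
      by (rule regular_map_local[OF f z(3) uC]) (rule that)
    obtain hp1 where hp1: "\<And>t. poly hp1 t = h1 (a + t *s z)"
      using homogeneous_poly_on_line[OF F1(2), of a z] by metis
    obtain P1 where P1: "\<And>t. poly P1 t = F1 (a + t *s z) $ 1"
      using homogeneous_poly_on_line[OF F1(1)[of 1], of a z] by metis
    obtain Q1 where Q1: "\<And>t. poly Q1 t = F1 (a + t *s z) $ 2"
      using homogeneous_poly_on_line[OF F1(1)[of 2], of a z] by metis
    \<comment> \<open>Near \<open>t\<close> a different vector of forms may represent
      \<open>f\<close>. Where none of \<open>gp\<close>, \<open>hp\<close>, \<open>hp1\<close>
      vanishes both are valid and proportional; multiplying by these factors extends the identity to
      all parameters.\<close>
    have "poly (gp * hp * hp1 * (P0 * Q1 - Q0 * P1)) s = 0" for s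
    proof (cases "poly gp s = 0 \<or> poly hp s = 0 \<or> poly hp1 s = 0")
      case False
      then have s: "proj_point (a + s *s z) \<in> - C" "h (a + s *s z) \<noteq> 0" "h1 (a + s *s z) \<noteq> 0"
        using inC hp hp1 by auto
      have "F (a + s *s z) \<noteq> 0" "F1 (a + s *s z) \<noteq> 0"
        "proj_point (F (a + s *s z)) = proj_point (F1 (a + s *s z))"
        using F(4)[OF z(3) s(1,2)] F1(4)[OF z(3) s(1,3)] by auto
      then have "F (a + s *s z) $ 2 * F1 (a + s *s z) $ 1 = F (a + s *s z) $ 1 * F1 (a + s *s z) $ 2"
        using proj_point_eq_det by metis
      then show ?thesis by (simp add: P0 Q0 P1 Q1)
    qed auto
    then have "gp * hp * hp1 * (P0 * Q1 - Q0 * P1) = 0" by (simp add: poly_all_0_iff_0[symmetric])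
    moreover have "hp1 \<noteq> 0" using F1(3) hp1[of t] by auto
    ultimately have "P0 * Q1 = Q0 * P1" using nz by simp
    then have "P * Q1 = Q * P1" using G0 unfolding PQG by (simp add: mult.assoc)
    then have *: "poly P t * poly Q1 t = poly Q t * poly P1 t" by (metis poly_mult)
    have "F1 ?u \<noteq> 0" "f (proj_point ?u) = proj_point (F1 ?u)" using F1(4)[OF z(3) uC F1(3)] by auto
    moreover have "proj_point (poly_vec P Q t) = proj_point (F1 ?u)"
      using proj_point_eq_det[OF poly_vec_nonzero[OF cop] \<open>F1 ?u \<noteq> 0\<close>] * by (simp add: P1 Q1)
    ultimately show ?thesis by simp
  qed
  show ?thesis
  proof (rule that[of P Q "d - degree G"])
    show "line_rep C f a z P Q" unfolding line_rep_def using cop rep by blast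
    fix b assume b: "b \<in> B"
    have "proj_point (F z) \<notin> B" using f zC Fz(2) unfolding regular_map_def by auto
    then have "lin_form b (F z) \<noteq> 0" using lin_form_eq_0_iff[OF Fz(1)] b by auto
    then have co: "coeff (lin_form_poly b P0 Q0) d \<noteq> 0" by (simp add: lin_form_poly_def P0(3) Q0(3) lin_form_def)
    moreover have "degree (lin_form_poly b P0 Q0) \<le> d" unfolding lin_form_poly_def
      by (intro degree_diff_le order_trans[OF degree_smult_le] P0 Q0)
    ultimately have d: "degree (lin_form_poly b P0 Q0) = d" using le_degree by (metis le_antisym)
    have eq: "lin_form_poly b P0 Q0 = G * lin_form_poly b P Q" unfolding lin_form_poly_def PQG by (simp add: algebra_simps)
    have nz: "lin_form_poly b P Q \<noteq> 0" using co eq by auto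
    then have "degree (lin_form_poly b P0 Q0) = degree G + degree (lin_form_poly b P Q)" unfolding eq using G0 by (simp add: degree_mult_eq)
    then show "lin_form_poly b P Q \<noteq> 0 \<and> degree (lin_form_poly b P Q) = d - degree G" using d nz by simp
  qed
qed

lemma two_points_line:
  assumes g: "homogeneous_poly d g" "\<And>v. v \<noteq> 0 \<Longrightarrow> proj_point v \<in> C \<longleftrightarrow> g v = 0"
    and x: "x \<notin> C" "x' \<notin> C" "x \<noteq> x'"
  obtains a z t0 t1 where "z \<noteq> 0" "proj_point z \<notin> C" "\<And>t. a + t *s z \<noteq> 0"
    "x = proj_point (a + t0 *s z)" "x' = proj_point (a + t1 *s z)"
proof -
  obtain v where v: "v \<noteq> 0" "x = proj_point v" using proj_point_cases by blast
  obtain w where w: "w \<noteq> 0" "x' = proj_point w" using proj_point_cases by blast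
  have ind: "w \<noteq> c *s v" for c using x(3) v w proj_point_eq_iff by metis
  have gv: "g v \<noteq> 0" "g w \<noteq> 0" using g(2) v w x by auto
  obtain q where q: "\<And>t. poly q t = g (w + t *s v)" "coeff q d = g v"
    using homogeneous_poly_on_line[OF g(1), of w v] by metis
  \<comment> \<open>The factor \<open>[:0, 1:]\<close> also forces \<open>s \<noteq> 0\<close>,
    which keeps \<open>w\<close> from being the point at infinity of the line.\<close>
  have "q * [:0, 1:] \<noteq> 0" using q(2) gv by auto
  then obtain s where s: "poly (q * [:0, 1:]) s \<noteq> 0" using poly_all_0_iff_0 by blast
  then have s0: "s \<noteq> 0" "g (w + s *s v) \<noteq> 0" by (auto simp: q(1))
  define z where "z = w + s *s v"
  have az: "v + t *s z = (1 + t * s) *s v + t *s w" for t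
    by (simp add: z_def vec_eq_iff algebra_simps)
  have z0: "z \<noteq> 0"
  proof
    assume "z = 0"
    then have "w = (- s) *s v" by (simp add: z_def vec_eq_iff eq_neg_iff_add_eq_0)
    then show False using ind by blast
  qed
  show ?thesis
  \<comment> \<open>The second parameter is where the coefficient \<open>1 + t * s\<close> of
    \<open>v\<close> in \<open>az\<close> vanishes.\<close>
  proof (rule that[of z v 0 "- 1 / s"])
    show "z \<noteq> 0" by (rule z0)
    show "proj_point z \<notin> C" using g(2)[OF z0] s0(2) by (simp add: z_def)
    show "v + t *s z \<noteq> 0" for t
    proof
      assume *: "v + t *s z = 0"
      show False
      proof (cases "t = 0")
        case True then show False using * v by (simp add: vec_eq_iff)
      next
        case False
        from * have "(1 + t * s) * v $ i + t * w $ i = 0" for i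
          unfolding az by (simp add: vec_eq_iff algebra_simps)
        then have "w = (- (1 + t * s) / t) *s v"
          using False by (simp add: vec_eq_iff field_simps eq_neg_iff_add_eq_0)
        then show False using ind by blast
      qed
    qed
    show "x = proj_point (v + 0 *s z)" using v(2) by simp
    have "v + (- 1 / s) *s z = (- 1 / s) *s w" unfolding az using s0(1) by (simp add: vec_eq_iff)
    then show "x' = proj_point (v + (- 1 / s) *s z)"
      using w(2) proj_point_scale[OF _ w(1), of "- 1 / s"] s0(1) by (simp only:) simp
  qed
qed

lemma line_loop:
  assumes fin: "finite {t. proj_point (a + t *s z) \<in> C}" and nz: "\<And>t. a + t *s z \<noteq> 0"
  shows "\<forall>\<^sub>F r in at_right 0. continuous_map (nsphere 1) (top_of_set (- C))
    (\<lambda>x. proj_point (a + (p + of_real r * circle_coord x) *s z))"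
proof -
  let ?Z = "{t. proj_point (a + t *s z) \<in> C} - {p}"
  have "finite ?Z" using fin by simp
  then have "open (- ?Z)" by (intro open_Compl finite_imp_closed)
  then have "\<forall>\<^sub>F t in nhds p. t \<in> - ?Z" by (rule eventually_nhds_in_open) simp
  from eventually_cball_at_right_0[OF this]
  have "\<forall>\<^sub>F r in at_right 0. \<forall>t\<in>cball p r. t \<in> - ?Z" .
  moreover have "\<forall>\<^sub>F r in at_right (0::real). r > 0" by (simp add: eventually_at_right_less)
  ultimately show ?thesis
  proof eventually_elim
    case (elim r)
    have 1: "continuous_map (nsphere 1) (top_of_set (sphere 0 1)) circle_coord"
      unfolding continuous_map_in_subtopology
      using continuous_map_circle_coord norm_circle_coord by fastforce
    let ?L = "\<lambda>\<zeta>. proj_point (a + (p + of_real r * \<zeta>) *s z)"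
    have "continuous_on (sphere 0 1) ?L"
    proof (rule continuous_on_compose2[OF continuous_on_proj_point])
      have "continuous_on (sphere 0 1) (\<lambda>\<zeta>. \<chi> i. a $ i + (p + of_real r * \<zeta>) * z $ i)"
        by (intro continuous_intros)
      then show "continuous_on (sphere 0 1) (\<lambda>\<zeta>. a + (p + of_real r * \<zeta>) *s z)"
        by (rule continuous_on_eq) (simp add: vec_eq_iff algebra_simps)
    qed (rule image_subsetI, rule CollectI, rule nz)
    moreover have "?L \<zeta> \<in> - C" if "\<zeta> \<in> sphere 0 1" for \<zeta>
    proof -
      have "p + of_real r * \<zeta> \<in> cball p r" "p + of_real r * \<zeta> \<noteq> p"
        using that elim(2) by (auto simp: dist_norm norm_mult)
      then show ?thesis using elim(1) by blast
    qed
    ultimately have 2: "continuous_map (top_of_set (sphere 0 1)) (top_of_set (- C)) ?L" by auto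
    show ?case using continuous_map_compose[OF 1 2] by (simp add: o_def)
  qed
qed

text \<open>A local argument principle: on the loop the coordinate is a quotient of two polynomials,
  each of which is a power of \<open>\<zeta>\<close> times an exponential. The centre
  \<open>p\<close> itself may be mapped into \<open>C\<close>.\<close>

lemma winding_class_small_loop:
  assumes rep: "line_rep C f a z P Q" and f: "continuous_on (- C) f" "f ` (- C) \<subseteq> - B"
    and B: "finite B" "j \<in> B" "k \<in> B" and nz: "lin_form_poly j P Q \<noteq> 0" "lin_form_poly k P Q \<noteq> 0"
    and fin: "finite {t. proj_point (a + t *s z) \<in> C}" and az: "\<And>t. a + t *s z \<noteq> 0"
  shows "\<forall>\<^sub>F r in at_right 0. winding_class (hom_induced 1 (top_of_set (- B)) {} punctured_plane {} (lin_form_ratio j k)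
     (hom_induced 1 (top_of_set (- C)) {} (top_of_set (- B)) {} f
       (loop_hom (top_of_set (- C)) (\<lambda>x. proj_point (a + (p + of_real r * circle_coord x) *s z)))))
    = of_nat (order p (lin_form_poly j P Q)) - of_nat (order p (lin_form_poly k P Q))"
proof -
  have PQ: "coprime P Q" using rep by (simp add: line_rep_def)
  have ev: "\<forall>\<^sub>F r in at_right (0::real). r > 0" by (simp add: eventually_at_right_less)
  show ?thesis
    using ev line_loop[OF fin az, where p=p] eventually_no_other_root[OF nz(1), of p] eventually_no_other_root[OF nz(2), of p]
  proof eventually_elim
    case (elim r)
    let ?lam = "\<lambda>x. proj_point (a + (p + of_real r * circle_coord x) *s z)"
    let ?S = "top_of_set (- B)" and ?M = "top_of_set (- C)"
    let ?F = "lin_form_ratio j k \<circ> (f \<circ> ?lam)"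
    have cf: "continuous_map ?M ?S f" using f by auto
    have cu: "continuous_map ?S punctured_plane (lin_form_ratio j k)"
      using continuous_on_lin_form_ratio[OF B(1,3)] lin_form_ratio_nonzero[OF B(2,3)] by auto
    have cfl: "continuous_map (nsphere 1) ?S (f \<circ> ?lam)" by (rule continuous_map_compose[OF elim(2) cf])
    have cF: "continuous_map (nsphere 1) punctured_plane ?F" by (rule continuous_map_compose[OF cfl cu])
    obtain gj where gj: "continuous_on (cball 0 1) gj"
        "\<And>\<zeta>. \<zeta> \<in> cball 0 1 \<Longrightarrow> poly (lin_form_poly j P Q) (p + of_real r * \<zeta>) = \<zeta> ^ order p (lin_form_poly j P Q) * exp (gj \<zeta>)"
      using poly_log_near[OF nz(1) elim(1), of p] elim(3) by metis
    obtain gk where gk: "continuous_on (cball 0 1) gk"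
        "\<And>\<zeta>. \<zeta> \<in> cball 0 1 \<Longrightarrow> poly (lin_form_poly k P Q) (p + of_real r * \<zeta>) = \<zeta> ^ order p (lin_form_poly k P Q) * exp (gk \<zeta>)"
      using poly_log_near[OF nz(2) elim(1), of p] elim(4) by metis
    define e where "e t = exp (2 * of_real pi * \<i> * of_real t)" for t :: real
    have e1: "norm (e t) = 1" for t by (simp add: e_def)
    define nj nk where "nj = order p (lin_form_poly j P Q)" and "nk = order p (lin_form_poly k P Q)"
    define G where "G t = (of_nat nj * (2 * of_real pi * \<i> * of_real t) - of_nat nk * (2 * of_real pi * \<i> * of_real t))
        + (gj (e t) - gk (e t))" for t :: real
    have ce: "continuous_on {0..1} e" unfolding e_def by (intro continuous_intros)
    have "winding_class (loop_hom punctured_plane ?F) = (G 1 - G 0) / (2 * of_real pi * \<i>)"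
    proof (rule winding_class_loop[OF cF])
      show "continuous_on {0..1} G" unfolding G_def
        by (intro continuous_intros continuous_on_compose2[OF gj(1) ce] continuous_on_compose2[OF gk(1) ce])
           (use e1 in auto)
      fix t :: real assume "t \<in> {0..1}"
      have ecb: "e t \<in> cball 0 1" using e1 by simp
      have inM: "?lam (circle_point t) \<notin> C"
      proof -
        have "circle_point t \<in> topspace (nsphere 1)" unfolding topspace_nsphere1 by (simp add: circle_point_def)
        then have "?lam (circle_point t) \<in> topspace ?M" using elim(2) continuous_map_funspace by blast
        then show ?thesis by simp
      qed
      then have "f (?lam (circle_point t)) = proj_point (poly_vec P Q (p + of_real r * e t))"
        using line_repD(2)[OF rep] by (simp only: circle_coord_circle_point e_def)
      then have "?F (circle_point t) = poly (lin_form_poly j P Q) (p + of_real r * e t) / poly (lin_form_poly k P Q) (p + of_real r * e t)"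
        using poly_vec_nonzero[OF PQ] by (simp add: lin_form_ratio_proj_point poly_lin_form_poly)
      also have "\<dots> = (e t ^ nj * exp (gj (e t))) / (e t ^ nk * exp (gk (e t)))"
        by (simp add: gj(2)[OF ecb] gk(2)[OF ecb] nj_def nk_def)
      also have "\<dots> = exp (G t)"
        by (simp add: G_def exp_add exp_diff e_def exp_of_nat_mult)
      finally show "?F (circle_point t) = exp (G t)" .
    qed
    \<comment> \<open>\<open>e 1 = e 0\<close>, so the zero-free parts cancel and only the linear
      terms count.\<close>
    also have "G 1 - G 0 = (of_nat nj - of_nat nk) * (2 * of_real pi * \<i>)"
      by (simp add: G_def e_def exp_eq_1 algebra_simps)
    also have "\<dots> / (2 * of_real pi * \<i>) = of_nat nj - of_nat nk" by simp
    also have "loop_hom punctured_plane ?F = hom_induced 1 ?S {} punctured_plane {} (lin_form_ratio j k)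
        (hom_induced 1 ?M {} ?S {} f (loop_hom ?M ?lam))"
      unfolding hom_induced_compose_empty[OF cfl cu] hom_induced_compose_empty[OF elim(2) cf] by (simp only: o_apply)
    finally show ?case by (simp only: nj_def nk_def)
  qed
qed

text \<open>The circle avoids \<open>C\<close> even if its centre does not, and off \<open>C\<close>
  the map given by \<open>P\<close> and \<open>Q\<close> agrees with \<open>f\<close>.\<close>

lemma hom_induced_line_loop:
  assumes rep: "line_rep C f a z P Q" and f: "continuous_on (- C) f" "f ` (- C) \<subseteq> - B"
    and lam: "continuous_map (nsphere 1) (top_of_set (- C)) (\<lambda>x. proj_point (a + (p + of_real r * circle_coord x) *s z))"
      (is "continuous_map _ _ ?lam")
  shows "hom_induced 1 (top_of_set (- C)) {} (top_of_set (- B)) {} f (loop_hom (top_of_set (- C)) ?lam)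
    = loop_hom (top_of_set (- B)) (small_loop P Q p r)"
proof -
  have cf: "continuous_map (top_of_set (- C)) (top_of_set (- B)) f" using f by auto
  have "loop_hom (top_of_set (- B)) (small_loop P Q p r) = loop_hom (top_of_set (- B)) (f \<circ> ?lam)"
  proof (rule loop_hom_cong)
    fix x assume "x \<in> topspace (nsphere 1)"
    then have "?lam x \<in> topspace (top_of_set (- C))" using lam continuous_map_funspace by blast
    then have "?lam x \<notin> C" by (metis ComplD topspace_euclidean_subtopology)
    from line_repD(2)[OF rep this] show "small_loop P Q p r x = (f \<circ> ?lam) x"
      by (simp only: small_loop_def o_apply)
  qed
  then show ?thesis unfolding hom_induced_compose_empty[OF lam cf] by (simp only: o_apply)
qed

text \<open>\<open>\<rho>\<close> and the classes \<open>\<delta> b\<close> are fixed before any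
  line is chosen, so one function \<open>\<kappa>\<close> serves all lines. The value of
  \<open>\<rho>\<close> on a small loop is computed twice: through \<open>f'\<close> it is
  \<open>exp (s * n)\<close>, and through \<open>f\<close> it is a power of
  \<open>\<rho> (\<delta> b)\<close>, or 1 if the centre lies over no point of
  \<open>B\<close>.\<close>

lemma divisor_relation:
  fixes B B' :: "2 cproj set"
  assumes g: "homogeneous_poly d0 g" "\<And>v. v \<noteq> 0 \<Longrightarrow> proj_point v \<in> C \<longleftrightarrow> g v = 0"
    and f: "continuous_on (- C) f" "f ` (- C) \<subseteq> - B" and f': "continuous_on (- C) f'" "f' ` (- C) \<subseteq> - B'"
    and B: "finite B" and B': "finite B'" "j \<in> B'" "k \<in> B'"
    and W: "corresponding_component (top_of_set (- C)) E
        (pullback_char (top_of_set (- C)) (top_of_set (- B)) f ` char_torus (top_of_set (- B)))"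
      "corresponding_component (top_of_set (- C)) E
        (pullback_char (top_of_set (- C)) (top_of_set (- B')) f' ` char_torus (top_of_set (- B')))"
  obtains \<kappa> :: "2 cproj \<Rightarrow> real" where
    "\<And>a z P Q P' Q' p. \<lbrakk>z \<noteq> 0; proj_point z \<notin> C; \<forall>t. a + t *s z \<noteq> 0;
        line_rep C f a z P Q; line_rep C f' a z P' Q'; \<forall>b\<in>B. lin_form_poly b P Q \<noteq> 0; \<forall>b\<in>B'. lin_form_poly b P' Q' \<noteq> 0\<rbrakk>
      \<Longrightarrow> real (order p (lin_form_poly j P' Q')) - real (order p (lin_form_poly k P' Q'))
        = (\<Sum>b\<in>B. \<kappa> b * real (order p (lin_form_poly b P Q)))"
proof -
  let ?M = "top_of_set (- C)" and ?S = "top_of_set (- B)" and ?S' = "top_of_set (- B')"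
  let ?u = "lin_form_ratio j k"
  obtain \<epsilon> where \<epsilon>: "\<epsilon> > 0" "\<And>s. \<bar>s\<bar> < \<epsilon> \<Longrightarrow> \<exists>\<rho>\<in>char_torus ?S. \<forall>h\<in>carrier (homology_group 1 ?M).
     \<rho> (hom_induced 1 ?M {} ?S {} f h)
       = exp (of_real s * winding_class (hom_induced 1 ?S' {} punctured_plane {} ?u (hom_induced 1 ?M {} ?S' {} f' h)))"
    by (rule common_small_characters[OF W, of ?u]) (rule that)
  define s where "s = \<epsilon> / 2"
  have s: "s > 0" "\<bar>s\<bar> < \<epsilon>" using \<epsilon>(1) by (auto simp: s_def)
  obtain \<rho> where \<rho>: "\<rho> \<in> char_torus ?S" "\<And>h. h \<in> carrier (homology_group 1 ?M) \<Longrightarrow>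
     \<rho> (hom_induced 1 ?M {} ?S {} f h)
       = exp (of_real s * winding_class (hom_induced 1 ?S' {} punctured_plane {} ?u (hom_induced 1 ?M {} ?S' {} f' h)))"
    using \<epsilon>(2)[OF s(2)] by blast
  have "\<exists>\<delta>. \<delta> \<in> carrier (homology_group 1 ?S) \<and>
    (\<forall>P Q p. coprime P Q \<longrightarrow> lin_form_poly b P Q \<noteq> 0 \<longrightarrow> poly (lin_form_poly b P Q) p = 0 \<longrightarrow>
      (\<forall>\<^sub>F r in at_right 0. loop_hom ?S (small_loop P Q p r)
        = \<delta> [^]\<^bsub>homology_group 1 ?S\<^esub> (int (order p (lin_form_poly b P Q)))))" if "b \<in> B" for b
    by (rule small_loop_around[OF B that]) blast
  then obtain \<delta> where \<delta>: "\<And>b. b \<in> B \<Longrightarrow> \<delta> b \<in> carrier (homology_group 1 ?S)"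
    "\<And>b P Q p. b \<in> B \<Longrightarrow> coprime P Q \<Longrightarrow> lin_form_poly b P Q \<noteq> 0 \<Longrightarrow> poly (lin_form_poly b P Q) p = 0 \<Longrightarrow>
      (\<forall>\<^sub>F r in at_right 0. loop_hom ?S (small_loop P Q p r)
        = \<delta> b [^]\<^bsub>homology_group 1 ?S\<^esub> (int (order p (lin_form_poly b P Q))))"
    by metis
  define \<kappa> where "\<kappa> b = ln (norm (\<rho> (\<delta> b))) / s" for b
  show ?thesis
  proof (rule that[of \<kappa>])
    fix a z P Q P' Q' p
    assume z12: "z \<noteq> 0" "proj_point z \<notin> C" and z3: "\<forall>t. a + t *s z \<noteq> 0"
      and rep: "line_rep C f a z P Q" and rep': "line_rep C f' a z P' Q'"
      and "\<forall>b\<in>B. lin_form_poly b P Q \<noteq> 0" "\<forall>b\<in>B'. lin_form_poly b P' Q' \<noteq> 0"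
    then have lnz: "\<And>b. b \<in> B \<Longrightarrow> lin_form_poly b P Q \<noteq> 0" and lnz': "\<And>b. b \<in> B' \<Longrightarrow> lin_form_poly b P' Q' \<noteq> 0" by auto
    note z = z12 z3[rule_format]
    have PQ: "coprime P Q" using rep by (simp add: line_rep_def)
    have fin: "finite {t. proj_point (a + t *s z) \<in> C}" by (rule finite_line_curve[OF g z])
    let ?lam = "\<lambda>r x. proj_point (a + (p + of_real r * circle_coord x) *s z)"
    define n where "n = real (order p (lin_form_poly j P' Q')) - real (order p (lin_form_poly k P' Q'))"
    have ev: "\<forall>\<^sub>F r in at_right 0. \<rho> (loop_hom ?S (small_loop P Q p r)) = exp (of_real (s * n))"
      using line_loop[OF fin z(3), where p=p]
        winding_class_small_loop[OF rep' f' B'(1,2,3) lnz'[OF B'(2)] lnz'[OF B'(3)] fin z(3), where p=p]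
    proof eventually_elim
      case (elim r)
      have "\<rho> (loop_hom ?S (small_loop P Q p r)) = \<rho> (hom_induced 1 ?M {} ?S {} f (loop_hom ?M (?lam r)))"
        using hom_induced_line_loop[OF rep f elim(1)] by simp
      also have "\<dots> = exp (of_real s * (of_nat (order p (lin_form_poly j P' Q')) - of_nat (order p (lin_form_poly k P' Q'))))"
        by (subst \<rho>(2)[OF hom_induced_carrier]) (simp only: elim(2))
      finally show ?case by (simp add: n_def)
    qed
    show "real (order p (lin_form_poly j P' Q')) - real (order p (lin_form_poly k P' Q')) = (\<Sum>b\<in>B. \<kappa> b * real (order p (lin_form_poly b P Q)))"
    proof (cases "proj_point (poly_vec P Q p) \<in> B")
      case False
      then have "order p (lin_form_poly b P Q) = 0" if "b \<in> B" for b
        using that poly_lin_form_poly_eq_0_iff[OF PQ, of b p] by (intro order_0I) auto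
      then have rhs: "(\<Sum>b\<in>B. \<kappa> b * real (order p (lin_form_poly b P Q))) = 0" by simp
      \<comment> \<open>Both evaluations hold for all small radii; a single common radius is enough,
        as neither value depends on it.\<close>
      from eventually_happens'[OF _ eventually_conj[OF ev small_loop_trivial[OF PQ B False]]]
      have "exp (complex_of_real (s * n)) = \<rho> \<one>\<^bsub>homology_group 1 ?S\<^esub>" by force
      also have "\<dots> = 1" by (rule char_torus_one[OF \<rho>(1)])
      finally have "exp (complex_of_real (s * n)) = 1" .
      then have "norm (exp (complex_of_real (s * n))) = 1" by simp
      then have "s * n = 0" by simp
      then show ?thesis using s(1) rhs by (simp add: n_def)
    next
      case True
      define b where "b = proj_point (poly_vec P Q p)"
      have b: "b \<in> B" "poly (lin_form_poly b P Q) p = 0" using True poly_lin_form_poly_eq_0_iff[OF PQ] by (auto simp: b_def)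
      have ord0: "order p (lin_form_poly b' P Q) = 0" if "b' \<noteq> b" for b'
        using that poly_lin_form_poly_eq_0_iff[OF PQ, of b' p] by (intro order_0I) (auto simp: b_def)
      have rhs: "(\<Sum>b\<in>B. \<kappa> b * real (order p (lin_form_poly b P Q))) = \<kappa> b * real (order p (lin_form_poly b P Q))"
        using sum.remove[OF B b(1), of "\<lambda>b. \<kappa> b * real (order p (lin_form_poly b P Q))"] ord0 by simp
      let ?k = "order p (lin_form_poly b P Q)"
      from eventually_happens'[OF _ eventually_conj[OF ev \<delta>(2)[OF b(1) PQ lnz[OF b(1)] b(2)]]]
      have "exp (complex_of_real (s * n)) = \<rho> (\<delta> b [^]\<^bsub>homology_group 1 ?S\<^esub> (int ?k))" by force
      also have "\<dots> = \<rho> (\<delta> b) ^ ?k" by (rule char_torus_int_pow[OF \<rho>(1) \<delta>(1)[OF b(1)]])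
      \<comment> \<open>Absolute values discard the unknown argument of
        \<open>\<rho> (\<delta> b)\<close>, while \<open>n\<close> can still be recovered because
        \<open>s * n\<close> is real.\<close>
      finally have "norm (exp (complex_of_real (s * n))) = norm (\<rho> (\<delta> b)) ^ ?k" by (simp add: norm_power)
      then have eq: "exp (s * n) = norm (\<rho> (\<delta> b)) ^ ?k" by simp
      have k0: "?k \<noteq> 0" using b(2) lnz[OF b(1)] order_root by blast
      have "norm (\<rho> (\<delta> b)) ^ ?k \<noteq> 0" unfolding eq[symmetric] by simp
      then have "norm (\<rho> (\<delta> b)) > 0" using k0 by simp
      with ln_realpow[of "norm (\<rho> (\<delta> b))" ?k] have "s * n = real ?k * ln (norm (\<rho> (\<delta> b)))"
        unfolding eq[symmetric] by simp
      then have "n = ln (norm (\<rho> (\<delta> b))) / s * real ?k" using s(1) by (simp add: field_simps)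
      then show ?thesis unfolding rhs unfolding \<kappa>_def n_def .
    qed
  qed
qed

subsection \<open>Fibers\<close>

lemma order_prod_power:
  fixes q :: "'i \<Rightarrow> complex poly"
  assumes "finite I" "\<And>i. i \<in> I \<Longrightarrow> q i \<noteq> 0"
  shows "order p (\<Prod>i\<in>I. q i ^ n i) = (\<Sum>i\<in>I. n i * order p (q i))"
proof -
  have pow: "order p (r ^ m) = m * order p r" if "r \<noteq> 0" for r :: "complex poly" and m
    using that by (induction m) (auto simp: order_mult)
  show ?thesis
    using assms
  proof (induction I rule: finite_induct)
    case (insert i I)
    then have "q i ^ n i * (\<Prod>i\<in>I. q i ^ n i) \<noteq> 0" by auto
    from order_mult[OF this, of p] show ?case using insert pow by simp
  qed simp
qed

text \<open>A complex polynomial is its leading coefficient times the product over its roots, and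
  the same product \<open>R\<close> serves both sides.\<close>

lemma complex_poly_eq_smult:
  fixes A B :: "complex poly"
  assumes "A \<noteq> 0" "B \<noteq> 0" "\<And>p. order p A = order p B"
  obtains c where "c \<noteq> 0" "A = smult c B"
proof -
  define R where "R = (\<Prod>z|poly B z = 0. [:-z, 1:] ^ order z B)"
  have "poly A z = 0 \<longleftrightarrow> poly B z = 0" for z using assms order_root by metis
  then have A: "smult (lead_coeff A) R = A"
    using complex_poly_decompose[of A] assms(3) by (simp add: R_def)
  have B: "smult (lead_coeff B) R = B" using complex_poly_decompose[of B] by (simp add: R_def)
  have "A = smult (lead_coeff A / lead_coeff B) B"
    using assms(1,2) by (subst B[symmetric], subst A[symmetric]) simp
  then show ?thesis using assms(1,2) by (intro that[of "lead_coeff A / lead_coeff B"]) auto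
qed

lemma common_denominator:
  fixes \<kappa> :: "'i \<Rightarrow> real"
  assumes "finite I" "\<And>i. i \<in> I \<Longrightarrow> \<kappa> i \<in> \<rat>"
  obtains N :: nat and e :: "'i \<Rightarrow> int" where "N > 0" "\<And>i. i \<in> I \<Longrightarrow> real N * \<kappa> i = of_int (e i)"
proof -
  have "\<exists>N::nat. N > 0 \<and> (\<forall>i\<in>I. real N * \<kappa> i \<in> \<int>)"
    using assms
  proof (induction I rule: finite_induct)
    case empty show ?case by (intro exI[of _ 1]) simp
  next
    case (insert x F)
    then obtain N where N: "N > 0" "\<forall>i\<in>F. real N * \<kappa> i \<in> \<int>" by auto
    have "\<kappa> x \<in> \<rat>" using insert by auto
    then obtain a b :: int where ab: "b > 0" "\<kappa> x = of_int a / of_int b" by (metis Rats_cases')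
    have b: "real (nat b) = of_int b" using ab(1) by simp
    show ?case
    proof (intro exI[of _ "N * nat b"] conjI ballI)
      show "0 < N * nat b" using N(1) ab(1) by simp
      fix i assume i: "i \<in> insert x F"
      show "real (N * nat b) * \<kappa> i \<in> \<int>"
      proof (cases "i \<in> F")
        case True
        have "real (N * nat b) * \<kappa> i = of_int b * (real N * \<kappa> i)" by (simp add: b)
        also have "\<dots> \<in> \<int>" by (rule Ints_mult[OF Ints_of_int N(2)[rule_format, OF True]])
        finally show ?thesis .
      next
        case False
        then have "real (N * nat b) * \<kappa> i = real N * of_int a" using i ab by (simp add: b)
        also have "\<dots> \<in> \<int>" by (intro Ints_mult) auto
        finally show ?thesis .
      qed
    qed
  qed
  then obtain N :: nat where N: "N > 0" "\<forall>i\<in>I. \<exists>e. real N * \<kappa> i = of_int e" by (metis Ints_cases)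
  from bchoice[OF N(2)] obtain e where "\<forall>i\<in>I. real N * \<kappa> i = of_int (e i)" by blast
  then show ?thesis using N(1) that by blast
qed

text \<open>Clearing denominators in \<open>\<kappa>\<close> gives polynomials with equal orders everywhere, hence proportional ones.
  Comparing degrees shows that the exponents of the forms sum to zero unless the map is constant on
  the line, so the common scalar relating the values at \<open>t0\<close> and \<open>t1\<close> drops out.\<close>

lemma ratio_power_eq_on_line:
  assumes B: "finite B" and PQ: "coprime P Q"
    and nz: "\<And>b. b \<in> B \<Longrightarrow> lin_form_poly b P Q \<noteq> 0" "\<And>b. b \<in> B \<Longrightarrow> degree (lin_form_poly b P Q) = D"
    and nz': "J \<noteq> 0" "K \<noteq> 0" "degree J = degree K"
    and rel: "\<And>p. real (order p J) - real (order p K) = (\<Sum>b\<in>B. \<kappa> b * real (order p (lin_form_poly b P Q)))"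
    and t: "proj_point (poly_vec P Q t0) = proj_point (poly_vec P Q t1)" "proj_point (poly_vec P Q t0) \<notin> B"
      "poly K t0 \<noteq> 0" "poly K t1 \<noteq> 0"
  obtains N :: nat where "N > 0" "(poly J t0 / poly K t0) ^ N = (poly J t1 / poly K t1) ^ N"
proof -
  let ?l = "\<lambda>b. lin_form_poly b P Q"
  \<comment> \<open>If the form of \<open>b\<close> has no root on the line, the relation says
    nothing about \<open>\<kappa> b\<close>, which might be irrational. Replacing it by 0 in that
    case changes no term of the sum.\<close>
  define \<kappa>' where "\<kappa>' b = (if \<exists>q. poly (?l b) q = 0 then \<kappa> b else 0)" for b
  have rel': "real (order p J) - real (order p K) = (\<Sum>b\<in>B. \<kappa>' b * real (order p (?l b)))" for p
    unfolding rel
  proof (rule sum.cong[OF refl])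
    fix b assume "b \<in> B"
    then show "\<kappa> b * real (order p (?l b)) = \<kappa>' b * real (order p (?l b))"
      using order_root[of "?l b" p] nz(1) by (auto simp: \<kappa>'_def)
  qed
  \<comment> \<open>At a root of the form of \<open>b\<close> no other form vanishes, so the
    relation has one term and can be solved for the coefficient.\<close>
  have rat: "\<kappa>' b \<in> \<rat>" if b: "b \<in> B" for b
  proof (cases "\<exists>q. poly (?l b) q = 0")
    case True
    then obtain q where q: "poly (?l b) q = 0" by blast
    have "order q (?l b') = 0" if "b' \<noteq> b" for b'
      using that q poly_lin_form_poly_eq_0_iff[OF PQ] by (intro order_0I) auto
    then have "(\<Sum>b\<in>B. \<kappa>' b * real (order q (?l b))) = \<kappa>' b * real (order q (?l b))"
      using sum.remove[OF B b, of "\<lambda>b. \<kappa>' b * real (order q (?l b))"] by simp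
    moreover have "order q (?l b) \<noteq> 0" using q nz(1)[OF b] order_root by blast
    ultimately have "\<kappa>' b = (real (order q J) - real (order q K)) / real (order q (?l b))"
      using rel'[of q] by simp
    then show ?thesis by simp
  qed (simp add: \<kappa>'_def)
  obtain N e where N: "N > 0" "\<And>b. b \<in> B \<Longrightarrow> real N * \<kappa>' b = of_int (e b)"
    by (rule common_denominator[OF B rat]) (assumption, rule that)
  \<comment> \<open>Negative and positive parts of the exponents, placed on opposite sides so that
    both sides are polynomials.\<close>
  define m l where "m b = nat (- e b)" and "l b = nat (e b)" for b
  have ml: "real (l b) - real (m b) = of_int (e b)" for b by (simp add: m_def l_def)
  define A1 where "A1 = J ^ N * (\<Prod>b\<in>B. ?l b ^ m b)"
  define A2 where "A2 = K ^ N * (\<Prod>b\<in>B. ?l b ^ l b)"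
  have prodnz: "(\<Prod>b\<in>B. ?l b ^ n b) \<noteq> 0" for n :: "2 cproj \<Rightarrow> nat" using B nz(1) by auto
  have A0: "A1 \<noteq> 0" "A2 \<noteq> 0" using nz' prodnz by (auto simp: A1_def A2_def)
  have ordA: "order p A1 = N * order p J + (\<Sum>b\<in>B. m b * order p (?l b))"
    "order p A2 = N * order p K + (\<Sum>b\<in>B. l b * order p (?l b))" for p
    using A0 order_prod_power[OF B nz(1)] order_prod_power[of "{()}" "\<lambda>_. J" p "\<lambda>_. N"]
      order_prod_power[of "{()}" "\<lambda>_. K" p "\<lambda>_. N"] nz'
    by (auto simp: A1_def A2_def order_mult)
  have "order p A1 = order p A2" for p
  proof -
    have "real N * (real (order p J) - real (order p K)) = (\<Sum>b\<in>B. of_int (e b) * real (order p (?l b)))"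
      unfolding rel' sum_distrib_left
    proof (rule sum.cong[OF refl])
      fix b assume "b \<in> B"
      from N(2)[OF this] show "real N * (\<kappa>' b * real (order p (?l b))) = of_int (e b) * real (order p (?l b))"
        by (metis mult.assoc)
    qed
    also have "\<dots> = (\<Sum>b\<in>B. real (l b) * real (order p (?l b))) - (\<Sum>b\<in>B. real (m b) * real (order p (?l b)))"
      by (simp flip: ml sum_subtractf add: left_diff_distrib)
    finally have "real (order p A1) = real (order p A2)" by (simp add: ordA algebra_simps)
    then show ?thesis by simp
  qed
  then obtain c where c: "c \<noteq> 0" "A1 = smult c A2" using complex_poly_eq_smult[OF A0] by blast
  have degp: "degree (\<Prod>b\<in>B. ?l b ^ n b) = (\<Sum>b\<in>B. n b) * D" for n :: "2 cproj \<Rightarrow> nat"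
    using nz by (simp add: degree_prod_sum_eq degree_power_eq sum_distrib_right)
  have "degree A1 = N * degree J + (\<Sum>b\<in>B. m b) * D" "degree A2 = N * degree K + (\<Sum>b\<in>B. l b) * D"
    using nz' prodnz by (simp_all add: A1_def A2_def degree_mult_eq degree_power_eq degp)
  moreover have "degree A1 = degree A2" using c by simp
  ultimately have sums: "(\<Sum>b\<in>B. m b) = (\<Sum>b\<in>B. l b) \<or> D = 0" using nz'(3) by auto
  obtain a where a: "poly_vec P Q t1 = a *s poly_vec P Q t0"
    using t(1) proj_point_eq_iff[OF poly_vec_nonzero poly_vec_nonzero] PQ by blast
  have la: "poly (?l b) t1 = a * poly (?l b) t0" for b by (simp add: poly_lin_form_poly a lin_form_scale)
  have l0: "poly (?l b) t0 \<noteq> 0" if "b \<in> B" for b using that t(2) poly_lin_form_poly_eq_0_iff[OF PQ] by auto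
  \<comment> \<open>For \<open>D = 0\<close> the degrees give no information on the exponents, but
    then the forms are nonzero constants on the line and the scalar is 1.\<close>
  have a1: "a = 1" if D0: "D = 0" and Bne: "B \<noteq> {}"
  proof -
    obtain b where b: "b \<in> B" using Bne by blast
    then obtain k where "?l b = [:k:]" using nz(2)[OF b] D0 degree_eq_zeroE by metis
    then show ?thesis using la[of b] l0[OF b] by simp
  qed
  have pows: "a ^ (\<Sum>b\<in>B. m b) = a ^ (\<Sum>b\<in>B. l b)"
    using sums a1 by (cases "B = {}") auto
  have a0: "a \<noteq> 0" using a poly_vec_nonzero[OF PQ, of t1] by auto
  have pr: "poly (\<Prod>b\<in>B. ?l b ^ n b) t1 = a ^ (\<Sum>b\<in>B. n b) * poly (\<Prod>b\<in>B. ?l b ^ n b) t0" for n :: "2 cproj \<Rightarrow> nat"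
    by (simp add: poly_prod la power_mult_distrib prod.distrib power_sum)
  have pn: "poly (\<Prod>b\<in>B. ?l b ^ n b) t0 \<noteq> 0" for n :: "2 cproj \<Rightarrow> nat" using B l0 by (simp add: poly_prod)
  define u v where "u = poly (\<Prod>b\<in>B. ?l b ^ m b) t0" and "v = poly (\<Prod>b\<in>B. ?l b ^ l b) t0"
  have uv: "u \<noteq> 0" "v \<noteq> 0" using pn by (auto simp: u_def v_def)
  have e0: "poly J t0 ^ N * u = c * (poly K t0 ^ N * v)"
    using arg_cong[OF c(2), of "\<lambda>q. poly q t0"] by (simp only: A1_def A2_def poly_mult poly_power poly_smult u_def v_def)
  have "poly J t1 ^ N * (a ^ (\<Sum>b\<in>B. m b) * u) = c * (poly K t1 ^ N * (a ^ (\<Sum>b\<in>B. l b) * v))"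
    using arg_cong[OF c(2), of "\<lambda>q. poly q t1"]
    by (simp only: A1_def A2_def poly_mult poly_power poly_smult u_def v_def pr)
  then have e1: "poly J t1 ^ N * u = c * (poly K t1 ^ N * v)" using a0 unfolding pows by simp
  have "(poly J t0 / poly K t0) ^ N = c * v / u" "(poly J t1 / poly K t1) ^ N = c * v / u"
    using e0 e1 uv t(3,4) by (simp_all add: power_divide field_simps)
  then show ?thesis using that N(1) by metis
qed

text \<open>The exponent \<open>N\<close> depends on the line through \<open>w\<close> and
  \<open>x\<close>, so no single equation holds on the fiber. The values still lie in the union over
  all \<open>N\<close> of finite root sets, whereas a connected set of complex numbers with two
  elements is uncountable.\<close>

lemma constant_on_fiber:
  fixes B B' :: "2 cproj set"
  assumes C: "plane_curve C"
    and f: "regular_map (- C) (- B) f" and f': "regular_map (- C) (- B') f'"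
    and B: "finite B" and B': "finite B'" "j \<in> B'" "k \<in> B'" "j \<noteq> k"
    and W: "corresponding_component (top_of_set (- C)) E
        (pullback_char (top_of_set (- C)) (top_of_set (- B)) f ` char_torus (top_of_set (- B)))"
      "corresponding_component (top_of_set (- C)) E
        (pullback_char (top_of_set (- C)) (top_of_set (- B')) f' ` char_torus (top_of_set (- B')))"
    and conn: "connected {x \<in> - C. f x = y}"
    and x: "x \<in> - C" "x' \<in> - C" "f x = y" "f x' = y"
  shows "f' x = f' x'"
proof -
  obtain d0 g where g: "homogeneous_poly d0 g" "\<And>v. v \<noteq> 0 \<Longrightarrow> proj_point v \<in> C \<longleftrightarrow> g v = 0" and oC: "open (- C)"
    using plane_curveE[OF C] by blast
  have cf: "continuous_on (- C) f" "f ` (- C) \<subseteq> - B" and cf': "continuous_on (- C) f'" "f' ` (- C) \<subseteq> - B'"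
    using continuous_on_regular_map[OF f oC] continuous_on_regular_map[OF f' oC] f f' by (auto simp: regular_map_def)
  obtain \<kappa> :: "2 cproj \<Rightarrow> real" where \<kappa>:
    "\<And>a z P Q P' Q' p. \<lbrakk>z \<noteq> 0; proj_point z \<notin> C; \<forall>t. a + t *s z \<noteq> 0;
        line_rep C f a z P Q; line_rep C f' a z P' Q'; \<forall>b\<in>B. lin_form_poly b P Q \<noteq> 0; \<forall>b\<in>B'. lin_form_poly b P' Q' \<noteq> 0\<rbrakk>
      \<Longrightarrow> real (order p (lin_form_poly j P' Q')) - real (order p (lin_form_poly k P' Q'))
        = (\<Sum>b\<in>B. \<kappa> b * real (order p (lin_form_poly b P Q)))"
    by (rule divisor_relation[OF g cf cf' B B'(1-3) W]) (assumption, rule that)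
  let ?u = "\<lambda>x. lin_form_ratio j k (f' x)"
  have pow: "\<exists>N::nat. N > 0 \<and> ?u w ^ N = ?u x ^ N" if w: "w \<in> - C" "f w = y" for w
  proof (cases "w = x")
    case True then show ?thesis by (intro exI[of _ 1]) simp
  next
    case False
    have wx: "w \<notin> C" "x \<notin> C" using w(1) x(1) by auto
    obtain a z t0 t1 where L: "z \<noteq> 0" "proj_point z \<notin> C" "\<And>t. a + t *s z \<noteq> 0"
      "w = proj_point (a + t0 *s z)" "x = proj_point (a + t1 *s z)"
      by (rule two_points_line[OF g wx False]) (assumption, rule that)
    obtain P Q D where PQ: "line_rep C f a z P Q" "\<And>b. b \<in> B \<Longrightarrow> lin_form_poly b P Q \<noteq> 0 \<and> degree (lin_form_poly b P Q) = D"
      by (rule regular_map_on_line[OF g L(1-3) f]) (assumption, rule that)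
    obtain P' Q' D' where PQ': "line_rep C f' a z P' Q'" "\<And>b. b \<in> B' \<Longrightarrow> lin_form_poly b P' Q' \<noteq> 0 \<and> degree (lin_form_poly b P' Q') = D'"
      by (rule regular_map_on_line[OF g L(1-3) f']) (assumption, rule that)
    have cop: "coprime P Q" "coprime P' Q'" using PQ PQ' line_repD by blast+
    have val: "f w = proj_point (poly_vec P Q t0)" "f x = proj_point (poly_vec P Q t1)"
      "f' w = proj_point (poly_vec P' Q' t0)" "f' x = proj_point (poly_vec P' Q' t1)"
      using line_repD(2)[OF PQ(1)] line_repD(2)[OF PQ'(1)] L(4,5) wx by auto
    have notB: "f w \<notin> B" "f' w \<notin> B'" "f' x \<notin> B'" using cf(2) cf'(2) wx by auto
    have u: "?u w = poly (lin_form_poly j P' Q') t0 / poly (lin_form_poly k P' Q') t0" "?u x = poly (lin_form_poly j P' Q') t1 / poly (lin_form_poly k P' Q') t1"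
      unfolding val by (simp_all add: lin_form_ratio_proj_point poly_vec_nonzero[OF cop(2)] poly_lin_form_poly)
    have kn: "poly (lin_form_poly k P' Q') t0 \<noteq> 0" "poly (lin_form_poly k P' Q') t1 \<noteq> 0"
      using notB(2,3) B'(3) poly_lin_form_poly_eq_0_iff[OF cop(2)] val by auto
    have rel: "real (order p (lin_form_poly j P' Q')) - real (order p (lin_form_poly k P' Q')) = (\<Sum>b\<in>B. \<kappa> b * real (order p (lin_form_poly b P Q)))" for p
      by (rule \<kappa>[OF L(1,2) _ PQ(1) PQ'(1)]) (use L(3) PQ(2) PQ'(2) in auto)
    obtain N :: nat where "N > 0" "(poly (lin_form_poly j P' Q') t0 / poly (lin_form_poly k P' Q') t0) ^ N = (poly (lin_form_poly j P' Q') t1 / poly (lin_form_poly k P' Q') t1) ^ N"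
    proof (rule ratio_power_eq_on_line[OF B cop(1), where D=D and J="lin_form_poly j P' Q'" and K="lin_form_poly k P' Q'" and \<kappa>=\<kappa>])
      show "lin_form_poly b P Q \<noteq> 0" "degree (lin_form_poly b P Q) = D" if "b \<in> B" for b using PQ(2)[OF that] by auto
      show "lin_form_poly j P' Q' \<noteq> 0" "lin_form_poly k P' Q' \<noteq> 0" "degree (lin_form_poly j P' Q') = degree (lin_form_poly k P' Q')"
        using PQ'(2) B' by auto
      show "real (order p (lin_form_poly j P' Q')) - real (order p (lin_form_poly k P' Q')) = (\<Sum>b\<in>B. \<kappa> b * real (order p (lin_form_poly b P Q)))" for p
        by (rule rel)
      show "proj_point (poly_vec P Q t0) = proj_point (poly_vec P Q t1)" using val w(2) x(3) by simp
      show "proj_point (poly_vec P Q t0) \<notin> B" using val notB by simp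
      show "poly (lin_form_poly k P' Q') t0 \<noteq> 0" "poly (lin_form_poly k P' Q') t1 \<noteq> 0" by (rule kn)+
    qed
    then show ?thesis unfolding u by blast
  qed
  let ?F = "{x \<in> - C. f x = y}"
  have "continuous_on ?F (\<lambda>x. ?u x)"
    by (rule continuous_on_compose2[OF continuous_on_lin_form_ratio[OF B'(1,3)] continuous_on_subset[OF cf'(1)]])
       (use cf'(2) in auto)
  then have "connected (?u ` ?F)" using conn by (rule connected_continuous_image)
  moreover have "countable (?u ` ?F)"
  proof (rule countable_subset)
    show "?u ` ?F \<subseteq> (\<Union>N\<in>{0<..}. {w. w ^ N = ?u x ^ N})" using pow by fastforce
    show "countable (\<Union>N\<in>{0<..}. {w. w ^ N = ?u x ^ N})"
      by (rule countable_UN[OF countableI_type]) (auto intro: countable_finite)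
  qed
  ultimately have "?u x = ?u x'"
    using connected_uncountable[of "?u ` ?F" "?u x" "?u x'"] x by blast
  then show ?thesis
    by (rule lin_form_ratio_inj[OF B'(4), rotated 2]) (use cf'(2) x B'(3) in auto)
qed

subsection \<open>Maps with the same fibers\<close>

lemma finite_poly_vec_preimage:
  assumes PQ: "coprime P Q" and t0: "proj_point (poly_vec P Q t0) \<noteq> y"
  shows "finite {t. proj_point (poly_vec P Q t) = y}"
proof -
  have "poly (lin_form_poly y P Q) t0 \<noteq> 0" using t0 by (simp add: poly_lin_form_poly_eq_0_iff[OF PQ])
  then have "lin_form_poly y P Q \<noteq> 0" by auto
  from poly_roots_finite[OF this] show ?thesis by (simp add: poly_lin_form_poly_eq_0_iff[OF PQ])
qed

lemma finite_poly_vec_preimage_set: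
  assumes "coprime P Q" "proj_point (poly_vec P Q t0) \<noteq> proj_point (poly_vec P Q t1)" "finite Y"
  shows "finite {t. proj_point (poly_vec P Q t) \<in> Y}"
proof -
  have "{t. proj_point (poly_vec P Q t) \<in> Y} = (\<Union>y\<in>Y. {t. proj_point (poly_vec P Q t) = y})" by auto
  then show ?thesis using assms finite_poly_vec_preimage[OF assms(1)] by (metis (no_types, lifting) finite_UN_I)
qed

text \<open>The determinant of the vectors at \<open>t\<close> and at \<open>s\<close>, as a
  polynomial in \<open>t\<close>. For a coprime pair its roots are the fiber through
  \<open>s\<close> on the affine line.\<close>

definition secant :: "complex poly \<Rightarrow> complex poly \<Rightarrow> complex \<Rightarrow> complex poly" where
  "secant P Q s = smult (poly Q s) P - smult (poly P s) Q"

text \<open>For a coprime nonconstant pair its zeros are the ramification points on the affine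
  line.\<close>

definition wronskian :: "complex poly \<Rightarrow> complex poly \<Rightarrow> complex poly" where
  "wronskian P Q = P * pderiv Q - Q * pderiv P"

lemma poly_secant: "poly (secant P Q s) t = poly Q s * poly P t - poly P s * poly Q t"
  by (simp add: secant_def)

lemma poly_secant_eq_0_iff:
  assumes "coprime P Q"
  shows "poly (secant P Q s) t = 0 \<longleftrightarrow> proj_point (poly_vec P Q t) = proj_point (poly_vec P Q s)"
  using proj_point_eq_det[OF poly_vec_nonzero[OF assms] poly_vec_nonzero[OF assms], of s t]
  by (auto simp: poly_secant)

text \<open>Coprimality turns \<open>P * pderiv Q = Q * pderiv P\<close> into
  \<open>P dvd pderiv P\<close>, which by degree forces \<open>pderiv P = 0\<close>. The same holds
  for \<open>Q\<close>, so the map would be constant.\<close>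

lemma wronskian_nonzero:
  assumes PQ: "coprime P Q" and nonconst: "proj_point (poly_vec P Q t0) \<noteq> proj_point (poly_vec P Q t1)"
  shows "wronskian P Q \<noteq> 0"
proof
  assume "wronskian P Q = 0"
  then have eq: "P * pderiv Q = Q * pderiv P" by (simp add: wronskian_def)
  have const: "pderiv p = 0" if "coprime p q" "p * pderiv q = q * pderiv p" for p q :: "complex poly"
  proof (rule ccontr)
    assume nz: "pderiv p \<noteq> 0"
    have "p dvd pderiv p" using that by (metis coprime_dvd_mult_right_iff dvd_triv_left)
    then have "degree p \<le> degree (pderiv p)" using nz by (rule dvd_imp_degree_le)
    moreover have "degree p \<noteq> 0" using nz by (auto simp: pderiv_eq_0_iff)
    ultimately show False by (simp add: degree_pderiv)
  qed
  have "pderiv P = 0" "pderiv Q = 0" using const[of P Q] const[of Q P] PQ eq by (auto simp: coprime_commute)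
  then obtain c d where "P = [:c:]" "Q = [:d:]" by (metis pderiv_eq_0_iff degree_eq_zeroE)
  then show False using nonconst by (simp add: poly_vec_def)
qed

text \<open>At a multiple root the vector with entries \<open>poly Q s\<close> and
  \<open>- poly P s\<close> would solve the linear system given by the values and the derivatives of
  \<open>P\<close> and \<open>Q\<close> at \<open>t\<close>. Its determinant is the Wronskian, and
  the vector is nonzero.\<close>

lemma secant_simple_roots:
  assumes PQ: "coprime P Q" and t: "poly (secant P Q s) t = 0" "poly (wronskian P Q) t \<noteq> 0"
  shows "order t (secant P Q s) = 1"
proof -
  let ?q = "secant P Q s"
  have d: "poly (pderiv ?q) t = poly Q s * poly (pderiv P) t - poly P s * poly (pderiv Q) t"
    by (simp add: secant_def pderiv_diff pderiv_smult)
  have "poly (pderiv ?q) t \<noteq> 0"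
  proof
    assume 0: "poly (pderiv ?q) t = 0"
    have 1: "poly Q s * poly P t = poly P s * poly Q t" "poly Q s * poly (pderiv P) t = poly P s * poly (pderiv Q) t"
      using t(1) 0 d by (simp_all add: poly_secant)
    have "poly Q s * poly (wronskian P Q) t = 0" "poly P s * poly (wronskian P Q) t = 0"
    proof -
      have "poly Q s * poly (wronskian P Q) t
          = (poly Q s * poly P t) * poly (pderiv Q) t - poly Q t * (poly Q s * poly (pderiv P) t)"
        by (simp add: wronskian_def algebra_simps)
      also have "\<dots> = 0" unfolding 1 by (simp add: algebra_simps)
      finally show "poly Q s * poly (wronskian P Q) t = 0" .
      have "poly P s * poly (wronskian P Q) t
          = poly P t * (poly P s * poly (pderiv Q) t) - (poly P s * poly Q t) * poly (pderiv P) t"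
        by (simp add: wronskian_def algebra_simps)
      also have "\<dots> = 0" unfolding 1[symmetric] by (simp add: algebra_simps)
      finally show "poly P s * poly (wronskian P Q) t = 0" .
    qed
    then have "poly_vec P Q s = 0" using t(2) by (simp add: vec_eq_iff forall_2)
    then show False using poly_vec_nonzero[OF PQ] by blast
  qed
  moreover from this have "?q \<noteq> 0" "pderiv ?q \<noteq> 0" by auto
  ultimately show ?thesis
    using order_pderiv[of "pderiv ?q" t] order_pderiv[of ?q t] t(1) order_root[of ?q t] order_0I[of "pderiv ?q" t] by auto
qed

definition moebius_vec :: "complex \<Rightarrow> complex \<Rightarrow> complex \<Rightarrow> complex \<Rightarrow> complex ^ 2 \<Rightarrow> complex ^ 2" where
  "moebius_vec \<alpha> \<beta> \<gamma> \<delta> v = vector [\<alpha> * v $ 1 + \<beta> * v $ 2, \<gamma> * v $ 1 + \<delta> * v $ 2]"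

lemma moebius_vec_nth [simp]: "moebius_vec \<alpha> \<beta> \<gamma> \<delta> v $ 1 = \<alpha> * v $ 1 + \<beta> * v $ 2" "moebius_vec \<alpha> \<beta> \<gamma> \<delta> v $ 2 = \<gamma> * v $ 1 + \<delta> * v $ 2"
  by (simp_all add: moebius_vec_def)

lemma moebius_vec_scale: "moebius_vec \<alpha> \<beta> \<gamma> \<delta> (c *s v) = c *s moebius_vec \<alpha> \<beta> \<gamma> \<delta> v"
  by (simp add: vec_eq_iff forall_2 algebra_simps)

lemma moebius_vec_inverse:
  assumes "\<alpha> * \<delta> - \<beta> * \<gamma> \<noteq> 0"
  defines "d \<equiv> \<alpha> * \<delta> - \<beta> * \<gamma>"
  shows "moebius_vec (\<delta> / d) (- \<beta> / d) (- \<gamma> / d) (\<alpha> / d) (moebius_vec \<alpha> \<beta> \<gamma> \<delta> v) = v"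
    "(\<delta> / d) * (\<alpha> / d) - (- \<beta> / d) * (- \<gamma> / d) \<noteq> 0"
    "moebius_vec \<alpha> \<beta> \<gamma> \<delta> (moebius_vec (\<delta> / d) (- \<beta> / d) (- \<gamma> / d) (\<alpha> / d) v) = v"
proof -
  have d: "d \<noteq> 0" using assms by simp
  have D: "\<alpha> * \<delta> = d + \<beta> * \<gamma>" by (simp add: d_def)
  show "moebius_vec (\<delta> / d) (- \<beta> / d) (- \<gamma> / d) (\<alpha> / d) (moebius_vec \<alpha> \<beta> \<gamma> \<delta> v) = v"
    using d by (simp add: vec_eq_iff forall_2 field_simps) (simp add: d_def algebra_simps)
  show "moebius_vec \<alpha> \<beta> \<gamma> \<delta> (moebius_vec (\<delta> / d) (- \<beta> / d) (- \<gamma> / d) (\<alpha> / d) v) = v"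
    using d by (simp add: vec_eq_iff forall_2 field_simps) (simp add: d_def algebra_simps)
  have "(\<delta> / d) * (\<alpha> / d) - (- \<beta> / d) * (- \<gamma> / d) = (\<alpha> * \<delta> - \<beta> * \<gamma>) / (d * d)"
    by (simp add: diff_divide_distrib mult.commute)
  then show "(\<delta> / d) * (\<alpha> / d) - (- \<beta> / d) * (- \<gamma> / d) \<noteq> 0" using d assms(1) by simp
qed

text \<open>For \<open>s\<close> outside a finite set the two secant polynomials at \<open>s\<close> have the same roots, all of them
  simple, so they are proportional; two such values of \<open>s\<close> suffice to solve for \<open>P'\<close> and \<open>Q'\<close>.\<close>

lemma same_fibers_imp_linear:
  assumes PQ: "coprime P Q" "coprime P' Q'"
    and nonconst: "proj_point (poly_vec P Q t0) \<noteq> proj_point (poly_vec P Q t1)" "proj_point (poly_vec P' Q' t0) \<noteq> proj_point (poly_vec P' Q' t1)"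
    and fin: "finite Z" "finite A" "finite A'"
    and fib: "\<And>t s. t \<notin> Z \<Longrightarrow> s \<notin> Z \<Longrightarrow> proj_point (poly_vec P Q t) = proj_point (poly_vec P Q s) \<Longrightarrow>
         proj_point (poly_vec P Q s) \<notin> A \<Longrightarrow> proj_point (poly_vec P' Q' t) = proj_point (poly_vec P' Q' s)"
    and fib': "\<And>t s. t \<notin> Z \<Longrightarrow> s \<notin> Z \<Longrightarrow> proj_point (poly_vec P' Q' t) = proj_point (poly_vec P' Q' s) \<Longrightarrow>
         proj_point (poly_vec P' Q' s) \<notin> A' \<Longrightarrow> proj_point (poly_vec P Q t) = proj_point (poly_vec P Q s)"
  obtains \<alpha> \<beta> \<gamma> \<delta> where "\<alpha> * \<delta> - \<beta> * \<gamma> \<noteq> 0" "\<And>t. poly_vec P' Q' t = moebius_vec \<alpha> \<beta> \<gamma> \<delta> (poly_vec P Q t)"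
proof -
  let ?p = "\<lambda>t. proj_point (poly_vec P Q t)" and ?p' = "\<lambda>t. proj_point (poly_vec P' Q' t)"
  \<comment> \<open>Values are excluded rather than points: if the value at \<open>s\<close> is not
    in \<open>Y\<close>, the whole fiber through \<open>s\<close> avoids \<open>Z\<close> and the
    zeros of the Wronskian.\<close>
  define Y where "Y = A \<union> ?p ` (Z \<union> {t. poly (wronskian P Q) t = 0})"
  define Y' where "Y' = A' \<union> ?p' ` (Z \<union> {t. poly (wronskian P' Q') t = 0})"
  have fY: "finite Y" "finite Y'"
    unfolding Y_def Y'_def using fin poly_roots_finite wronskian_nonzero[OF PQ(1) nonconst(1)] wronskian_nonzero[OF PQ(2) nonconst(2)]
    by auto
  define Bad where "Bad = Z \<union> {t. ?p t \<in> Y} \<union> {t. ?p' t \<in> Y'}"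
  have fBad: "finite Bad"
    unfolding Bad_def using fin finite_poly_vec_preimage_set[OF PQ(1) nonconst(1) fY(1)] finite_poly_vec_preimage_set[OF PQ(2) nonconst(2) fY(2)]
    by auto
  have sec: "\<exists>c. secant P' Q' s = smult c (secant P Q s)" if s: "s \<notin> Bad" for s
  proof -
    have sn: "s \<notin> Z" "?p s \<notin> Y" "?p' s \<notin> Y'" using s by (auto simp: Bad_def)
    have nz: "secant P Q s \<noteq> 0" "secant P' Q' s \<noteq> 0"
      using nonconst poly_secant_eq_0_iff[OF PQ(1), of s] poly_secant_eq_0_iff[OF PQ(2), of s] poly_0 by metis+
    have iff: "poly (secant P Q s) t = 0 \<longleftrightarrow> poly (secant P' Q' s) t = 0" for t
      unfolding poly_secant_eq_0_iff[OF PQ(1)] poly_secant_eq_0_iff[OF PQ(2)]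
    proof
      assume e: "?p t = ?p s"
      then have "t \<notin> Z" using sn(2) unfolding Y_def by (metis UnCI image_eqI)
      from fib[OF this sn(1) e] show "?p' t = ?p' s" using sn(2) by (auto simp: Y_def)
    next
      assume e: "?p' t = ?p' s"
      then have "t \<notin> Z" using sn(3) unfolding Y'_def by (metis UnCI image_eqI)
      from fib'[OF this sn(1) e] show "?p t = ?p s" using sn(3) by (auto simp: Y'_def)
    qed
    have simple: "order t (secant P Q s) = 1" if r: "poly (secant P Q s) t = 0" for t
    proof (rule secant_simple_roots[OF PQ(1) r])
      have "?p t = ?p s" using r poly_secant_eq_0_iff[OF PQ(1)] by blast
      then show "poly (wronskian P Q) t \<noteq> 0" using sn(2) unfolding Y_def by (metis (mono_tags) UnCI image_eqI mem_Collect_eq)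
    qed
    have simple': "order t (secant P' Q' s) = 1" if r: "poly (secant P' Q' s) t = 0" for t
    proof (rule secant_simple_roots[OF PQ(2) r])
      have "?p' t = ?p' s" using r poly_secant_eq_0_iff[OF PQ(2)] by blast
      then show "poly (wronskian P' Q') t \<noteq> 0" using sn(3) unfolding Y'_def by (metis (mono_tags) UnCI image_eqI mem_Collect_eq)
    qed
    have "order t (secant P' Q' s) = order t (secant P Q s)" for t
      using iff[of t] simple[of t] simple'[of t] order_0I by metis
    from complex_poly_eq_smult[OF nz(2,1) this] show ?thesis by metis
  qed
  have "infinite (- Bad)" using fBad by (simp add: Compl_eq_Diff_UNIV Diff_infinite_finite infinite_UNIV_char_0)
  then obtain s1 where s1: "s1 \<notin> Bad" using not_finite_existsD by (metis ComplD infinite_imp_nonempty ex_in_conv)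
  have "finite (Bad \<union> {t. ?p' t = ?p' s1})" using fBad finite_poly_vec_preimage_set[OF PQ(2) nonconst(2), of "{?p' s1}"] by simp
  then have "infinite (- (Bad \<union> {t. ?p' t = ?p' s1}))" by (simp only: Compl_eq_Diff_UNIV) (simp add: Diff_infinite_finite infinite_UNIV_char_0)
  \<comment> \<open>A second point with another value under the second map makes the determinant
    \<open>?D\<close> of the linear system below nonzero.\<close>
  then obtain s2 where s2: "s2 \<notin> Bad" "?p' s2 \<noteq> ?p' s1" by (metis (mono_tags, lifting) ComplD UnCI infinite_imp_nonempty ex_in_conv mem_Collect_eq)
  obtain c1 where c1: "secant P' Q' s1 = smult c1 (secant P Q s1)" using sec[OF s1] by blast
  obtain c2 where c2: "secant P' Q' s2 = smult c2 (secant P Q s2)" using sec[OF s2(1)] by blast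
  define p1 q1 p2 q2 where "p1 = poly P' s1" and "q1 = poly Q' s1" and "p2 = poly P' s2" and "q2 = poly Q' s2"
  define a1 b1 a2 b2 where "a1 = poly P s1" and "b1 = poly Q s1" and "a2 = poly P s2" and "b2 = poly Q s2"
  have "poly (secant P' Q' s1) s2 \<noteq> 0" using s2(2) poly_secant_eq_0_iff[OF PQ(2)] by blast
  then have D: "q1 * p2 - p1 * q2 \<noteq> 0" (is "?D \<noteq> 0") by (simp add: poly_secant p1_def q1_def p2_def q2_def)
  have e1: "q1 * poly P' t - p1 * poly Q' t = c1 * (b1 * poly P t - a1 * poly Q t)" for t
    using arg_cong[OF c1, of "\<lambda>q. poly q t"] by (simp add: poly_secant p1_def q1_def a1_def b1_def)
  have e2: "q2 * poly P' t - p2 * poly Q' t = c2 * (b2 * poly P t - a2 * poly Q t)" for t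
    using arg_cong[OF c2, of "\<lambda>q. poly q t"] by (simp add: poly_secant p2_def q2_def a2_def b2_def)
  \<comment> \<open>Cramer's rule for \<open>e1\<close> and \<open>e2\<close> with the unknowns
    \<open>poly P' t\<close> and \<open>poly Q' t\<close>.\<close>
  define \<alpha> \<beta> where "\<alpha> = (p2 * c1 * b1 - p1 * c2 * b2) / ?D" and "\<beta> = (p1 * c2 * a2 - p2 * c1 * a1) / ?D"
  define \<gamma> \<delta> where "\<gamma> = (q2 * c1 * b1 - q1 * c2 * b2) / ?D" and "\<delta> = (q1 * c2 * a2 - q2 * c1 * a1) / ?D"
  have P': "poly P' t = \<alpha> * poly P t + \<beta> * poly Q t" for t
  proof -
    have "?D * poly P' t = p2 * (q1 * poly P' t - p1 * poly Q' t) - p1 * (q2 * poly P' t - p2 * poly Q' t)"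
      by (simp add: algebra_simps)
    also have "\<dots> = (?D * \<alpha>) * poly P t + (?D * \<beta>) * poly Q t"
      unfolding e1 e2 using D by (simp add: \<alpha>_def \<beta>_def) (simp add: algebra_simps)
    finally have "?D * poly P' t = ?D * (\<alpha> * poly P t + \<beta> * poly Q t)" by (simp add: algebra_simps)
    then show ?thesis using D by simp
  qed
  have Q': "poly Q' t = \<gamma> * poly P t + \<delta> * poly Q t" for t
  proof -
    have "?D * poly Q' t = q2 * (q1 * poly P' t - p1 * poly Q' t) - q1 * (q2 * poly P' t - p2 * poly Q' t)"
      by (simp add: algebra_simps)
    also have "\<dots> = (?D * \<gamma>) * poly P t + (?D * \<delta>) * poly Q t"
      unfolding e1 e2 using D by (simp add: \<gamma>_def \<delta>_def) (simp add: algebra_simps)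
    finally have "?D * poly Q' t = ?D * (\<gamma> * poly P t + \<delta> * poly Q t)" by (simp add: algebra_simps)
    then show ?thesis using D by simp
  qed
  \<comment> \<open>The secant is a determinant, so a linear substitution multiplies it by the
    determinant of that substitution.\<close>
  have "poly (secant P' Q' s1) s2 = (\<alpha> * \<delta> - \<beta> * \<gamma>) * poly (secant P Q s1) s2"
    unfolding poly_secant P' Q' by (simp add: algebra_simps)
  then have "\<alpha> * \<delta> - \<beta> * \<gamma> \<noteq> 0" using \<open>poly (secant P' Q' s1) s2 \<noteq> 0\<close> by auto
  moreover have "poly_vec P' Q' t = moebius_vec \<alpha> \<beta> \<gamma> \<delta> (poly_vec P Q t)" for t
    by (simp add: vec_eq_iff forall_2 moebius_vec_def P' Q')
  ultimately show ?thesis using that by blast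
qed

section \<open>Moebius transformations as regular maps of the projective line\<close>

definition moebius :: "complex \<Rightarrow> complex \<Rightarrow> complex \<Rightarrow> complex \<Rightarrow> 2 cproj \<Rightarrow> 2 cproj" where
  "moebius \<alpha> \<beta> \<gamma> \<delta> y = proj_point (moebius_vec \<alpha> \<beta> \<gamma> \<delta> (rep_vec y))"

lemma moebius_vec_nonzero:
  assumes "\<alpha> * \<delta> - \<beta> * \<gamma> \<noteq> 0" "v \<noteq> 0" shows "moebius_vec \<alpha> \<beta> \<gamma> \<delta> v \<noteq> 0"
proof
  assume 0: "moebius_vec \<alpha> \<beta> \<gamma> \<delta> v = 0"
  have "moebius_vec (\<delta> / (\<alpha> * \<delta> - \<beta> * \<gamma>)) (- \<beta> / (\<alpha> * \<delta> - \<beta> * \<gamma>)) (- \<gamma> / (\<alpha> * \<delta> - \<beta> * \<gamma>)) (\<alpha> / (\<alpha> * \<delta> - \<beta> * \<gamma>)) 0 = v"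
    using moebius_vec_inverse(1)[OF assms(1), of v] unfolding 0 .
  moreover have "moebius_vec a b c d 0 = 0" for a b c d by (simp add: vec_eq_iff forall_2)
  ultimately show False using assms(2) by simp
qed

lemma moebius_proj_point:
  assumes "\<alpha> * \<delta> - \<beta> * \<gamma> \<noteq> 0" "v \<noteq> 0"
  shows "moebius \<alpha> \<beta> \<gamma> \<delta> (proj_point v) = proj_point (moebius_vec \<alpha> \<beta> \<gamma> \<delta> v)"
proof -
  obtain c where c: "v = c *s rep_vec (proj_point v)"
    using proj_point_eq_iff[OF rep_vec(1) assms(2)] rep_vec(2) by metis
  then have "c \<noteq> 0" using assms(2) by auto
  then show ?thesis
    unfolding moebius_def by (subst (2) c) (simp only: moebius_vec_scale proj_point_scale moebius_vec_nonzero[OF assms(1) rep_vec(1)] not_False_eq_True)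
qed

lemma moebius_inverse:
  assumes "\<alpha> * \<delta> - \<beta> * \<gamma> \<noteq> 0"
  obtains a b c d where "a * d - b * c \<noteq> 0" "\<And>y. moebius a b c d (moebius \<alpha> \<beta> \<gamma> \<delta> y) = y" "\<And>y. moebius \<alpha> \<beta> \<gamma> \<delta> (moebius a b c d y) = y"
proof -
  let ?d = "\<alpha> * \<delta> - \<beta> * \<gamma>"
  note inv = moebius_vec_inverse[OF assms]
  show ?thesis
  proof (rule that[of "\<delta> / ?d" "\<alpha> / ?d" "- \<beta> / ?d" "- \<gamma> / ?d"])
    show "\<delta> / ?d * (\<alpha> / ?d) - - \<beta> / ?d * (- \<gamma> / ?d) \<noteq> 0" by (rule inv(2))
    fix y :: "2 cproj"
    obtain v where v: "v \<noteq> 0" "y = proj_point v" using proj_point_cases by blast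
    show "moebius (\<delta> / ?d) (- \<beta> / ?d) (- \<gamma> / ?d) (\<alpha> / ?d) (moebius \<alpha> \<beta> \<gamma> \<delta> y) = y"
      unfolding v(2) by (simp only: moebius_proj_point assms inv v(1) moebius_vec_nonzero not_False_eq_True)
    show "moebius \<alpha> \<beta> \<gamma> \<delta> (moebius (\<delta> / ?d) (- \<beta> / ?d) (- \<gamma> / ?d) (\<alpha> / ?d) y) = y"
      unfolding v(2) by (simp only: moebius_proj_point assms inv v(1) moebius_vec_nonzero not_False_eq_True)
  qed
qed

lemma homogeneous_poly_linear: "homogeneous_poly 1 (\<lambda>v :: complex ^ 2. a * v $ 1 + b * v $ 2)"
proof -
  define m where "m k = (\<lambda>i::2. if i = k then 1 else 0 :: nat)" for k
  have "m 1 1 \<noteq> m 2 1" by (simp add: m_def)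
  then have ne: "m 1 \<noteq> m 2" by metis
  show ?thesis
    unfolding homogeneous_poly_def
  proof (intro exI[of _ "{m 1, m 2}"] exI[of _ "\<lambda>k. if k = m 1 then a else b"] conjI ballI)
    show "(\<Sum>i\<in>UNIV. n i) = 1" if "n \<in> {m 1, m 2}" for n using that by (auto simp: m_def sum_2)
    show "(\<lambda>v. a * v $ 1 + b * v $ 2) = (\<lambda>v. \<Sum>k\<in>{m 1, m 2}. (if k = m 1 then a else b) * (\<Prod>i\<in>UNIV. v $ i ^ k i))"
      using ne by (simp add: UNIV_2) (simp add: m_def)
  qed simp
qed

lemma homogeneous_poly_const: "homogeneous_poly 0 (\<lambda>v. a)"
  unfolding homogeneous_poly_def
  by (intro exI[of _ "{\<lambda>i. 0}"] exI[of _ "\<lambda>k. a"]) simp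

lemma regular_map_moebius:
  assumes "\<alpha> * \<delta> - \<beta> * \<gamma> \<noteq> 0" "moebius \<alpha> \<beta> \<gamma> \<delta> ` X \<subseteq> Y"
  shows "regular_map X Y (moebius \<alpha> \<beta> \<gamma> \<delta>)"
  unfolding regular_map_def
proof (intro conjI allI impI)
  show "moebius \<alpha> \<beta> \<gamma> \<delta> ` X \<subseteq> Y" by (rule assms)
  fix u :: "complex ^ 2"
  have "homogeneous_poly 1 (\<lambda>v. moebius_vec \<alpha> \<beta> \<gamma> \<delta> v $ j)" for j :: 2
  proof (cases "j = 1")
    case False
    then have "j = 2" using exhaust_2[of j] by blast
    then show ?thesis by (simp only: moebius_vec_nth homogeneous_poly_linear)
  qed (simp only: moebius_vec_nth homogeneous_poly_linear)
  then show "\<exists>d e h F. (\<forall>j. homogeneous_poly d (\<lambda>v. F v $ j)) \<and> homogeneous_poly e h \<and> h u \<noteq> 0 \<and>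
      (\<forall>v. v \<noteq> 0 \<and> proj_point v \<in> X \<and> h v \<noteq> 0 \<longrightarrow> F v \<noteq> 0 \<and> moebius \<alpha> \<beta> \<gamma> \<delta> (proj_point v) = proj_point (F v))"
    using homogeneous_poly_const[of 1] moebius_proj_point[OF assms(1)] moebius_vec_nonzero[OF assms(1)]
    by (intro exI[of _ 1] exI[of _ 0] exI[of _ "\<lambda>_. 1"] exI[of _ "moebius_vec \<alpha> \<beta> \<gamma> \<delta>"]) simp
qed

lemma infinite_cproj2: "infinite (UNIV :: 2 cproj set)"
proof
  assume fin: "finite (UNIV :: 2 cproj set)"
  have nz: "vector [1, c] \<noteq> (0 :: complex ^ 2)" for c by (metis vector_2(1) zero_index zero_neq_one)
  have "inj (\<lambda>c. proj_point (vector [1, c] :: complex ^ 2))"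
    by (rule injI) (use proj_point_eq_det[OF nz nz] in auto)
  then have "finite (UNIV :: complex set)" using fin by (metis finite_imageD finite_subset subset_UNIV)
  then show False by (simp add: infinite_UNIV_char_0)
qed

text \<open>If two values were missed on the whole affine line, their forms would be polynomials
  without zeros, hence constant by the fundamental theorem of algebra, and so would be their ratio,
  which is a coordinate on the target. So at most one value is missed, and \<open>Z\<close> accounts
  for finitely many more.\<close>

lemma finite_missed_values:
  assumes PQ: "coprime P Q" and nonconst: "proj_point (poly_vec P Q t0) \<noteq> proj_point (poly_vec P Q t1)" and Z: "finite Z"
  shows "finite {y. \<forall>t. t \<notin> Z \<longrightarrow> proj_point (poly_vec P Q t) \<noteq> y}"
proof -
  let ?p = "\<lambda>t. proj_point (poly_vec P Q t)"
  have uniq: "y1 = y2" if "\<And>t. ?p t \<noteq> y1" "\<And>t. ?p t \<noteq> y2" for y1 y2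
  proof (rule ccontr)
    assume ne: "y1 \<noteq> y2"
    have const: "poly (lin_form_poly y P Q) t0 = poly (lin_form_poly y P Q) t1" if "\<And>t. ?p t \<noteq> y" for y
    proof -
      have "poly (lin_form_poly y P Q) t \<noteq> 0" for t using that poly_lin_form_poly_eq_0_iff[OF PQ] by blast
      then have "constant (poly (lin_form_poly y P Q))" using fundamental_theorem_of_algebra by metis
      then show ?thesis by (simp add: constant_def)
    qed
    have 1: "lin_form y1 (poly_vec P Q t0) = lin_form y1 (poly_vec P Q t1)" "lin_form y2 (poly_vec P Q t0) = lin_form y2 (poly_vec P Q t1)"
      using const[OF that(1)] const[OF that(2)] by (simp_all add: poly_lin_form_poly)
    have "lin_form_ratio y1 y2 (?p t0) = lin_form_ratio y1 y2 (?p t1)"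
      by (simp add: lin_form_ratio_proj_point poly_vec_nonzero[OF PQ] 1)
    then have "?p t0 = ?p t1" by (rule lin_form_ratio_inj[OF ne that(2) that(2)])
    then show False using nonconst by blast
  qed
  have "finite {y. \<forall>t. ?p t \<noteq> y}"
  proof (cases "\<exists>y. \<forall>t. ?p t \<noteq> y")
    case True
    then obtain y where "\<forall>t. ?p t \<noteq> y" by blast
    then have "{y. \<forall>t. ?p t \<noteq> y} \<subseteq> {y}" using uniq by auto
    then show ?thesis by (rule finite_subset) simp
  next
    case False
    then have "{y. \<forall>t. ?p t \<noteq> y} = {}" by auto
    then show ?thesis by (simp only: finite.emptyI)
  qed
  moreover have "{y. \<forall>t. t \<notin> Z \<longrightarrow> ?p t \<noteq> y} \<subseteq> {y. \<forall>t. ?p t \<noteq> y} \<union> ?p ` Z" by auto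
  ultimately show ?thesis using Z by (meson finite_Un finite_imageI finite_subset)
qed


text \<open>Each line yields its own Moebius transformation, and one reference line fixes
  \<open>\<phi>\<close>. Since that line attains all but finitely many values of the target, a
  generic point of another line shares its value under \<open>f\<close> with a point of the
  reference line, and \<open>fib\<close> carries this over to \<open>f'\<close>. Agreement at
  infinitely many parameters is a polynomial identity, which also covers the exceptional
  fibers.\<close>

lemma biregular_of_same_fibers:
  fixes B B' :: "2 cproj set"
  assumes C: "plane_curve C"
    and f: "regular_map (- C) (- B) f" "f ` (- C) = - B" and f': "regular_map (- C) (- B') f'" "f' ` (- C) = - B'"
    and fin: "finite B" "finite B'" "finite A" "finite A'"
    and fib: "\<And>x x'. x \<in> - C \<Longrightarrow> x' \<in> - C \<Longrightarrow> f x = f x' \<Longrightarrow> f x' \<notin> A \<Longrightarrow> f' x = f' x'"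
    and fib': "\<And>x x'. x \<in> - C \<Longrightarrow> x' \<in> - C \<Longrightarrow> f' x = f' x' \<Longrightarrow> f' x' \<notin> A' \<Longrightarrow> f x = f x'"
  shows "\<exists>\<phi>. biregular_map (- B) (- B') \<phi> \<and> (\<forall>x \<in> - C. f' x = \<phi> (f x))"
proof -
  obtain d0 g where g: "homogeneous_poly d0 g" "\<And>v. v \<noteq> 0 \<Longrightarrow> proj_point v \<in> C \<longleftrightarrow> g v = 0"
    using plane_curveE[OF C] by blast
  have line: "\<exists>a z t0 t1 P Q P' Q'. finite {t. proj_point (a + t *s z) \<in> C} \<and>
      x = proj_point (a + t0 *s z) \<and> x' = proj_point (a + t1 *s z) \<and>
      line_rep C f a z P Q \<and> line_rep C f' a z P' Q'"
    if x: "x \<notin> C" "x' \<notin> C" "x \<noteq> x'" for x x'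
  proof -
    obtain a z t0 t1 where L: "z \<noteq> 0" "proj_point z \<notin> C" "\<And>t. a + t *s z \<noteq> 0"
      "x = proj_point (a + t0 *s z)" "x' = proj_point (a + t1 *s z)"
      by (rule two_points_line[OF g x]) (assumption, rule that)
    obtain P Q D where PQ: "line_rep C f a z P Q" "\<And>b. b \<in> B \<Longrightarrow> lin_form_poly b P Q \<noteq> 0 \<and> degree (lin_form_poly b P Q) = D"
      by (rule regular_map_on_line[OF g L(1-3) f(1)]) (assumption, rule that)
    obtain P' Q' D' where PQ': "line_rep C f' a z P' Q'" "\<And>b. b \<in> B' \<Longrightarrow> lin_form_poly b P' Q' \<noteq> 0 \<and> degree (lin_form_poly b P' Q') = D'"
      by (rule regular_map_on_line[OF g L(1-3) f'(1)]) (assumption, rule that)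
    show ?thesis using L PQ(1) PQ'(1) finite_line_curve[OF g L(1-3)] by blast
  qed
  \<comment> \<open>The line through \<open>x\<close> and \<open>x1\<close> must be one on which
    neither map is constant. Surjectivity gives a suitable point for each map separately; a generic
    point of the line joining the two serves both.\<close>
  have other: "\<exists>x1. x1 \<notin> C \<and> f x1 \<noteq> f x \<and> f' x1 \<noteq> f' x" for x
  proof -
    have inf: "\<exists>y\<in>- Y. y \<noteq> w" if "finite Y" for Y and w :: "2 cproj"
    proof -
      have "finite (insert w Y)" using that by simp
      then have "insert w Y \<noteq> UNIV" using infinite_cproj2 by metis
      then show ?thesis by blast
    qed
    obtain x2 where x2: "x2 \<notin> C" "f x2 \<noteq> f x" using inf[OF fin(1), of "f x"] f(2) by (metis ComplD imageE)
    obtain x3 where x3: "x3 \<notin> C" "f' x3 \<noteq> f' x" using inf[OF fin(2), of "f' x"] f'(2) by (metis ComplD imageE)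
    show ?thesis
    proof (cases "x2 = x3")
      case True then show ?thesis using x2 x3 by blast
    next
      case False
      obtain a z t0 t1 P Q P' Q' where L: "finite {t. proj_point (a + t *s z) \<in> C}"
        "x2 = proj_point (a + t0 *s z)" "x3 = proj_point (a + t1 *s z)"
        "line_rep C f a z P Q" "line_rep C f' a z P' Q'"
        using line[OF x2(1) x3(1) False] by blast
      note v = line_repD(2)[OF L(4)] and v' = line_repD(2)[OF L(5)]
      have "proj_point (poly_vec P Q t0) \<noteq> f x" "proj_point (poly_vec P' Q' t1) \<noteq> f' x"
        using v[of t0] v'[of t1] x2 x3 L(2,3) by auto
      then have "finite ({t. proj_point (a + t *s z) \<in> C} \<union> {t. proj_point (poly_vec P Q t) = f x} \<union> {t. proj_point (poly_vec P' Q' t) = f' x})"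
        using L(1) finite_poly_vec_preimage line_repD(1)[OF L(4)] line_repD(1)[OF L(5)] by simp
      from ex_new_if_finite[OF infinite_UNIV_char_0 this]
      obtain t where t: "proj_point (a + t *s z) \<notin> C" "proj_point (poly_vec P Q t) \<noteq> f x" "proj_point (poly_vec P' Q' t) \<noteq> f' x"
        by blast
      then show ?thesis using v[OF t(1)] v'[OF t(1)] by metis
    qed
  qed
  have lin_on_line: "\<exists>a z t0 P Q \<alpha> \<beta> \<gamma> \<delta>. finite {t. proj_point (a + t *s z) \<in> C} \<and> x = proj_point (a + t0 *s z) \<and>
      line_rep C f a z P Q \<and> (\<exists>t1. proj_point (poly_vec P Q t0) \<noteq> proj_point (poly_vec P Q t1)) \<and> \<alpha> * \<delta> - \<beta> * \<gamma> \<noteq> 0 \<and>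
      (\<forall>t. proj_point (a + t *s z) \<notin> C \<longrightarrow> f' (proj_point (a + t *s z)) = proj_point (moebius_vec \<alpha> \<beta> \<gamma> \<delta> (poly_vec P Q t)))"
    if x: "x \<notin> C" for x
  proof -
    obtain x1 where x1: "x1 \<notin> C" "f x1 \<noteq> f x" "f' x1 \<noteq> f' x" using other by blast
    then have "x \<noteq> x1" by auto
    from line[OF x x1(1) this] obtain a z t0 t1 P Q P' Q' where L: "finite {t. proj_point (a + t *s z) \<in> C}"
        "x = proj_point (a + t0 *s z)" "x1 = proj_point (a + t1 *s z)"
        "line_rep C f a z P Q" "line_rep C f' a z P' Q'" by blast
    note v = line_repD(2)[OF L(4)] and v' = line_repD(2)[OF L(5)]
    have nc: "proj_point (poly_vec P Q t0) \<noteq> proj_point (poly_vec P Q t1)" "proj_point (poly_vec P' Q' t0) \<noteq> proj_point (poly_vec P' Q' t1)"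
      using v[of t0] v[of t1] v'[of t0] v'[of t1] L(2,3) x x1 by auto
    obtain \<alpha> \<beta> \<gamma> \<delta> where m: "\<alpha> * \<delta> - \<beta> * \<gamma> \<noteq> 0" "\<And>t. poly_vec P' Q' t = moebius_vec \<alpha> \<beta> \<gamma> \<delta> (poly_vec P Q t)"
    proof (rule same_fibers_imp_linear[OF line_repD(1)[OF L(4)] line_repD(1)[OF L(5)] nc L(1) fin(3,4)])
      fix t s assume ts: "t \<notin> {t. proj_point (a + t *s z) \<in> C}" "s \<notin> {t. proj_point (a + t *s z) \<in> C}"
      then have ts': "proj_point (a + t *s z) \<in> - C" "proj_point (a + s *s z) \<in> - C" by auto
      then have V: "f (proj_point (a + t *s z)) = proj_point (poly_vec P Q t)" "f (proj_point (a + s *s z)) = proj_point (poly_vec P Q s)"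
        "f' (proj_point (a + t *s z)) = proj_point (poly_vec P' Q' t)" "f' (proj_point (a + s *s z)) = proj_point (poly_vec P' Q' s)"
        using v v' by auto
      show "proj_point (poly_vec P' Q' t) = proj_point (poly_vec P' Q' s)"
        if "proj_point (poly_vec P Q t) = proj_point (poly_vec P Q s)" "proj_point (poly_vec P Q s) \<notin> A"
        using fib[OF ts'] that unfolding V by blast
      show "proj_point (poly_vec P Q t) = proj_point (poly_vec P Q s)"
        if "proj_point (poly_vec P' Q' t) = proj_point (poly_vec P' Q' s)" "proj_point (poly_vec P' Q' s) \<notin> A'"
        using fib'[OF ts'] that unfolding V by blast
    qed (rule that)
    have "f' (proj_point (a + t *s z)) = proj_point (moebius_vec \<alpha> \<beta> \<gamma> \<delta> (poly_vec P Q t))" if "proj_point (a + t *s z) \<notin> C" for t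
      using v'[OF that] m(2) by simp
    then show ?thesis using L nc(1) m(1) by blast
  qed
  obtain v0 where "g v0 \<noteq> 0" "v0 \<noteq> 0"
  proof -
    have "- B \<noteq> {}" using fin(1) infinite_cproj2 by (metis Compl_empty_eq double_complement)
    then have "- C \<noteq> {}" using f(2) by auto
    then obtain x where "x \<notin> C" by blast
    obtain v where "v \<noteq> 0" "x = proj_point v" using proj_point_cases by blast
    then show ?thesis using that g(2) \<open>x \<notin> C\<close> by blast
  qed
  then have "proj_point v0 \<notin> C" using g(2) by blast
  from lin_on_line[OF this] obtain a0 z0 s0 s1 P0 Q0 \<alpha>0 \<beta>0 \<gamma>0 \<delta>0 where L0: "finite {t. proj_point (a0 + t *s z0) \<in> C}"
    "line_rep C f a0 z0 P0 Q0" "proj_point (poly_vec P0 Q0 s0) \<noteq> proj_point (poly_vec P0 Q0 s1)" "\<alpha>0 * \<delta>0 - \<beta>0 * \<gamma>0 \<noteq> 0"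
    "\<And>t. proj_point (a0 + t *s z0) \<notin> C \<Longrightarrow> f' (proj_point (a0 + t *s z0)) = proj_point (moebius_vec \<alpha>0 \<beta>0 \<gamma>0 \<delta>0 (poly_vec P0 Q0 t))"
    by blast
  let ?\<phi> = "moebius \<alpha>0 \<beta>0 \<gamma>0 \<delta>0"
  let ?badL = "{t. proj_point (a0 + t *s z0) \<in> C}"
  have main: "f' x = ?\<phi> (f x)" if x: "x \<in> - C" for x
  proof -
    have xC: "x \<notin> C" using x by simp
    from lin_on_line[OF this] obtain a z t0 t1 P Q \<alpha> \<beta> \<gamma> \<delta> where L: "finite {t. proj_point (a + t *s z) \<in> C}"
      "x = proj_point (a + t0 *s z)" "line_rep C f a z P Q" "proj_point (poly_vec P Q t0) \<noteq> proj_point (poly_vec P Q t1)"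
      "\<alpha> * \<delta> - \<beta> * \<gamma> \<noteq> 0"
      "\<And>t. proj_point (a + t *s z) \<notin> C \<Longrightarrow> f' (proj_point (a + t *s z)) = proj_point (moebius_vec \<alpha> \<beta> \<gamma> \<delta> (poly_vec P Q t))"
      by blast
    have PQ: "coprime P Q" and PQ0: "coprime P0 Q0" using line_repD(1) L(3) L0(2) by blast+
    let ?p = "\<lambda>t. proj_point (poly_vec P Q t)"
    let ?Z = "{t. proj_point (a + t *s z) \<in> C}"
    define Y where "Y = A \<union> {y. \<forall>t. t \<notin> ?badL \<longrightarrow> proj_point (poly_vec P0 Q0 t) \<noteq> y}"
    have fY: "finite Y" unfolding Y_def using fin(3) finite_missed_values[OF PQ0 L0(3) L0(1)] by simp
    have finBad: "finite (?Z \<union> {t. ?p t \<in> Y})" using L(1) finite_poly_vec_preimage_set[OF PQ L(4) fY] by simp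
    \<comment> \<open>The determinant of two image vectors: one from the transformation of this
      line, one from that of the reference line.\<close>
    define R where "R = (smult \<gamma> P + smult \<delta> Q) * (smult \<alpha>0 P + smult \<beta>0 Q) - (smult \<alpha> P + smult \<beta> Q) * (smult \<gamma>0 P + smult \<delta>0 Q)"
    have Riff: "poly R t = 0 \<longleftrightarrow> proj_point (moebius_vec \<alpha> \<beta> \<gamma> \<delta> (poly_vec P Q t)) = ?\<phi> (?p t)" for t
      unfolding moebius_proj_point[OF L0(4) poly_vec_nonzero[OF PQ]]
        proj_point_eq_det[OF moebius_vec_nonzero[OF L(5) poly_vec_nonzero[OF PQ]] moebius_vec_nonzero[OF L0(4) poly_vec_nonzero[OF PQ]]]
      by (simp add: R_def)
    have "poly R t = 0" if t: "t \<notin> ?Z \<union> {t. ?p t \<in> Y}" for t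
    proof -
      have t1: "proj_point (a + t *s z) \<in> - C" "?p t \<notin> A" using t by (auto simp: Y_def)
      obtain s where s: "s \<notin> ?badL" "proj_point (poly_vec P0 Q0 s) = ?p t" using t by (auto simp: Y_def)
      have s1: "proj_point (a0 + s *s z0) \<in> - C" using s(1) by auto
      have ft: "f (proj_point (a + t *s z)) = ?p t" "f (proj_point (a0 + s *s z0)) = ?p t"
        using line_repD(2)[OF L(3), of t] line_repD(2)[OF L0(2), of s] t1 s1 s(2) by auto
      have "f' (proj_point (a + t *s z)) = f' (proj_point (a0 + s *s z0))"
        by (rule fib[OF t1(1) s1]) (use ft t1(2) in auto)
      then have "proj_point (moebius_vec \<alpha> \<beta> \<gamma> \<delta> (poly_vec P Q t)) = proj_point (moebius_vec \<alpha>0 \<beta>0 \<gamma>0 \<delta>0 (poly_vec P0 Q0 s))"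
        using L(6)[of t] L0(5)[of s] t1 s1 by simp
      also have "\<dots> = ?\<phi> (?p t)"
        unfolding s(2)[symmetric] by (rule moebius_proj_point[OF L0(4) poly_vec_nonzero[OF PQ0], symmetric])
      finally show ?thesis using Riff by blast
    qed
    then have "- (?Z \<union> {t. ?p t \<in> Y}) \<subseteq> {t. poly R t = 0}" by blast
    moreover have "infinite (- (?Z \<union> {t. ?p t \<in> Y}))"
      using finBad by (metis Compl_eq_Diff_UNIV Diff_infinite_finite infinite_UNIV_char_0)
    ultimately have "infinite {t. poly R t = 0}" using finite_subset by blast
    then have "R = 0" using poly_roots_finite by blast
    \<comment> \<open>\<open>t0\<close> may be among the excluded parameters; it is covered because
      \<open>R\<close> is the zero polynomial.\<close>
    then have "proj_point (moebius_vec \<alpha> \<beta> \<gamma> \<delta> (poly_vec P Q t0)) = ?\<phi> (?p t0)" using Riff[of t0] by simp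
    then show ?thesis using L(6)[of t0] line_repD(2)[OF L(3), of t0] xC L(2) by simp
  qed
  obtain a b c d where inv: "a * d - b * c \<noteq> 0" "\<And>y. moebius a b c d (?\<phi> y) = y" "\<And>y. ?\<phi> (moebius a b c d y) = y"
    using moebius_inverse[OF L0(4)] by metis
  have 1: "?\<phi> ` (- B) \<subseteq> - B'"
  proof
    fix y assume "y \<in> ?\<phi> ` (- B)"
    then obtain x where "x \<in> - C" "y = ?\<phi> (f x)" unfolding f(2)[symmetric] by blast
    then show "y \<in> - B'" using main f'(2) by (metis image_eqI)
  qed
  have 2: "moebius a b c d ` (- B') \<subseteq> - B"
  proof
    fix y assume "y \<in> moebius a b c d ` (- B')"
    then obtain x where "x \<in> - C" "y = moebius a b c d (f' x)" unfolding f'(2)[symmetric] by blast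
    then show "y \<in> - B" using main inv(2) f(2) by (metis image_eqI)
  qed
  have "biregular_map (- B) (- B') ?\<phi>"
    unfolding biregular_map_def
    using regular_map_moebius[OF L0(4) 1] regular_map_moebius[OF inv(1) 2] inv(2,3) by blast
  then show ?thesis using main by blast
qed

text \<open>The dimension bound enters through the number of punctures: it provides two distinct
  points of \<open>B\<close>, the zero and the pole of a coordinate on the target.\<close>

lemma associated_mapD:
  assumes "associated_map C E B f" "lin_dim complex_ring (cohomology 1 (top_of_set (- C))) E \<ge> 2"
  obtains j k A where "finite B" "j \<in> B" "k \<in> B" "j \<noteq> k" "regular_map (- C) (- B) f" "f ` (- C) = - B"
    "finite A" "\<And>y. y \<in> - B - A \<Longrightarrow> connected {x \<in> - C. f x = y}"
    "corresponding_component (top_of_set (- C)) E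
        (pullback_char (top_of_set (- C)) (top_of_set (- B)) f ` char_torus (top_of_set (- B)))"
proof -
  have *: "finite B" "enat (card B) = lin_dim complex_ring (cohomology 1 (top_of_set (- C))) E + 1"
    "regular_map (- C) (- B) f" "f ` (- C) = - B" "connected_generic_fiber (- C) (- B) f"
    "corresponding_component (top_of_set (- C)) E
        (pullback_char (top_of_set (- C)) (top_of_set (- B)) f ` char_torus (top_of_set (- B)))"
    using assms(1) unfolding associated_map_def Let_def by blast+
  have "enat 2 \<le> lin_dim complex_ring (cohomology 1 (top_of_set (- C))) E"
    using assms(2) by (simp add: numeral_eq_enat)
  also have "\<dots> \<le> enat (card B)" unfolding *(2) by simp
  finally have "\<not> card B \<le> Suc 0" by simp
  then obtain j k where "j \<in> B" "k \<in> B" "j \<noteq> k" using card_le_Suc0_iff_eq[OF *(1)] by blast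
  moreover obtain A where "finite A" "\<And>y. y \<in> - B - A \<Longrightarrow> connected {x \<in> - C. f x = y}"
    using *(5) unfolding connected_generic_fiber_def by blast
  ultimately show ?thesis using that * by blast
qed

text \<open>The target curve is given only up to isomorphism. That \<open>E\<close> determines the
  map therefore means that two associated maps differ by an isomorphism of their targets.\<close>

theorem proposition3p23:
  fixes C :: "3 cproj set"
    and E :: "3 cproj cochain set set"
    and B B' :: "2 cproj set"
    and f f' :: "3 cproj \<Rightarrow> 2 cproj"
  assumes "plane_curve C"
    and "maximal_isotropic (top_of_set (- C)) E"
    and "lin_dim complex_ring (cohomology 1 (top_of_set (- C))) E \<ge> 2"
    and "associated_map C E B f"
    and "associated_map C E B' f'"
  shows "\<exists>\<phi>. biregular_map (- B) (- B') \<phi> \<and> (\<forall>x \<in> - C. f' x = \<phi> (f x))"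
proof -
  obtain j k A where 1: "finite B" "j \<in> B" "k \<in> B" "j \<noteq> k" "regular_map (- C) (- B) f" "f ` (- C) = - B"
    "finite A" "\<And>y. y \<in> - B - A \<Longrightarrow> connected {x \<in> - C. f x = y}"
    "corresponding_component (top_of_set (- C)) E
        (pullback_char (top_of_set (- C)) (top_of_set (- B)) f ` char_torus (top_of_set (- B)))"
    by (rule associated_mapD[OF assms(4,3)]) (rule that)
  obtain j' k' A' where 2: "finite B'" "j' \<in> B'" "k' \<in> B'" "j' \<noteq> k'" "regular_map (- C) (- B') f'" "f' ` (- C) = - B'"
    "finite A'" "\<And>y. y \<in> - B' - A' \<Longrightarrow> connected {x \<in> - C. f' x = y}"
    "corresponding_component (top_of_set (- C)) E
        (pullback_char (top_of_set (- C)) (top_of_set (- B')) f' ` char_torus (top_of_set (- B')))"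
    by (rule associated_mapD[OF assms(5,3)]) (rule that)
  show ?thesis
  \<comment> \<open>Constancy on fibers is applied in both directions, with the roles of
    \<open>f\<close> and \<open>f'\<close> exchanged. \<open>A\<close> and \<open>A'\<close> contain
    the values whose fibers may be disconnected.\<close>
  proof (rule biregular_of_same_fibers[OF assms(1) 1(5,6) 2(5,6) 1(1) 2(1) 1(7) 2(7)])
    fix x x' assume x: "x \<in> - C" "x' \<in> - C"
    show "f' x = f' x'" if eq: "f x = f x'" and nA: "f x' \<notin> A"
    proof (rule constant_on_fiber[OF assms(1) 1(5) 2(5) 1(1) 2(1-4) 1(9) 2(9) _ x eq refl])
      show "connected {x \<in> - C. f x = f x'}" using 1(6,8) nA x by blast
    qed
    show "f x = f x'" if eq: "f' x = f' x'" and nA: "f' x' \<notin> A'"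
    proof (rule constant_on_fiber[OF assms(1) 2(5) 1(5) 2(1) 1(1-4) 2(9) 1(9) _ x eq refl])
      show "connected {x \<in> - C. f' x = f' x'}" using 2(6,8) nA x by blast
    qed
  qed
qed

end
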